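(* Let $L$ and $E$ be holomorphic line bundles over an $n$-dimensional compact complex manifold $X$. Suppose $R$ and $P$ are positive Hermitian algebraic functions on $L$ and $E$ respectively, such that $R$ satisfies the strong global Cauchy-Schwarz (SGCS) condition. Let $\Omega$ be the volume form on $X$ induced from $R$, and let $C>0$ be a constant such that for all $m\in\mathbb N$ and all $s\in H^0(X,L^m\otimes E)$, $$\left|\mathbf K_{R^mP,\Omega}(s,s)-\frac{\pi^n}{m^n}\|s\|_2^2\right|\le \frac{C}{m^{n+1}}\|s\|_2^2,$$ where $\|s\|_2$ is the $L^2$ norm of $s$ with respect to $R^mP$ and $\Omega$. Then for each positive integer $m>\frac{C}{\pi^n}$ (resp. $m\ge\frac{C}{\pi^n}$), the Hermitian algebraic function $R^mP$ is a maximal sum of Hermitian squares (resp. a sum of Hermitian squares), and in particular there exists some holomorphic map $\phi:X\to\mathbb P^N$ (with $N$ depending on $m$) such that $((L^m\otimes E)^*,h_{R^mP})=(\phi^*\mathcal O_{\mathbb P^N}(-1),\phi^*h_N)$ as Hermitian holomorphic line bundles (up to isometric isomorphism).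
   Context: $\mathbb N=\{1,2,\dots\}$. Let $F$ be a holomorphic line bundle over $X$ with dual $F^*$, let $\overline X$ be the complex conjugate manifold of $X$, and let $\rho_1,\rho_2$ be the projections of $X\times\overline X$ onto its two factors. A Hermitian algebraic function $Q$ on $F$ is a global holomorphic section of $\rho_1^*F\otimes\rho_2^*\overline F$ over $X\times\overline X$ with $Q(x,\overline y)=\overline{Q(y,\overline x)}\in F_x\otimes\overline{F_y}$ for all $x,y\in X$. For $v\in F^*_x$, $w\in F^*_y$ put $Q(v,\overline w)=\langle Q(x,\overline y),v\otimes\overline w\rangle$ (natural pairing). $Q$ is positive if $Q(v,\overline v)>0$ for all $0\ne v\in F^*$; then $h_Q(v,w)=Q(v,\overline w)$ ($v,w\in F_x^*$) is a Hermitian metric on $F^*$. Its curvature form is, locally, $\Theta_{h_Q}=-\frac{\sqrt{-1}}{2}\partial\overline\partial\log h_Q(\tau,\tau)$ for any local non-vanishing holomorphic section $\tau$ of $F^*$. Products such as $R^mP$ are tensor products of sections; $R^mP$ is a positive Hermitian algebraic function on $L^m\otimes E$. A positive $Q$ satisfies the SGCS condition if: (SGCS-1) $|Q(v,\overline w)|^2<Q(v,\overline v)Q(w,\overline w)$ for all nonzero $v,w\in F^*$ lying over distinct points of $X$; and (SGCS-2) $\Theta_{h_Q}$ is negative definite on $X$. The Kähler form and volume form induced from $R$ are $\omega=-\Theta_{h_R}$ and $\Omega=\omega^n/n!$. For $Q$ positive on $F$ and $s,t\in H^0(X,F)$: $\|s\|_2^2=\int_X\frac{s(x)\overline{s(x)}}{Q(x,\overline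 x)}\,\Omega(x)$, and $$\mathbf K_{Q,\Omega}(s,t)=\iint_{X\times X}\frac{Q(x,\overline y)\,s(y)\,\overline{t(x)}}{Q(x,\overline x)\,Q(y,\overline y)}\,\Omega(x)\,\Omega(y).$$ These are used with $F=L^m\otimes E$, $Q=R^mP$. $Q$ is a maximal sum of Hermitian squares (resp. a sum of Hermitian squares) if there is a basis (resp. a finite subset) $\{s_0,\dots,s_N\}$ of $H^0(X,F)$ with $Q(x,\overline x)=\sum_{i=0}^N s_i(x)\overline{s_i(x)}$ for all $x\in X$. $h_N$ denotes the Hermitian metric on the universal (tautological) line bundle $\mathcal O_{\mathbb P^N}(-1)$ induced by the polynomial $\sum_{i=0}^N|z_i|^2$ on $\mathbb C^{N+1}$. *)

theory Defs
  imports "HOL-Analysis.Analysis" "HOL-Combinatorics.Permutations"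
begin

section \<open>Complex manifolds\<close>

definition cholo_on :: "(complex^'n::finite \<Rightarrow> complex) \<Rightarrow> (complex^'n) set \<Rightarrow> bool" where
  "cholo_on f S \<longleftrightarrow> open S \<and>
     (\<forall>z\<in>S. \<exists>a. (f has_derivative (\<lambda>h. \<Sum>j\<in>UNIV. a $ j * h $ j)) (at z))"

text \<open>A complex manifold is a Hausdorff second countable space \<open>'x\<close> with a holomorphic atlas.
  A chart is its domain together with its coordinate map, which is only relevant on the domain.
  The complex dimension is \<open>CARD('n)\<close>; connectedness is not required.\<close>

type_synonym ('x, 'n) chart = "'x set \<times> ('x \<Rightarrow> complex^'n)"

definition complex_manifold ::
  "('x::{t2_space,second_countable_topology}, 'n::finite) chart set \<Rightarrow> bool" where
  "complex_manifold A \<longleftrightarrow>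
     (\<Union>c\<in>A. fst c) = UNIV \<and>
     (\<forall>(U, \<phi>)\<in>A. open U \<and> open (\<phi> ` U) \<and> homeomorphism U (\<phi> ` U) \<phi> (inv_into U \<phi>)) \<and>
     (\<forall>(U, \<phi>)\<in>A. \<forall>(V, \<psi>)\<in>A. \<forall>j. cholo_on (\<lambda>z. \<psi> (inv_into U \<phi> z) $ j) (\<phi> ` (U \<inter> V)))"

definition holo_on ::
  "('x::topological_space, 'n::finite) chart set \<Rightarrow> ('x \<Rightarrow> complex) \<Rightarrow> 'x set \<Rightarrow> bool" where
  "holo_on A f W \<longleftrightarrow> open W \<and>
     (\<forall>(U, \<phi>)\<in>A. cholo_on (\<lambda>z. f (inv_into U \<phi> z)) (\<phi> ` (U \<inter> W)))"

definition conj_atlas :: "('x, 'n::finite) chart set \<Rightarrow> ('x, 'n) chart set" where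
  "conj_atlas A = (\<lambda>(U, \<phi>). (U, \<lambda>x. \<chi> j. cnj (\<phi> x $ j))) ` A"

definition prod_atlas ::
  "('x, 'n::finite) chart set \<Rightarrow> ('y, 'm::finite) chart set \<Rightarrow> ('x \<times> 'y, 'n + 'm) chart set" where
  "prod_atlas A B = (\<lambda>((U, \<phi>), (V, \<psi>)).
     (U \<times> V, \<lambda>(x, y). \<chi> k. case k of Inl i \<Rightarrow> \<phi> x $ i | Inr j \<Rightarrow> \<psi> y $ j)) ` (A \<times> B)"

section \<open>Holomorphic line bundles\<close>

text \<open>A line bundle is given by an open cover \<open>lb_dom i\<close> (members may be empty) and transition
  functions \<open>lb_trans i j\<close>.  An element of the fibre at \<open>x\<close> is the family \<open>v\<close> of its coordinates in
  all trivializations around \<open>x\<close>, so that \<open>v i = lb_trans i j x * v j\<close>; it is normalized to be \<open>0\<close> at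
  those indices whose trivialization does not contain \<open>x\<close>.\<close>

record ('x, 'i) line_bundle =
  lb_dom :: "'i \<Rightarrow> 'x set"
  lb_trans :: "'i \<Rightarrow> 'i \<Rightarrow> 'x \<Rightarrow> complex"

definition holomorphic_line_bundle ::
  "('x::topological_space, 'n::finite) chart set \<Rightarrow> ('x, 'i) line_bundle \<Rightarrow> bool" where
  "holomorphic_line_bundle A F \<longleftrightarrow>
     (\<forall>i. open (lb_dom F i)) \<and> (\<Union>i. lb_dom F i) = UNIV \<and>
     (\<forall>i j. holo_on A (lb_trans F i j) (lb_dom F i \<inter> lb_dom F j)) \<and>
     (\<forall>i. \<forall>x\<in>lb_dom F i. lb_trans F i i x = 1) \<and>
     (\<forall>i j k. \<forall>x\<in>lb_dom F i \<inter> lb_dom F j \<inter> lb_dom F k. lb_trans F i j x * lb_trans F j k x = lb_trans F i k x)"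

definition fibre :: "('x, 'i) line_bundle \<Rightarrow> 'x \<Rightarrow> ('i \<Rightarrow> complex) set" where
  "fibre F x = {v. (\<forall>i. x \<notin> lb_dom F i \<longrightarrow> v i = 0) \<and>
                   (\<forall>i j. x \<in> lb_dom F i \<inter> lb_dom F j \<longrightarrow> v i = lb_trans F i j x * v j)}"

text \<open>Used wherever a trivialization around \<open>x\<close> is needed and the outcome does not depend on it.\<close>

definition idx :: "('x, 'i) line_bundle \<Rightarrow> 'x \<Rightarrow> 'i" where
  "idx F x = (SOME i. x \<in> lb_dom F i)"

text \<open>The local holomorphic frame over \<open>lb_dom F i\<close>, with \<open>i\<close>-th coordinate \<open>1\<close>.\<close>

definition frame :: "('x, 'i) line_bundle \<Rightarrow> 'i \<Rightarrow> 'x \<Rightarrow> 'i \<Rightarrow> complex" where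
  "frame F i x = (\<lambda>k. if x \<in> lb_dom F i \<inter> lb_dom F k then lb_trans F k i x else 0)"

definition hol_section ::
  "('x::topological_space, 'n::finite) chart set \<Rightarrow> ('x, 'i) line_bundle \<Rightarrow>
    ('x \<Rightarrow> 'i \<Rightarrow> complex) \<Rightarrow> bool" where
  "hol_section A F s \<longleftrightarrow> (\<forall>x. s x \<in> fibre F x) \<and> (\<forall>i. holo_on A (\<lambda>x. s x i) (lb_dom F i))"

definition H0 ::
  "('x::topological_space, 'n::finite) chart set \<Rightarrow> ('x, 'i) line_bundle \<Rightarrow>
    ('x \<Rightarrow> 'i \<Rightarrow> complex) set" where
  "H0 A F = {s. hol_section A F s}"

definition dual_lb :: "('x, 'i) line_bundle \<Rightarrow> ('x, 'i) line_bundle" where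
  "dual_lb F = \<lparr>lb_dom = lb_dom F, lb_trans = (\<lambda>i j x. inverse (lb_trans F i j x))\<rparr>"

definition conj_lb :: "('x, 'i) line_bundle \<Rightarrow> ('x, 'i) line_bundle" where
  "conj_lb F = \<lparr>lb_dom = lb_dom F, lb_trans = (\<lambda>i j x. cnj (lb_trans F i j x))\<rparr>"

definition tensor_lb ::
  "('x, 'i) line_bundle \<Rightarrow> ('x, 'j) line_bundle \<Rightarrow> ('x, 'i \<times> 'j) line_bundle" where
  "tensor_lb F G = \<lparr>lb_dom = (\<lambda>(i, j). lb_dom F i \<inter> lb_dom G j),
     lb_trans = (\<lambda>(i, j) (k, l) x. lb_trans F i k x * lb_trans G j l x)\<rparr>"

definition power_lb :: "('x, 'i) line_bundle \<Rightarrow> nat \<Rightarrow> ('x, 'i) line_bundle" where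
  "power_lb F m = \<lparr>lb_dom = lb_dom F, lb_trans = (\<lambda>i j x. lb_trans F i j x ^ m)\<rparr>"

definition pullback_lb :: "('y \<Rightarrow> 'x) \<Rightarrow> ('x, 'i) line_bundle \<Rightarrow> ('y, 'i) line_bundle" where
  "pullback_lb f F = \<lparr>lb_dom = (\<lambda>i. f -` lb_dom F i), lb_trans = (\<lambda>i j y. lb_trans F i j (f y))\<rparr>"

definition vtensor :: "('i \<Rightarrow> complex) \<Rightarrow> ('j \<Rightarrow> complex) \<Rightarrow> 'i \<times> 'j \<Rightarrow> complex" where
  "vtensor v w = (\<lambda>(i, j). v i * w j)"

definition vconj :: "('i \<Rightarrow> complex) \<Rightarrow> 'i \<Rightarrow> complex" where
  "vconj v = (\<lambda>i. cnj (v i))"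

text \<open>Natural pairing of an element of the fibre of \<open>F\<close> at \<open>x\<close> with one of the fibre of
  \<open>dual_lb F\<close> at \<open>x\<close>.\<close>

definition pairing ::
  "('x, 'i) line_bundle \<Rightarrow> 'x \<Rightarrow> ('i \<Rightarrow> complex) \<Rightarrow> ('i \<Rightarrow> complex) \<Rightarrow> complex" where
  "pairing F x \<xi> v = \<xi> (idx F x) * v (idx F x)"

text \<open>The quotient \<open>\<xi> / \<eta>\<close> of two elements of the same (one-dimensional) fibre, \<open>\<eta>\<close> nonzero.\<close>

definition fquot ::
  "('x, 'i) line_bundle \<Rightarrow> 'x \<Rightarrow> ('i \<Rightarrow> complex) \<Rightarrow> ('i \<Rightarrow> complex) \<Rightarrow> complex" where
  "fquot F x \<xi> \<eta> = \<xi> (idx F x) / \<eta> (idx F x)"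

section \<open>Hermitian algebraic functions\<close>

text \<open>The bundle \<open>\<rho>\<^sub>1\<^sup>* F \<otimes> \<rho>\<^sub>2\<^sup>* (conj F)\<close> over the product of \<open>X\<close> with its conjugate.\<close>

definition herm_lb :: "('x, 'i) line_bundle \<Rightarrow> ('x \<times> 'x, 'i \<times> 'i) line_bundle" where
  "herm_lb F = tensor_lb (pullback_lb fst F) (pullback_lb snd (conj_lb F))"

type_synonym ('x, 'i) herm_fun = "'x \<times> 'x \<Rightarrow> 'i \<times> 'i \<Rightarrow> complex"

definition hermitian_algebraic ::
  "('x::topological_space, 'n::finite) chart set \<Rightarrow> ('x, 'i) line_bundle \<Rightarrow>
    ('x, 'i) herm_fun \<Rightarrow> bool" where
  "hermitian_algebraic A F Q \<longleftrightarrow>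
     hol_section (prod_atlas A (conj_atlas A)) (herm_lb F) Q \<and>
     (\<forall>x y i j. Q (x, y) (i, j) = cnj (Q (y, x) (j, i)))"

definition heval ::
  "('x, 'i) line_bundle \<Rightarrow> ('x, 'i) herm_fun \<Rightarrow>
    'x \<Rightarrow> ('i \<Rightarrow> complex) \<Rightarrow> 'x \<Rightarrow> ('i \<Rightarrow> complex) \<Rightarrow> complex" where
  "heval F Q x v y w = pairing (herm_lb F) (x, y) (Q (x, y)) (vtensor v (vconj w))"

definition positive_hermitian_algebraic ::
  "('x::topological_space, 'n::finite) chart set \<Rightarrow> ('x, 'i) line_bundle \<Rightarrow>
    ('x, 'i) herm_fun \<Rightarrow> bool" where
  "positive_hermitian_algebraic A F Q \<longleftrightarrow> hermitian_algebraic A F Q \<and>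
     (\<forall>x. \<forall>v\<in>fibre (dual_lb F) x. v \<noteq> (\<lambda>_. 0) \<longrightarrow> 0 < Re (heval F Q x v x v))"

definition herm_power_mult ::
  "('x, 'i) herm_fun \<Rightarrow> nat \<Rightarrow> ('x, 'j) herm_fun \<Rightarrow> ('x, 'i \<times> 'j) herm_fun" where
  "herm_power_mult R m P = (\<lambda>p ((i, k), (j, l)). R p (i, j) ^ m * P p (k, l))"

section \<open>Hermitian metrics and their curvature\<close>

type_synonym ('x, 'i) hmetric = "'x \<Rightarrow> ('i \<Rightarrow> complex) \<Rightarrow> ('i \<Rightarrow> complex) \<Rightarrow> complex"

text \<open>The metric \<open>h\<^sub>Q\<close> on the dual of \<open>F\<close>.\<close>

definition metric_of ::
  "('x, 'i) line_bundle \<Rightarrow> ('x, 'i) herm_fun \<Rightarrow> ('x, 'i) hmetric" where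
  "metric_of F Q x v w = heval F Q x v x w"

definition wirtinger :: "'n \<Rightarrow> (complex^'n::finite \<Rightarrow> complex) \<Rightarrow> complex^'n \<Rightarrow> complex" where
  "wirtinger j f z = (frechet_derivative f (at z) (axis j 1)
                       - \<i> * frechet_derivative f (at z) (axis j \<i>)) / 2"

definition wirtinger_bar :: "'n \<Rightarrow> (complex^'n::finite \<Rightarrow> complex) \<Rightarrow> complex^'n \<Rightarrow> complex" where
  "wirtinger_bar j f z = (frechet_derivative f (at z) (axis j 1)
                           + \<i> * frechet_derivative f (at z) (axis j \<i>)) / 2"

text \<open>The two-form \<open>\<partial> \<partial>bar f = \<Sum>\<^sub>j\<^sub>k (\<partial>\<^sub>j \<partial>bar\<^sub>k f) dz\<^sub>j \<and> dzbar\<^sub>k\<close> at \<open>z\<close>, evaluated at the (real) tangent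
  vectors \<open>u\<close> and \<open>v\<close>, with \<open>(\<alpha> \<and> \<beta>) (u, v) = \<alpha> u * \<beta> v - \<alpha> v * \<beta> u\<close>.\<close>

definition ddbar ::
  "(complex^'n::finite \<Rightarrow> complex) \<Rightarrow> complex^'n \<Rightarrow> complex^'n \<Rightarrow> complex^'n \<Rightarrow> complex" where
  "ddbar f z u v = (\<Sum>j\<in>UNIV. \<Sum>k\<in>UNIV. wirtinger j (wirtinger_bar k f) z *
                      (u $ j * cnj (v $ k) - v $ j * cnj (u $ k)))"

text \<open>The curvature form of a metric \<open>h\<close> on \<open>G\<close> at \<open>x\<close>, in the coordinates of a chart around \<open>x\<close>.
  The local frame \<open>\<tau>\<close> is immaterial, since \<open>log \<bar>u\<bar>\<^sup>2\<close> is pluriharmonic for \<open>u\<close> holomorphic without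
  zeros.  The form is real; \<open>Re\<close> only adjusts the type.\<close>

definition curvature ::
  "('x, 'i) line_bundle \<Rightarrow> ('x, 'i) hmetric \<Rightarrow> ('x, 'n::finite) chart \<Rightarrow> 'x \<Rightarrow>
    complex^'n \<Rightarrow> complex^'n \<Rightarrow> real" where
  "curvature G h = (\<lambda>(U, \<phi>) x u v.
     let \<tau> = frame G (idx G x) in
     Re (- (\<i> / 2) * ddbar (\<lambda>z. let y = inv_into U \<phi> z in of_real (ln (Re (h y (\<tau> y) (\<tau> y)))))
                       (\<phi> x) u v))"

text \<open>A real form \<open>\<theta>\<close> of type (1,1) is negative definite if \<open>\<theta> (u, J u) < 0\<close> for \<open>u \<noteq> 0\<close>; this
  says that the matrix \<open>H\<close> is negative definite when \<open>\<theta> = (\<i>/2) \<Sum>\<^sub>j\<^sub>k H\<^sub>j\<^sub>k dz\<^sub>j \<and> dzbar\<^sub>k\<close>.\<close>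

definition neg_def_curvature ::
  "('x, 'n::finite) chart set \<Rightarrow> ('x, 'i) line_bundle \<Rightarrow> ('x, 'i) hmetric \<Rightarrow> bool" where
  "neg_def_curvature A G h \<longleftrightarrow>
     (\<forall>c\<in>A. \<forall>x\<in>fst c. \<forall>u. u \<noteq> 0 \<longrightarrow> curvature G h c x u (\<i> *s u) < 0)"

definition SGCS ::
  "('x, 'n::finite) chart set \<Rightarrow> ('x, 'i) line_bundle \<Rightarrow> ('x, 'i) herm_fun \<Rightarrow> bool" where
  "SGCS A F Q \<longleftrightarrow>
     (\<forall>x y. x \<noteq> y \<longrightarrow>
        (\<forall>v\<in>fibre (dual_lb F) x - {\<lambda>_. 0}. \<forall>w\<in>fibre (dual_lb F) y - {\<lambda>_. 0}.
           (cmod (heval F Q x v y w))\<^sup>2 < Re (heval F Q x v x v) * Re (heval F Q y w y w))) \<and>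
     neg_def_curvature A (dual_lb F) (metric_of F Q)"

section \<open>Volume form and integration\<close>

text \<open>For a two-form \<open>\<omega>\<close> on \<open>\<complex>\<^sup>n\<close>, the coefficient of \<open>\<omega>\<^sup>n\<close> (\<open>n\<close>-fold wedge power) with respect
  to the Euclidean volume form, that is, its value on the positively oriented real basis
  \<open>e\<^sub>1, \<i> e\<^sub>1, \<dots>, e\<^sub>n, \<i> e\<^sub>n\<close>, here indexed by \<open>'n \<times> bool\<close>.  The wedge product is normalized
  as for \<open>ddbar\<close>.\<close>

definition real_basis :: "'n::finite \<times> bool \<Rightarrow> complex^'n" where
  "real_basis = (\<lambda>(j, b). axis j (if b then \<i> else 1))"

definition top_wedge_power :: "(complex^'n::finite \<Rightarrow> complex^'n \<Rightarrow> real) \<Rightarrow> real" where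
  "top_wedge_power \<omega> =
     (\<Sum>\<sigma> | \<sigma> permutes (UNIV :: ('n \<times> bool) set).
        of_int (sign \<sigma>) *
        (\<Prod>j\<in>UNIV. \<omega> (real_basis (\<sigma> (j, False))) (real_basis (\<sigma> (j, True))))) / 2 ^ CARD('n)"

text \<open>The density, in a chart, of \<open>\<Omega> = \<omega>\<^sup>n / n!\<close> where \<open>\<omega>\<close> is minus the curvature of \<open>h\<^sub>R\<close>.\<close>

definition vol_density ::
  "('x, 'i) line_bundle \<Rightarrow> ('x, 'i) herm_fun \<Rightarrow> ('x, 'n::finite) chart \<Rightarrow> 'x \<Rightarrow> real" where
  "vol_density L R c x =
     top_wedge_power (\<lambda>u v. - curvature (dual_lb L) (metric_of L R) c x u v) / fact CARD('n)"

text \<open>Integration of \<open>\<Omega>\<close>: cut the manifold into countably many disjoint Borel pieces \<open>fst (D k)\<close>,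
  each lying in the domain of a chart \<open>snd (D k)\<close>, and integrate the density over each piece in
  coordinates.  By the change of variables formula the result does not depend on the pieces.\<close>

definition chart_partition ::
  "('x::topological_space, 'n::finite) chart set \<Rightarrow> (nat \<Rightarrow> 'x set \<times> ('x, 'n) chart) \<Rightarrow> bool" where
  "chart_partition A D \<longleftrightarrow>
     (\<forall>k. snd (D k) \<in> A \<and> fst (D k) \<in> sets borel \<and> fst (D k) \<subseteq> fst (snd (D k))) \<and>
     disjoint_family (\<lambda>k. fst (D k)) \<and> (\<Union>k. fst (D k)) = UNIV"

definition volume_measure ::
  "('x::topological_space, 'n::finite) chart set \<Rightarrow> ('x, 'i) line_bundle \<Rightarrow>
    ('x, 'i) herm_fun \<Rightarrow> 'x measure" where
  "volume_measure A L R = (let D = (SOME D. chart_partition A D) in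
     measure_of UNIV (sets borel) (\<lambda>B. \<Sum>k. case D k of (S, (U, \<phi>)) \<Rightarrow>
       \<integral>\<^sup>+ z\<in>\<phi> ` (B \<inter> S). ennreal (vol_density L R (U, \<phi>) (inv_into U \<phi> z)) \<partial>lborel))"

definition l2_norm_sq ::
  "'x measure \<Rightarrow> ('x, 'i) line_bundle \<Rightarrow> ('x, 'i) herm_fun \<Rightarrow> ('x \<Rightarrow> 'i \<Rightarrow> complex) \<Rightarrow> real" where
  "l2_norm_sq \<Omega> F Q s =
     (\<integral>x. Re (fquot (herm_lb F) (x, x) (vtensor (s x) (vconj (s x))) (Q (x, x))) \<partial>\<Omega>)"

text \<open>The integrand is \<open>Q(x,y) s(y) conj(t(x)) / (Q(x,x) Q(y,y))\<close>, a quotient of elements of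
  \<open>F\<^sub>x \<otimes> conj F\<^sub>x \<otimes> F\<^sub>y \<otimes> conj F\<^sub>y\<close>, read in a trivialization \<open>i\<close> around \<open>x\<close> and
  \<open>j\<close> around \<open>y\<close>.\<close>

definition K_form ::
  "'x measure \<Rightarrow> ('x, 'i) line_bundle \<Rightarrow> ('x, 'i) herm_fun \<Rightarrow>
    ('x \<Rightarrow> 'i \<Rightarrow> complex) \<Rightarrow> ('x \<Rightarrow> 'i \<Rightarrow> complex) \<Rightarrow> complex" where
  "K_form \<Omega> F Q s t =
     (\<integral>p. (case p of (x, y) \<Rightarrow> let i = idx F x; j = idx F y in
        Q (x, y) (i, j) * s y j * cnj (t x i) / (Q (x, x) (i, i) * Q (y, y) (j, j)))
      \<partial>(\<Omega> \<Otimes>\<^sub>M \<Omega>))"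

section \<open>Sums of Hermitian squares\<close>

definition is_square_sum ::
  "('x, 'i) herm_fun \<Rightarrow> ('x \<Rightarrow> 'i \<Rightarrow> complex) set \<Rightarrow> bool" where
  "is_square_sum Q S \<longleftrightarrow>
     (\<forall>x. Q (x, x) = (\<lambda>i. \<Sum>s\<in>S. vtensor (s x) (vconj (s x)) i))"

definition is_finite_basis ::
  "('x \<Rightarrow> 'i \<Rightarrow> complex) set \<Rightarrow> ('x \<Rightarrow> 'i \<Rightarrow> complex) set \<Rightarrow> bool" where
  "is_finite_basis V B \<longleftrightarrow> finite B \<and> B \<subseteq> V \<and>
     (\<forall>c. (\<forall>x i. (\<Sum>s\<in>B. c s * s x i) = 0) \<longrightarrow> (\<forall>s\<in>B. c s = 0)) \<and>
     (\<forall>t\<in>V. \<exists>c. \<forall>x i. t x i = (\<Sum>s\<in>B. c s * s x i))"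

definition maximal_sum_of_squares ::
  "('x::topological_space, 'n::finite) chart set \<Rightarrow> ('x, 'i) line_bundle \<Rightarrow>
    ('x, 'i) herm_fun \<Rightarrow> bool" where
  "maximal_sum_of_squares A F Q \<longleftrightarrow> (\<exists>S. is_finite_basis (H0 A F) S \<and> is_square_sum Q S)"

definition sum_of_squares ::
  "('x::topological_space, 'n::finite) chart set \<Rightarrow> ('x, 'i) line_bundle \<Rightarrow>
    ('x, 'i) herm_fun \<Rightarrow> bool" where
  "sum_of_squares A F Q \<longleftrightarrow> (\<exists>S. finite S \<and> S \<subseteq> H0 A F \<and> is_square_sum Q S)"

section \<open>Projective space and its tautological bundle\<close>

text \<open>\<open>\<complex>\<^sup>N\<^sup>+\<^sup>1\<close> consists of the sequences vanishing beyond \<open>N\<close>, and points of projective space are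
  one-dimensional subspaces of it.\<close>

definition proj_space :: "nat \<Rightarrow> (nat \<Rightarrow> complex) set set" where
  "proj_space N = {range (\<lambda>c i. c * z i) |z. (\<exists>i. z i \<noteq> 0) \<and> (\<forall>i>N. z i = 0)}"

definition affine_dom :: "nat \<Rightarrow> nat \<Rightarrow> (nat \<Rightarrow> complex) set set" where
  "affine_dom N i = {l \<in> proj_space N. \<exists>z\<in>l. z i \<noteq> 0}"

text \<open>The affine coordinate \<open>z\<^sub>i / z\<^sub>j\<close>, defined on \<open>affine_dom N j\<close>.\<close>

definition affine_coord :: "nat \<Rightarrow> nat \<Rightarrow> (nat \<Rightarrow> complex) set \<Rightarrow> complex" where
  "affine_coord i j l = (THE c. \<forall>z\<in>l. z i = c * z j)"

text \<open>Holomorphy is tested in the standard affine charts \<open>(affine_coord i j)\<^sub>i\<close> on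
  \<open>affine_dom N j\<close>; openness of the preimages of these domains is part of \<open>holo_on\<close>.\<close>

definition holomorphic_to_proj ::
  "('x::topological_space, 'n::finite) chart set \<Rightarrow> nat \<Rightarrow> ('x \<Rightarrow> (nat \<Rightarrow> complex) set) \<Rightarrow> bool" where
  "holomorphic_to_proj A N f \<longleftrightarrow> range f \<subseteq> proj_space N \<and>
     (\<forall>j\<le>N. \<forall>i\<le>N. holo_on A (\<lambda>x. affine_coord i j (f x)) (f -` affine_dom N j))"

text \<open>In the trivialization \<open>j\<close> with frame \<open>z / z\<^sub>j\<close>, the coordinate of a vector \<open>v\<close> of the line \<open>l\<close>
  is \<open>v j\<close>.  Hence \<open>fibre (tautological_lb N) l = l\<close>.\<close>

definition tautological_lb :: "nat \<Rightarrow> ((nat \<Rightarrow> complex) set, nat) line_bundle" where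
  "tautological_lb N = \<lparr>lb_dom = affine_dom N, lb_trans = affine_coord\<rparr>"

definition fubini_study :: "nat \<Rightarrow> ((nat \<Rightarrow> complex) set, nat) hmetric" where
  "fubini_study N l v w = (\<Sum>i\<le>N. v i * cnj (w i))"

section \<open>Isomorphisms of Hermitian holomorphic line bundles\<close>

text \<open>The inverse of a fibrewise bijective holomorphic bundle map is again holomorphic.\<close>

definition isometric_iso ::
  "('x::topological_space, 'n::finite) chart set \<Rightarrow>
    ('x, 'i) line_bundle \<Rightarrow> ('x, 'i) hmetric \<Rightarrow> ('x, 'j) line_bundle \<Rightarrow> ('x, 'j) hmetric \<Rightarrow>
    ('x \<Rightarrow> ('i \<Rightarrow> complex) \<Rightarrow> 'j \<Rightarrow> complex) \<Rightarrow> bool" where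
  "isometric_iso A F g G h \<Psi> \<longleftrightarrow>
     (\<forall>x. bij_betw (\<Psi> x) (fibre F x) (fibre G x)) \<and>
     (\<forall>x. \<forall>v\<in>fibre F x. \<forall>w\<in>fibre F x. \<forall>a b.
        \<Psi> x (\<lambda>i. a * v i + b * w i) = (\<lambda>j. a * \<Psi> x v j + b * \<Psi> x w j)) \<and>
     (\<forall>i j. holo_on A (\<lambda>x. \<Psi> x (frame F i x) j) (lb_dom F i \<inter> lb_dom G j)) \<and>
     (\<forall>x. \<forall>v\<in>fibre F x. \<forall>w\<in>fibre F x. h x (\<Psi> x v) (\<Psi> x w) = g x v w)"

definition hermitian_isomorphic ::
  "('x::topological_space, 'n::finite) chart set \<Rightarrow>
    ('x, 'i) line_bundle \<Rightarrow> ('x, 'i) hmetric \<Rightarrow> ('x, 'j) line_bundle \<Rightarrow> ('x, 'j) hmetric \<Rightarrow> bool" where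
  "hermitian_isomorphic A F g G h \<longleftrightarrow> (\<exists>\<Psi>. isometric_iso A F g G h \<Psi>)"

end

theory Submission
  imports Defs "HOL-Complex_Analysis.Conformal_Mappings"
begin

text \<open>Write \<open>F = L\<^sup>m \<otimes> E\<close> and \<open>Q = R\<^sup>m P\<close>.  The statement is linear algebra on the finite-dimensional space
  \<open>H\<^sup>0(X, F)\<close>.  In a basis \<open>e\<^sub>p\<close> of sections one has \<open>Q(x, cnj y) = \<Sum>\<^sub>p\<^sub>q c\<^sub>p\<^sub>q e\<^sub>p(x) cnj (e\<^sub>q(y))\<close> with a
  Hermitian matrix \<open>c\<close> (\<open>kernel_expansion\<close>), and integration turns this into
  \<open>K(s, s) = \<Sum>\<^sub>p\<^sub>q c\<^sub>p\<^sub>q \<langle>e\<^sub>p, s\<rangle> cnj \<langle>e\<^sub>q, s\<rangle>\<close> (\<open>K_form_expansion\<close>).  The Gram matrix of the basis is positive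
  definite, so the vectors \<open>\<langle>e\<^sub>p, s\<rangle>\<close> exhaust the coordinate space.  Since the hypothesis gives
  \<open>K(s, s) \<ge> (\<pi>\<^sup>n / m\<^sup>n - C / m\<^sup>n\<^sup>+\<^sup>1) \<parallel>s\<parallel>\<^sup>2\<close>, the matrix \<open>c\<close> is positive definite for \<open>m > C / \<pi>\<^sup>n\<close> and
  positive semidefinite for \<open>m \<ge> C / \<pi>\<^sup>n\<close>.  A Cholesky factorization of \<open>c\<close> writes \<open>Q(x, x)\<close> as a sum of
  squares of linearly independent sections, as many as the rank of \<open>c\<close>; they form a basis if \<open>c\<close> is
  definite (\<open>sum_of_squares_of_kernel_estimate\<close>).  These sections have no common zero because \<open>Q\<close> is positive.  They
  define the map to projective space, and evaluating them on dual vectors is the isometry with the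
  pulled back tautological bundle (\<open>projective_map_of_sum_of_squares\<close>).

  Two analytic facts enter.  The first is that finitely many points determine a section
  (\<open>finite_determination\<close>): a section vanishing on a fine net is, by the Schwarz lemma along complex lines,
  at most half of its own maximum, hence zero.  A determining set of least cardinality then
  carries a dual basis of sections (\<open>interpolation_basis\<close>), in which the entries of \<open>c\<close> are values of \<open>Q\<close>.

  The second is that \<open>\<Omega>\<close> is a finite measure which charges every nonempty open set, so that
  the scalar product is defined and positive.  Locally \<open>R(x, x) = r(z, cnj z)\<close> for a holomorphic function \<open>r\<close>
  of \<open>(z, w)\<close>, and the coefficients of the Kaehler form of \<open>R\<close> are the derivatives \<open>\<partial>\<^sub>z \<partial>\<^sub>w log r\<close>
  on \<open>w = cnj z\<close>.  They are unchanged by a new trivialization and transform as a form of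
  type (1,1) under a new chart (\<open>log_hess_scale\<close>, \<open>log_hess_compose\<close>).  The density of \<open>\<Omega>\<close> is the top power of this form; it is
  positive (\<open>top_wedge_power_form11_pos\<close>) and picks up the real Jacobian determinant under a change of chart
  (\<open>top_wedge_power_pullback\<close>), so the change of variables formula makes the measure of a set
  independent of the charts used.\<close>

section \<open>Positive semidefinite matrices\<close>

definition quad_form :: "'a set \<Rightarrow> ('a \<Rightarrow> 'a \<Rightarrow> complex) \<Rightarrow> ('a \<Rightarrow> complex) \<Rightarrow> complex" where
  "quad_form I c a = (\<Sum>j\<in>I. \<Sum>k\<in>I. c j k * a j * cnj (a k))"

text \<open>\<open>c\<close> is a sum of squares of linearly independent linear forms, the rows of \<open>u\<close> indexed by \<open>J\<close>.\<close>

definition rank_factorization ::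
  "'a set \<Rightarrow> ('a \<Rightarrow> 'a \<Rightarrow> complex) \<Rightarrow> 'a set \<Rightarrow> ('a \<Rightarrow> 'a \<Rightarrow> complex) \<Rightarrow> bool" where
  "rank_factorization I c J u \<longleftrightarrow> J \<subseteq> I \<and>
     (\<forall>j\<in>I. \<forall>k\<in>I. c j k = (\<Sum>i\<in>J. u i j * cnj (u i k))) \<and>
     (\<forall>b. (\<forall>j\<in>I. (\<Sum>i\<in>J. b i * u i j) = 0) \<longrightarrow> (\<forall>i\<in>J. b i = 0))"

text \<open>Invertibility of a square matrix on a finite index set, in the form of solvability of both linear systems.\<close>

definition invertible_on :: "'a set \<Rightarrow> ('a \<Rightarrow> 'a \<Rightarrow> complex) \<Rightarrow> bool" where
  "invertible_on I u \<longleftrightarrow>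
     (\<forall>b. \<exists>a. \<forall>j\<in>I. (\<Sum>i\<in>I. a i * u i j) = b j) \<and> (\<forall>b. \<exists>a. \<forall>i\<in>I. (\<Sum>j\<in>I. u i j * a j) = b i)"

text \<open>Induction on the index set, completing the square in the last coordinate.  If the last
  diagonal entry is zero, semidefiniteness makes its whole row zero and no square is split off.
  If it is positive, the square split off is the only one that involves the last coordinate; this triangular
  shape keeps the forms independent and, when no pivot is missing, makes both systems solvable.\<close>

lemma cholesky_decomposition:
  fixes c :: "'a \<Rightarrow> 'a \<Rightarrow> complex"
  assumes "finite I"
    and "\<And>j k. j \<in> I \<Longrightarrow> k \<in> I \<Longrightarrow> c k j = cnj (c j k)"
    and "\<And>a. 0 \<le> Re (quad_form I c a)"
  shows "\<exists>J u. rank_factorization I c J u \<and>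
    ((\<forall>a. (\<exists>j\<in>I. a j \<noteq> 0) \<longrightarrow> 0 < Re (quad_form I c a)) \<longrightarrow> J = I \<and> invertible_on I u)"
  using assms
  proof (induction I arbitrary: c rule: finite_induct)
    case empty
    show ?case by (intro exI[of _ "{}"] exI[of _ "\<lambda>_ _. 0"]) (auto simp: rank_factorization_def invertible_on_def)
  next
    case (insert n I)
    note herm = insert.prems(1) and psd = insert.prems(2)[unfolded quad_form_def]
    have nI: "n \<notin> I" and fin: "finite I" using insert.hyps by auto
    define S where "S = (\<lambda>c (a::'a\<Rightarrow>complex). \<Sum>j\<in>I. \<Sum>k\<in>I. c j k * a j * cnj (a k))"
    have split: "(\<Sum>j\<in>insert n I. \<Sum>k\<in>insert n I. d j k * a j * cnj (a k))
        = S d a + d n n * a n * cnj (a n) + (\<Sum>k\<in>I. d n k * a n * cnj (a k)) + (\<Sum>j\<in>I. d j n * a j * cnj (a n))"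
      for d :: "'a \<Rightarrow> 'a \<Rightarrow> complex" and a
      using nI fin by (simp add: S_def sum.distrib algebra_simps)
    have cnn_re: "Im (c n n) = 0" using herm[of n n] by (metis cnj.simps(2) insertI1 neg_equal_zero)
    have unit: "(\<Sum>j\<in>insert n I. \<Sum>k\<in>insert n I. c j k * (if j = n then 1 else 0) * cnj (if k = n then 1 else 0)) = c n n"
    proof -
      have 1: "(\<Sum>k\<in>I. c n k * cnj (if k = n then 1 else 0)) = 0" "(\<Sum>j\<in>I. \<Sum>k\<in>I. c j k * (if j = n then 1 else 0) * cnj (if k = n then 1 else 0)) = 0"
        using nI by (auto intro!: sum.neutral)
      have 2: "(\<Sum>j\<in>I. c j n * (if j = n then 1 else 0)) = 0" using nI by (auto intro!: sum.neutral)
      show ?thesis unfolding split S_def using 1 2 by simp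
    qed
    have cnn0: "0 \<le> Re (c n n)" using psd[of "\<lambda>j. if j = n then 1 else 0"] unfolding unit .
    have herm': "k \<in> I \<Longrightarrow> c n k = cnj (c k n)" for k using herm[of k n] by auto
    have cross: "(\<Sum>k\<in>I. c n k * x * cnj (a k)) = cnj (\<Sum>j\<in>I. c j n * a j * cnj x)" for x a
      by (simp add: herm' algebra_simps)
    have quad: "Re (\<Sum>j\<in>insert n I. \<Sum>k\<in>insert n I. c j k * (a(n:=x)) j * cnj ((a(n:=x)) k))
        = Re (S c a) + Re (c n n) * (cmod x)\<^sup>2 + 2 * Re (cnj x * (\<Sum>j\<in>I. c j n * a j))" for a x
    proof -
      have "S c (a(n:=x)) = S c a" unfolding S_def using nI by (auto intro!: sum.cong)
      moreover have "(\<Sum>k\<in>I. c n k * x * cnj ((a(n:=x)) k)) = cnj (\<Sum>j\<in>I. c j n * a j * cnj x)"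
        unfolding cross[symmetric] using nI by (auto intro!: sum.cong)
      moreover have "(\<Sum>j\<in>I. c j n * (a(n:=x)) j * cnj x) = (\<Sum>j\<in>I. c j n * a j * cnj x)"
        using nI by (auto intro!: sum.cong)
      moreover have "Re (c n n * x * cnj x) = Re (c n n) * (cmod x)\<^sup>2"
        using cnn_re by (simp add: cmod_power2) (simp add: power2_eq_square algebra_simps)
      moreover have "cnj x * (\<Sum>j\<in>I. c j n * a j) = (\<Sum>j\<in>I. c j n * a j * cnj x)"
        by (simp add: sum_distrib_left mult_ac)
      ultimately show ?thesis unfolding split by (simp only: fun_upd_same plus_complex.sel cnj.sel)
    qed
    show ?case
    proof (cases "Re (c n n) = 0")
      case True
      then have cnn: "c n n = 0" using cnn_re by (simp add: complex_eq_iff)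
      \<comment> \<open>A vanishing diagonal entry of a semidefinite form forces its row to vanish.\<close>
      have cn: "c j n = 0" if j: "j \<in> I" for j
      proof (rule ccontr)
        assume ne: "c j n \<noteq> 0"
        define a where "a = (\<lambda>k. if k = j then 1 else 0 :: complex)"
        have s: "(\<Sum>k\<in>I. c k n * a k) = c j n"
          using j fin by (simp add: a_def if_distrib cong: if_cong)
        have "0 \<le> Re (S c a) + 2 * Re (cnj (of_real (-t) * c j n) * c j n)" for t
          using psd[of "a(n := of_real (-t) * c j n)"] unfolding quad s True by simp
        moreover have "Re (cnj (of_real (-t) * c j n) * c j n) = - t * (cmod (c j n))\<^sup>2" for t
          by (simp add: cmod_power2) (simp add: power2_eq_square algebra_simps)
        ultimately have *: "0 \<le> Re (S c a) - 2 * t * (cmod (c j n))\<^sup>2" for t by (simp add: algebra_simps)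
        have "0 \<le> Re (S c a) - 2 * ((\<bar>Re (S c a)\<bar> + 1) / (cmod (c j n))\<^sup>2) * (cmod (c j n))\<^sup>2" by (rule *)
        then show False using ne by simp
      qed
      have psd': "0 \<le> Re (quad_form I c a)" for a
        using psd[of "a(n:=0)"] unfolding quad by (simp add: S_def quad_form_def)
      obtain J u where ex: "rank_factorization I c J u"
        using insert.IH[of c] herm psd' by blast
      note uJ = ex[unfolded rank_factorization_def, THEN conjunct1]
        ex[unfolded rank_factorization_def, THEN conjunct2, THEN conjunct1, rule_format]
        ex[unfolded rank_factorization_def, THEN conjunct2, THEN conjunct2, rule_format]
      define v where "v = (\<lambda>i j. if j = n then 0 else u i j)"
      have v: "j \<in> I \<Longrightarrow> v i j = u i j" "v i n = 0" for i j using nI by (auto simp: v_def)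
      have "quad_form (insert n I) c (\<lambda>j. if j = n then 1 else 0) = 0"
        using unit cnn unfolding quad_form_def by simp
      then have "\<not> (\<forall>a. (\<exists>j\<in>insert n I. a j \<noteq> 0) \<longrightarrow> 0 < Re (quad_form (insert n I) c a))"
        by (intro notI, drule_tac x = "\<lambda>j. if j = n then 1 else 0" in spec) auto
      moreover have "c j k = (\<Sum>i\<in>J. v i j * cnj (v i k))" if "j \<in> insert n I" "k \<in> insert n I" for j k
      proof (cases "j = n \<or> k = n")
        case True
        then show ?thesis using that cn herm' cnn v(2) by auto
      next
        case False
        then show ?thesis using that uJ(2)[of j k] v(1) by auto
      qed
      moreover have "b i = 0" if b: "\<forall>j\<in>insert n I. (\<Sum>i\<in>J. b i * v i j) = 0" and i: "i \<in> J" for b i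
      proof (rule uJ(3)[OF _ i])
        fix j assume "j \<in> I"
        then show "(\<Sum>i\<in>J. b i * u i j) = 0" using b v(1)[of j] by (metis (no_types, lifting) insertCI sum.cong)
      qed
      ultimately have "rank_factorization (insert n I) c J v"
        using uJ(1) unfolding rank_factorization_def by blast
      then show ?thesis
        using \<open>\<not> (\<forall>a. (\<exists>j\<in>insert n I. a j \<noteq> 0) \<longrightarrow> 0 < Re (quad_form (insert n I) c a))\<close> by blast
    next
      case False
      define r where "r = sqrt (Re (c n n))"
      have r: "r > 0" and r2: "of_real r * of_real r = c n n"
        using False cnn0 cnn_re by (auto simp: r_def complex_eq_iff)
      define \<rho> where "\<rho> = (\<lambda>j. if j = n then of_real r else c j n / of_real r)"
      define d where "d = (\<lambda>j k. c j k - \<rho> j * cnj (\<rho> k))"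
      have r2': "of_real r * of_real r = (of_real (Re (c n n)) :: complex)"
        using r2 cnn_re by (simp add: complex_eq_iff)
      \<comment> \<open>Completing the square: choosing the last coordinate optimally leaves the Schur complement.\<close>
      have complete: "Re (\<Sum>j\<in>insert n I. \<Sum>k\<in>insert n I. c j k * (a(n:=x)) j * cnj ((a(n:=x)) k)) = Re (S d a)"
        if x: "x = - (\<Sum>j\<in>I. c j n * a j) / c n n" for a x
      proof -
        define z where "z = (\<Sum>j\<in>I. c j n * a j)"
        have "S d a = S c a - (\<Sum>j\<in>I. \<rho> j * a j) * cnj (\<Sum>k\<in>I. \<rho> k * a k)"
          unfolding S_def d_def sum_product cnj_sum
          by (simp add: sum_subtractf algebra_simps)
        also have "(\<Sum>j\<in>I. \<rho> j * a j) = z / of_real r"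
          unfolding z_def sum_divide_distrib using nI by (auto simp: \<rho>_def intro!: sum.cong)
        finally have "Re (S d a) = Re (S c a) - (cmod z)\<^sup>2 / Re (c n n)"
          using r r2' by (simp add: complex_norm_square[symmetric] cmod_power2 power2_eq_square r_def)
        moreover have x': "x = - z / of_real (Re (c n n))" using x cnn_re unfolding z_def
          by (metis complex_is_Real_iff of_real_Re)
        have "cnj x * z = of_real (- (cmod z)\<^sup>2 / Re (c n n))"
          unfolding x' using complex_norm_square[of z] by (simp add: mult.commute)
        then have "Re (cnj x * z) = - (cmod z)\<^sup>2 / Re (c n n)" by simp
        moreover have "Re (c n n) * (cmod x)\<^sup>2 = (cmod z)\<^sup>2 / Re (c n n)"
          unfolding x' using False by (simp add: norm_divide power_divide power2_eq_square)
        ultimately show ?thesis unfolding quad z_def[symmetric] by simp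
      qed
      have psd': "0 \<le> Re (quad_form I d a)" for a
        using psd[of "a(n := - (\<Sum>j\<in>I. c j n * a j) / c n n)"] complete[OF refl, of a]
        by (simp add: S_def quad_form_def)
      have herm_d: "d k j = cnj (d j k)" if "j \<in> I" "k \<in> I" for j k
        using herm[of j k] that by (simp add: d_def)
      obtain J u where ex: "rank_factorization I d J u"
        and ex_pd: "(\<forall>a. (\<exists>j\<in>I. a j \<noteq> 0) \<longrightarrow> 0 < Re (quad_form I d a)) \<Longrightarrow> J = I \<and> invertible_on I u"
        using insert.IH[of d, OF herm_d psd'] by blast
      note uJ = ex[unfolded rank_factorization_def, THEN conjunct1]
        ex[unfolded rank_factorization_def, THEN conjunct2, THEN conjunct1, rule_format]
        ex[unfolded rank_factorization_def, THEN conjunct2, THEN conjunct2, rule_format]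
      define v where "v = (\<lambda>i j. if i = n then \<rho> j else if j = n then 0 else u i j)"
      have nJ: "n \<notin> J" and fJ: "finite J" using uJ(1) nI fin finite_subset by auto
      have v: "v n j = \<rho> j" "i \<in> I \<Longrightarrow> v i n = 0" "i \<in> I \<Longrightarrow> j \<in> I \<Longrightarrow> v i j = u i j" for i j
        using nI by (auto simp: v_def)
      have vJ: "i \<in> J \<Longrightarrow> v i n = 0" "i \<in> J \<Longrightarrow> j \<in> I \<Longrightarrow> v i j = u i j" for i j
        using uJ(1) v by auto
      have "c j k = (\<Sum>i\<in>insert n J. v i j * cnj (v i k))" if "j \<in> insert n I" "k \<in> insert n I" for j k
      proof -
        have "(\<Sum>i\<in>J. v i j * cnj (v i k)) = d j k"
        proof (cases "j = n \<or> k = n")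
          case True
          have "d j k = 0" using True that herm' r r2 nI cnn_re
            by (auto simp: d_def \<rho>_def field_simps complex_eq_iff)
          then show ?thesis using True vJ by (auto intro!: sum.neutral)
        next
          case False
          then show ?thesis using that uJ(2)[of j k] vJ by auto
        qed
        then show ?thesis using nJ fJ by (simp add: d_def v(1))
      qed
      moreover have "b i = 0" if i: "i \<in> insert n J" and b: "\<forall>j\<in>insert n I. (\<Sum>i\<in>insert n J. b i * v i j) = 0" for b i
      proof -
        have "(\<Sum>i\<in>insert n J. b i * v i n) = b n * of_real r"
          using nJ fJ vJ by (simp add: v(1) \<rho>_def)
        then have bn: "b n = 0" using b r by auto
        have "(\<Sum>i\<in>J. b i * u i j) = 0" if "j \<in> I" for j
        proof -
          have "(\<Sum>i\<in>J. b i * u i j) = (\<Sum>i\<in>J. b i * v i j)" using vJ that by auto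
          also have "\<dots> = 0" using b that bn nJ fJ by auto
          finally show ?thesis .
        qed
        then show ?thesis using uJ(3)[of b i] bn i by auto
      qed
      moreover have "insert n J = insert n I \<and> invertible_on (insert n I) v"
        if pd: "\<forall>a. (\<exists>j\<in>insert n I. a j \<noteq> 0) \<longrightarrow> 0 < Re (quad_form (insert n I) c a)"
      proof -
        have "0 < Re (quad_form I d a)" if "\<exists>j\<in>I. a j \<noteq> 0" for a
        proof -
          let ?a = "a(n := - (\<Sum>j\<in>I. c j n * a j) / c n n)"
          have "\<exists>j\<in>insert n I. ?a j \<noteq> 0" using that nI by auto
          then have "0 < Re (quad_form (insert n I) c ?a)" using pd by blast
          then show ?thesis using complete[OF refl, of a] by (simp only: quad_form_def S_def)
        qed
        then have JI: "J = I" and "invertible_on I u" using ex_pd by blast+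
        then have s1: "\<exists>a. \<forall>j\<in>I. (\<Sum>i\<in>I. a i * u i j) = b j"
          and s2: "\<exists>a. \<forall>i\<in>I. (\<Sum>j\<in>I. u i j * a j) = b i" for b
          by (simp_all add: invertible_on_def)
        have A: "\<exists>a. \<forall>j\<in>insert n I. (\<Sum>i\<in>insert n I. a i * v i j) = b j" for b
        proof -
          obtain a where a: "\<forall>j\<in>I. (\<Sum>i\<in>I. a i * u i j) = b j - b n / of_real r * \<rho> j"
            using s1[of "\<lambda>j. b j - b n / of_real r * \<rho> j"] by auto
          have I: "(\<Sum>i\<in>I. (a(n := b n / of_real r)) i * v i j) = (if j = n then 0 else \<Sum>i\<in>I. a i * u i j)"
            if "j \<in> insert n I" for j using nI that by (auto simp: v intro!: sum.cong sum.neutral)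
          have "(\<Sum>i\<in>insert n I. (a(n := b n / of_real r)) i * v i j) = b j" if j: "j \<in> insert n I" for j
          proof -
            have "(\<Sum>i\<in>insert n I. (a(n := b n / of_real r)) i * v i j) = b n / of_real r * \<rho> j + (if j = n then 0 else \<Sum>i\<in>I. a i * u i j)"
              using nI fin by (simp only: sum.insert if_False not_False_eq_True I[OF j] v(1) fun_upd_same)
            then show ?thesis using a j r by (auto simp: \<rho>_def)
          qed
          then show ?thesis by (intro exI[of _ "a(n := b n / of_real r)"] ballI)
        qed
        have B: "\<exists>a. \<forall>i\<in>insert n I. (\<Sum>j\<in>insert n I. v i j * a j) = b i" for b
        proof -
          obtain a where a: "\<forall>i\<in>I. (\<Sum>j\<in>I. u i j * a j) = b i" using s2 by auto
          define x where "x = (b n - (\<Sum>j\<in>I. \<rho> j * a j)) / of_real r"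
          have I: "(\<Sum>j\<in>I. v i j * (a(n := x)) j) = (if i = n then \<Sum>j\<in>I. \<rho> j * a j else b i)"
            if "i \<in> insert n I" for i
          proof (cases "i = n")
            case True
            then show ?thesis using nI by (auto simp: v intro!: sum.cong)
          next
            case False
            then have "(\<Sum>j\<in>I. v i j * (a(n := x)) j) = (\<Sum>j\<in>I. u i j * a j)"
              using nI that by (intro sum.cong) (auto simp: v)
            then show ?thesis using a that False by auto
          qed
          have "(\<Sum>j\<in>insert n I. v i j * (a(n := x)) j) = b i" if i: "i \<in> insert n I" for i
          proof -
            have "(\<Sum>j\<in>insert n I. v i j * (a(n := x)) j) = v i n * x + (if i = n then \<Sum>j\<in>I. \<rho> j * a j else b i)"
              using nI fin by (simp only: sum.insert if_False not_False_eq_True I[OF i] fun_upd_same)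
            also have "v i n = (if i = n then of_real r else 0)" using i by (auto simp: v \<rho>_def)
            finally show ?thesis using r by (auto simp: x_def)
          qed
          then show ?thesis by (intro exI[of _ "a(n := x)"] ballI)
        qed
        show ?thesis unfolding invertible_on_def by (intro conjI allI A B) (simp only: JI)
      qed
      moreover have "insert n J \<subseteq> insert n I" using uJ(1) by blast
      ultimately have "rank_factorization (insert n I) c (insert n J) v \<and>
        ((\<forall>a. (\<exists>j\<in>insert n I. a j \<noteq> 0) \<longrightarrow> 0 < Re (quad_form (insert n I) c a)) \<longrightarrow>
          insert n J = insert n I \<and> invertible_on (insert n I) v)"
        unfolding rank_factorization_def by blast
      then show ?thesis by blast
    qed
qed

section \<open>Top powers of two-forms\<close>

text \<open>The alternating sum of \<open>top_wedge_power\<close> for a two-form with Gram matrix \<open>\<beta>\<close> in a basis indexed by pairs: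
  up to normalization, the Pfaffian of \<open>\<beta>\<close>.\<close>

definition alt_sum :: "('n::finite \<times> bool \<Rightarrow> 'n \<times> bool \<Rightarrow> real) \<Rightarrow> real" where
  "alt_sum \<beta> = (\<Sum>\<sigma> | \<sigma> permutes (UNIV :: ('n \<times> bool) set).
     of_int (sign \<sigma>) * (\<Prod>j\<in>UNIV. \<beta> (\<sigma> (j, False)) (\<sigma> (j, True))))"

lemma prod_over_pairs: "(\<Prod>p\<in>(UNIV::('n \<times> bool) set). f p) = (\<Prod>j\<in>UNIV. f (j, False) * f (j, True))"
  for f :: "'n::finite \<times> bool \<Rightarrow> 'c::comm_monoid_mult"
proof -
  have "(\<Prod>p\<in>(UNIV::('n \<times> bool) set). f p) = (\<Prod>j\<in>UNIV. \<Prod>b\<in>UNIV. f (j, b))"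
    by (simp add: prod.cartesian_product UNIV_Times_UNIV[symmetric] del: UNIV_Times_UNIV)
  then show ?thesis by (simp add: UNIV_bool mult.commute)
qed

lemma sum_over_pairs: "(\<Sum>p\<in>(UNIV::('n \<times> bool) set). f p) = (\<Sum>j\<in>UNIV. f (j, False) + f (j, True))"
  for f :: "'n::finite \<times> bool \<Rightarrow> 'c::comm_monoid_add"
proof -
  have "(\<Sum>p\<in>(UNIV::('n \<times> bool) set). f p) = (\<Sum>j\<in>UNIV. \<Sum>b\<in>UNIV. f (j, b))"
    by (simp add: sum.cartesian_product UNIV_Times_UNIV[symmetric] del: UNIV_Times_UNIV)
  then show ?thesis by (simp add: UNIV_bool add.commute)
qed

text \<open>Multiplying out, one chooses a function \<open>f\<close> on the indices.  For fixed \<open>f\<close> the sum over \<open>\<sigma>\<close>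
  is the determinant of the matrix whose columns are selected from \<open>B\<close> by \<open>f\<close>, which
  vanishes unless \<open>f\<close> is a permutation.\<close>

lemma alt_sum_transform:
  fixes B :: "real ^ ('n::finite \<times> bool) ^ ('n \<times> bool)"
  assumes "\<And>p q. \<beta>' p q = (\<Sum>r\<in>UNIV. \<Sum>s\<in>UNIV. B $ p $ r * B $ q $ s * \<beta> r s)"
  shows "alt_sum \<beta>' = det B * alt_sum \<beta>"
proof -
  let ?P = "{\<sigma>. \<sigma> permutes (UNIV :: ('n \<times> bool) set)}"
  define unpair :: "('n \<Rightarrow> ('n \<times> bool) \<times> ('n \<times> bool)) \<Rightarrow> 'n \<times> bool \<Rightarrow> 'n \<times> bool"
    where "unpair = (\<lambda>g (j, b). if b then snd (g j) else fst (g j))"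
  have bij: "bij unpair"
  proof (rule bijI')
    fix g h show "(unpair g = unpair h) = (g = h)"
      by (auto simp: unpair_def fun_eq_iff prod_eq_iff split: prod.splits if_splits)
  next
    fix f show "\<exists>g. f = unpair g"
      by (intro exI[of _ "\<lambda>j. (f (j, False), f (j, True))"]) (auto simp: unpair_def fun_eq_iff)
  qed
  have expand: "(\<Prod>j\<in>UNIV. \<beta>' (\<sigma> (j, False)) (\<sigma> (j, True)))
      = (\<Sum>f\<in>UNIV. (\<Prod>p\<in>UNIV. B $ \<sigma> p $ f p) * (\<Prod>j\<in>UNIV. \<beta> (f (j, False)) (f (j, True))))" for \<sigma> :: "'n \<times> bool \<Rightarrow> 'n \<times> bool"
  proof -
    have "(\<Prod>j\<in>UNIV. \<beta>' (\<sigma> (j, False)) (\<sigma> (j, True)))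
        = (\<Prod>j\<in>UNIV. \<Sum>(r, s)\<in>UNIV. B $ \<sigma> (j, False) $ r * B $ \<sigma> (j, True) $ s * \<beta> r s)"
      unfolding assms UNIV_Times_UNIV[symmetric] by (subst sum.cartesian_product) simp
    also have "\<dots> = (\<Sum>g\<in>UNIV. \<Prod>j\<in>UNIV. case g j of (r, s) \<Rightarrow> B $ \<sigma> (j, False) $ r * B $ \<sigma> (j, True) $ s * \<beta> r s)"
      by (subst prod_sum_PiE) (auto simp: PiE_UNIV_domain simp del: UNIV_Times_UNIV)
    also have "\<dots> = (\<Sum>g\<in>UNIV. (\<Prod>p\<in>UNIV. B $ \<sigma> p $ unpair g p) *
        (\<Prod>j\<in>UNIV. \<beta> (unpair g (j, False)) (unpair g (j, True))))"
      unfolding prod_over_pairs prod.distrib[symmetric]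
      by (intro sum.cong prod.cong) (auto simp: unpair_def split: prod.splits)
    also have "\<dots> = (\<Sum>f\<in>UNIV. (\<Prod>p\<in>UNIV. B $ \<sigma> p $ f p) * (\<Prod>j\<in>UNIV. \<beta> (f (j, False)) (f (j, True))))"
      by (rule sum.reindex_bij_betw[OF bij])
    finally show ?thesis .
  qed
  have det_f: "(\<Sum>\<sigma>\<in>?P. of_int (sign \<sigma>) * (\<Prod>p\<in>UNIV. B $ \<sigma> p $ f p))
      = (if f permutes UNIV then of_int (sign f) * det B else 0)" for f
  proof -
    have "(\<Sum>\<sigma>\<in>?P. of_int (sign \<sigma>) * (\<Prod>p\<in>UNIV. B $ \<sigma> p $ f p)) = det (\<chi> p. transpose B $ f p)"
      by (simp add: det_def transpose_def)
    also have "\<dots> = (if f permutes UNIV then of_int (sign f) * det B else 0)"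
    proof (cases "inj f")
      case True
      then have "f permutes UNIV" by (intro bij_imp_permutes) (auto simp: bij_def finite_UNIV_inj_surj)
      then show ?thesis by (simp add: det_permute_rows)
    next
      case False
      then obtain p q where pq: "p \<noteq> q" "f p = f q" unfolding inj_def by blast
      have "row p (\<chi> p. transpose B $ f p) = row q (\<chi> p. transpose B $ f p)"
        using pq by (simp add: row_def)
      then have "det (\<chi> p. transpose B $ f p) = 0" by (rule det_identical_rows[OF pq(1)])
      moreover have "\<not> f permutes UNIV" using False permutes_inj by blast
      ultimately show ?thesis by simp
    qed
    finally show ?thesis .
  qed
  have "alt_sum \<beta>' = (\<Sum>\<sigma>\<in>?P. \<Sum>f\<in>UNIV. of_int (sign \<sigma>) * (\<Prod>p\<in>UNIV. B $ \<sigma> p $ f p) *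
      (\<Prod>j\<in>UNIV. \<beta> (f (j, False)) (f (j, True))))"
    unfolding alt_sum_def expand by (simp add: sum_distrib_left mult.assoc)
  also have "\<dots> = (\<Sum>f\<in>UNIV. (\<Sum>\<sigma>\<in>?P. of_int (sign \<sigma>) * (\<Prod>p\<in>UNIV. B $ \<sigma> p $ f p)) *
      (\<Prod>j\<in>UNIV. \<beta> (f (j, False)) (f (j, True))))"
    unfolding sum_distrib_right by (rule sum.swap)
  also have "\<dots> = (\<Sum>f\<in>?P. of_int (sign f) * det B * (\<Prod>j\<in>UNIV. \<beta> (f (j, False)) (f (j, True))))"
    unfolding det_f by (intro sum.mono_neutral_cong_right) auto
  also have "\<dots> = det B * alt_sum \<beta>"
    unfolding alt_sum_def sum_distrib_left by (intro sum.cong) auto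
  finally show ?thesis .
qed

text \<open>The Gram matrix of the standard Kaehler form in the basis \<open>e\<^sub>j, \<i> e\<^sub>j\<close>.\<close>

definition std_symplectic :: "'n \<times> bool \<Rightarrow> 'n \<times> bool \<Rightarrow> real" where
  "std_symplectic = (\<lambda>(j, a) (k, b). if j = k \<and> a \<noteq> b then (if a then - 1 else 1) else 0)"

lemma permutation_finite_bij: "bij f \<Longrightarrow> permutation f" for f :: "'a::finite \<Rightarrow> 'a"
  using permutes_imp_permutation[OF finite, of f UNIV] bij_imp_permutes[of f UNIV] by auto

lemma inj_imp_permutation: "inj f \<Longrightarrow> permutation f" for f :: "'a::finite \<Rightarrow> 'a"
  by (intro permutation_finite_bij) (simp add: bij_def finite_UNIV_inj_surj)

definition flip :: "'n set \<Rightarrow> 'n \<times> bool \<Rightarrow> 'n \<times> bool" where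
  "flip J = (\<lambda>(j, a). (j, if j \<in> J then \<not> a else a))"

lemma permutation_flip: "permutation (flip J)" for J :: "'n::finite set"
  by (intro inj_imp_permutation injI) (auto simp: flip_def split: if_splits)

lemma sign_flip: "sign (flip J) = (- 1) ^ card J" for J :: "'n::finite set"
proof (induction J rule: finite_induct[OF finite])
  case 1
  have "flip {} = (id :: 'n \<times> bool \<Rightarrow> _)" by (auto simp: flip_def)
  then show ?case by simp
next
  case (2 x J)
  have "flip (insert x J) = Transposition.transpose (x, False) (x, True) \<circ> flip J"
    using 2(2) by (auto simp: fun_eq_iff Transposition.transpose_def flip_def)
  then have "sign (flip (insert x J)) = sign (Transposition.transpose (x, False) (x, True)) * sign (flip J)"
    by (simp only: sign_compose[OF permutation_swap_id permutation_flip])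
  then show ?case using 2 by (simp add: sign_swap_id)
qed

text \<open>The permutation acts in the same way on the first and on the second members of the pairs, so its
  sign is a square.\<close>

lemma sign_lift_pairs:
  fixes \<tau> :: "'n::finite \<Rightarrow> 'n"
  assumes "bij \<tau>"
  shows "sign (\<lambda>(j, a::bool). (\<tau> j, a)) = 1"
proof -
  define s where "s = (\<lambda>(j::'n, a). (j, \<not> a))"
  define t where "t = (\<lambda>(j, a). (if a then \<tau> j else j, a))"
  have ss: "s \<circ> s = id" by (auto simp: s_def fun_eq_iff)
  have ps: "permutation s" by (intro permutation_finite_bij o_bij[OF ss ss])
  have pt: "permutation t" unfolding t_def
    using assms by (intro inj_imp_permutation injI) (auto simp: bij_def inj_def split: if_splits)
  have "(\<lambda>(j, a::bool). (\<tau> j, a)) = t \<circ> (s \<circ> (t \<circ> s))"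
    by (auto simp: fun_eq_iff t_def s_def)
  then show ?thesis using ps pt by (simp add: sign_compose permutation_compose mult_ac)
qed

text \<open>A permutation contributes only if it maps pairs to pairs.  It is then a permutation of the pairs, which is even,
  composed with flips of some pairs; every flip changes both the sign of the permutation and
  that of one factor.  Hence no term is negative, and the identity contributes 1.\<close>

lemma alt_sum_std_symplectic_pos: "0 < alt_sum (std_symplectic :: 'n::finite \<times> bool \<Rightarrow> _)"
proof -
  have nonneg: "0 \<le> of_int (sign \<sigma>) * (\<Prod>j\<in>UNIV. std_symplectic (\<sigma> (j, False)) (\<sigma> (j, True)))"
    if \<sigma>: "\<sigma> permutes (UNIV :: ('n \<times> bool) set)" for \<sigma>
  proof (cases "\<exists>j. std_symplectic (\<sigma> (j, False)) (\<sigma> (j, True)) = 0")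
    case True
    then have "(\<Prod>j\<in>UNIV. std_symplectic (\<sigma> (j, False)) (\<sigma> (j, True))) = 0"
      by (intro prod_zero) auto
    then show ?thesis by (simp only: mult_zero_right order_refl)
  next
    case False
    define \<tau> where "\<tau> = (\<lambda>j. fst (\<sigma> (j, False)))"
    define J where "J = {j. snd (\<sigma> (j, False))}"
    have F: "\<sigma> (j, False) = (\<tau> j, j \<in> J)" for j by (simp add: \<tau>_def J_def)
    have T: "\<sigma> (j, True) = (\<tau> j, j \<notin> J)" for j
    proof -
      have "std_symplectic (\<tau> j, j \<in> J) (\<sigma> (j, True)) \<noteq> 0" using False F[of j] by metis
      then show ?thesis by (cases "\<sigma> (j, True)") (auto simp: std_symplectic_def split: if_splits)
    qed
    have "inj \<tau>"
    proof (rule injI)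
      fix j k assume jk: "\<tau> j = \<tau> k"
      have inj: "\<sigma> p = \<sigma> q \<Longrightarrow> p = q" for p q using permutes_inj[OF \<sigma>] by (simp add: inj_eq)
      show "j = k"
      proof (cases "(j \<in> J) = (k \<in> J)")
        case True then show ?thesis using inj[of "(j, False)" "(k, False)"] F jk by auto
      next
        case False then show ?thesis using inj[of "(j, False)" "(k, True)"] F T jk by auto
      qed
    qed
    then have bij: "bij \<tau>" by (simp add: bij_def finite_UNIV_inj_surj)
    let ?l = "\<lambda>(j, a::bool). (\<tau> j, a)"
    have "\<sigma> p = (?l \<circ> flip J) p" for p
      by (cases p; cases "snd p") (use F T in \<open>auto simp: flip_def\<close>)
    then have eq: "\<sigma> = ?l \<circ> flip J" by blast
    have "permutation ?l" using \<open>inj \<tau>\<close> by (intro inj_imp_permutation injI) (auto simp: inj_def)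
    then have "sign \<sigma> = (- 1) ^ card J"
      unfolding eq by (simp add: sign_compose permutation_flip sign_lift_pairs[OF bij] sign_flip)
    moreover have "(\<Prod>j\<in>UNIV. std_symplectic (\<sigma> (j, False)) (\<sigma> (j, True))) = (\<Prod>j\<in>UNIV. if j \<in> J then - 1 else 1)"
      by (intro prod.cong) (auto simp: F T std_symplectic_def)
    moreover have "\<dots> = (- 1) ^ card J" by (simp add: prod.If_cases)
    ultimately show ?thesis by (simp add: power_mult_distrib[symmetric])
  qed
  have "of_int (sign (id::'n \<times> bool \<Rightarrow> _)) * (\<Prod>j\<in>UNIV. std_symplectic (id (j::'n, False)) (id (j, True))) = 1"
    by (simp add: std_symplectic_def)
  then have "1 \<le> alt_sum (std_symplectic :: 'n \<times> bool \<Rightarrow> _)"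
    unfolding alt_sum_def
    by (intro order_trans[OF _ member_le_sum[of id]]) (auto intro: nonneg permutes_id simp: finite_permutations)
  then show ?thesis by simp
qed

definition real_coords :: "complex^'n::finite \<Rightarrow> real ^ ('n \<times> bool)" where
  "real_coords z = (\<chi> p. if snd p then Im (z $ fst p) else Re (z $ fst p))"

lemma real_coords_expansion: "z = (\<Sum>p\<in>UNIV. (real_coords z $ p) *\<^sub>R real_basis p)"
proof (subst vec_eq_iff, intro allI)
  fix i
  have "(\<Sum>p\<in>UNIV. (real_coords z $ p) *\<^sub>R real_basis p) $ i
      = (\<Sum>j\<in>UNIV. (if j = i then z $ j else 0))"
    unfolding sum_component sum_over_pairs
    by (intro sum.cong refl) (auto simp: real_coords_def real_basis_def axis_def complex_eq_iff)
  also have "\<dots> = z $ i" by simp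
  finally show "z $ i = (\<Sum>p\<in>UNIV. (real_coords z $ p) *\<^sub>R real_basis p) $ i" by simp
qed

lemma top_wedge_power_alt_sum:
  "top_wedge_power \<omega> = alt_sum (\<lambda>p q. \<omega> (real_basis p) (real_basis q)) / 2 ^ CARD('n)"
  for \<omega> :: "complex^'n::finite \<Rightarrow> complex^'n \<Rightarrow> real"
  by (simp add: top_wedge_power_def alt_sum_def)

lemma top_wedge_power_pullback:
  fixes T :: "complex^'n::finite \<Rightarrow> complex^'n"
  assumes "bilinear \<omega>"
  shows "top_wedge_power (\<lambda>u v. \<omega> (T u) (T v)) = det (\<chi> p. real_coords (T (real_basis p))) * top_wedge_power \<omega>"
proof -
  have "\<omega> (T (real_basis p)) (T (real_basis q)) = (\<Sum>r\<in>UNIV. \<Sum>s\<in>UNIV.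
      (\<chi> p. real_coords (T (real_basis p))) $ p $ r * (\<chi> p. real_coords (T (real_basis p))) $ q $ s
      * \<omega> (real_basis r) (real_basis s))" for p q
  proof -
    have "\<omega> (T (real_basis p)) (T (real_basis q))
      = \<omega> (\<Sum>r\<in>UNIV. (real_coords (T (real_basis p)) $ r) *\<^sub>R real_basis r) (\<Sum>s\<in>UNIV. (real_coords (T (real_basis q)) $ s) *\<^sub>R real_basis s)"
      by (simp add: real_coords_expansion[symmetric])
    also have "\<dots> = (\<Sum>(r, s)\<in>UNIV \<times> UNIV. \<omega> ((real_coords (T (real_basis p)) $ r) *\<^sub>R real_basis r) ((real_coords (T (real_basis q)) $ s) *\<^sub>R real_basis s))"
      by (rule bilinear_sum[OF assms])
    also have "\<dots> = (\<Sum>(r, s)\<in>UNIV \<times> UNIV. real_coords (T (real_basis p)) $ r * real_coords (T (real_basis q)) $ s * \<omega> (real_basis r) (real_basis s))"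
      by (intro sum.cong) (auto simp: bilinear_lmul[OF assms] bilinear_rmul[OF assms])
    finally show ?thesis by (simp add: sum.cartesian_product)
  qed
  then show ?thesis unfolding top_wedge_power_alt_sum by (subst alt_sum_transform) auto
qed

text \<open>The real form of type (1,1) with coefficient matrix \<open>H\<close>.\<close>

definition form11 :: "(complex^'n^'n::finite) \<Rightarrow> complex^'n \<Rightarrow> complex^'n \<Rightarrow> real" where
  "form11 H u v = Re (\<i> / 2 * (\<Sum>j\<in>UNIV. \<Sum>k\<in>UNIV. H $ j $ k * (u $ j * cnj (v $ k) - v $ j * cnj (u $ k))))"

lemma bilinear_form11: "bilinear (form11 H)"
proof -
  have eq: "form11 H u v = (\<Sum>j\<in>UNIV. \<Sum>k\<in>UNIV. Re (\<i> / 2 * (H $ j $ k * (u $ j * cnj (v $ k) - v $ j * cnj (u $ k)))))" for u v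
    unfolding form11_def sum_distrib_left Re_sum ..
  have "linear (\<lambda>u. form11 H u v)" "linear (\<lambda>v. form11 H u v)" for u v
    unfolding eq
    by (intro linear_compose_sum ballI linearI; simp add: field_simps)+
  then show ?thesis by (simp add: bilinear_def)
qed

lemma form11_std: "form11 (mat 1) (real_basis p) (real_basis q) = std_symplectic p q"
proof -
  obtain j a k b where p: "p = (j, a)" and q: "q = (k, b)" by (cases p, cases q)
  have "form11 (mat 1) u v = Re (\<i> / 2 * (\<Sum>j\<in>UNIV. u $ j * cnj (v $ j) - v $ j * cnj (u $ j)))" for u v :: "complex^'a"
  proof -
    have "(\<Sum>k\<in>UNIV. mat 1 $ j $ k * (u $ j * cnj (v $ k) - v $ j * cnj (u $ k))) = u $ j * cnj (v $ j) - v $ j * cnj (u $ j)" for j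
      by (simp add: mat_def if_distrib[of "\<lambda>x. x * _"] cong: if_cong)
    then show ?thesis by (simp add: form11_def)
  qed
  also have "(\<Sum>i\<in>UNIV. real_basis p $ i * cnj (real_basis q $ i) - real_basis q $ i * cnj (real_basis p $ i))
     = (\<Sum>i\<in>UNIV. if i = j then (if j = k then (if a then \<i> else 1) * cnj (if b then \<i> else 1) - (if b then \<i> else 1) * cnj (if a then \<i> else 1) else 0) else 0)"
    by (intro sum.cong) (auto simp: p q real_basis_def axis_def)
  finally show ?thesis by (auto simp: p q std_symplectic_def)
qed

lemma sum_swap_pairs:
  "(\<Sum>j\<in>A. \<Sum>k\<in>B. \<Sum>l\<in>C. \<Sum>m\<in>D. f j k l m) = (\<Sum>l\<in>C. \<Sum>m\<in>D. \<Sum>j\<in>A. \<Sum>k\<in>B. f j k l m)"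
proof -
  have "(\<Sum>j\<in>A. \<Sum>k\<in>B. \<Sum>l\<in>C. \<Sum>m\<in>D. f j k l m) = (\<Sum>j\<in>A. \<Sum>l\<in>C. \<Sum>k\<in>B. \<Sum>m\<in>D. f j k l m)"
    by (rule sum.cong[OF refl], rule sum.swap)
  also have "\<dots> = (\<Sum>l\<in>C. \<Sum>j\<in>A. \<Sum>k\<in>B. \<Sum>m\<in>D. f j k l m)" by (rule sum.swap)
  also have "\<dots> = (\<Sum>l\<in>C. \<Sum>j\<in>A. \<Sum>m\<in>D. \<Sum>k\<in>B. f j k l m)"
    by (rule sum.cong[OF refl], rule sum.cong[OF refl], rule sum.swap)
  also have "\<dots> = (\<Sum>l\<in>C. \<Sum>m\<in>D. \<Sum>j\<in>A. \<Sum>k\<in>B. f j k l m)"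
    by (rule sum.cong[OF refl], rule sum.swap)
  finally show ?thesis .
qed

lemma sum_sum_factor:
  "(\<Sum>j\<in>A. \<Sum>k\<in>B. h * a j * cnj (b k)) = h * ((\<Sum>j\<in>A. a j) * cnj (\<Sum>k\<in>B. b k))"
  unfolding cnj_sum sum_product by (simp add: sum_distrib_left mult.assoc)

lemma form11_pullback:
  fixes U :: "complex^'n^'n::finite"
  assumes "\<And>j k. H' $ j $ k = (\<Sum>l\<in>UNIV. \<Sum>m\<in>UNIV. H $ l $ m * U $ l $ j * cnj (U $ m $ k))"
  shows "form11 H' u v = form11 H (U *v u) (U *v v)"
proof -
  have *: "(\<Sum>j\<in>UNIV. \<Sum>k\<in>UNIV. H' $ j $ k * (u $ j * cnj (v $ k)))
      = (\<Sum>l\<in>UNIV. \<Sum>m\<in>UNIV. H $ l $ m * ((U *v u) $ l * cnj ((U *v v) $ m)))" for u v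
  proof -
    have "(\<Sum>j\<in>UNIV. \<Sum>k\<in>UNIV. H' $ j $ k * (u $ j * cnj (v $ k)))
      = (\<Sum>j\<in>UNIV. \<Sum>k\<in>UNIV. \<Sum>l\<in>UNIV. \<Sum>m\<in>UNIV. H $ l $ m * (U $ l $ j * u $ j) * cnj (U $ m $ k * v $ k))"
      unfolding assms sum_distrib_right by (intro sum.cong refl) (simp add: mult_ac)
    also have "\<dots> = (\<Sum>l\<in>UNIV. \<Sum>m\<in>UNIV. \<Sum>j\<in>UNIV. \<Sum>k\<in>UNIV. H $ l $ m * (U $ l $ j * u $ j) * cnj (U $ m $ k * v $ k))"
      by (rule sum_swap_pairs)
    also have "\<dots> = (\<Sum>l\<in>UNIV. \<Sum>m\<in>UNIV. H $ l $ m * ((U *v u) $ l * cnj ((U *v v) $ m)))"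
      unfolding matrix_vector_mult_def vec_lambda_beta sum_sum_factor ..
    finally show ?thesis .
  qed
  show ?thesis unfolding form11_def right_diff_distrib sum_subtractf
    using *[of u v] *[of v u] by (simp add: right_diff_distrib)
qed

text \<open>The real part in \<open>form11\<close> discards the contribution of the anti-Hermitian part of \<open>H\<close>.\<close>

lemma hermitian_part_form11:
  "form11 (\<chi> j k. (H $ j $ k + cnj (H $ k $ j)) / 2) u v = form11 H u v"
proof -
  define S where "S = (\<lambda>H. \<Sum>j\<in>UNIV. \<Sum>k\<in>UNIV. H j k * (u $ j * cnj (v $ k) - v $ j * cnj (u $ k)))"
  have "cnj (S (\<lambda>j k. H $ j $ k)) = (\<Sum>j\<in>UNIV. \<Sum>k\<in>UNIV. cnj (H $ j $ k) * (cnj (u $ j) * v $ k - cnj (v $ j) * u $ k))"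
    by (simp add: S_def)
  also have "\<dots> = (\<Sum>k\<in>UNIV. \<Sum>j\<in>UNIV. cnj (H $ j $ k) * (cnj (u $ j) * v $ k - cnj (v $ j) * u $ k))"
    by (rule sum.swap)
  also have "\<dots> = - S (\<lambda>j k. cnj (H $ k $ j))"
    unfolding S_def sum_negf[symmetric] by (intro sum.cong refl) (simp add: algebra_simps)
  finally have *: "S (\<lambda>j k. cnj (H $ k $ j)) = - cnj (S (\<lambda>j k. H $ j $ k))" by simp
  have "S (\<lambda>j k. (H $ j $ k + cnj (H $ k $ j)) / 2) = (S (\<lambda>j k. H $ j $ k) + S (\<lambda>j k. cnj (H $ k $ j))) / 2"
    unfolding S_def sum.distrib[symmetric] sum_divide_distrib
    by (intro sum.cong refl) (simp add: field_simps)
  moreover have "form11 (\<chi> j k. K j k) u v = Re (\<i> / 2 * S K)" for K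
    by (simp only: form11_def S_def vec_lambda_beta)
  moreover have "form11 H u v = Re (\<i> / 2 * S (\<lambda>j k. H $ j $ k))"
    by (simp only: form11_def S_def)
  ultimately show ?thesis unfolding * by (simp only:) simp
qed

lemma form11_diag: "form11 H u (\<i> *s u) = Re (\<Sum>j\<in>UNIV. \<Sum>k\<in>UNIV. H $ j $ k * u $ j * cnj (u $ k))"
proof -
  have "(\<Sum>j\<in>UNIV. \<Sum>k\<in>UNIV. H $ j $ k * (u $ j * cnj ((\<i> *s u) $ k) - (\<i> *s u) $ j * cnj (u $ k)))
     = - 2 * \<i> * (\<Sum>j\<in>UNIV. \<Sum>k\<in>UNIV. H $ j $ k * u $ j * cnj (u $ k))"
    unfolding sum_distrib_left by (intro sum.cong refl) (simp add: algebra_simps)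
  then show ?thesis unfolding form11_def by simp
qed

lemma linear_real_coords: "linear real_coords"
  by (intro linearI) (auto simp: real_coords_def vec_eq_iff)

lemma real_coords_inverse: "real_coords (\<Sum>p\<in>UNIV. (x $ p) *\<^sub>R real_basis p) = x"
proof -
  have "real_coords (real_basis p) = axis p 1" for p :: "'a \<times> bool"
    by (cases p) (auto simp: real_coords_def real_basis_def axis_def vec_eq_iff)
  then show ?thesis
    unfolding linear_sum[OF linear_real_coords] o_def linear_cmul[OF linear_real_coords]
    by (simp add: basis_expansion[of x, unfolded scalar_mult_eq_scaleR])
qed

lemma det_real_coords_nonzero:
  fixes T :: "complex^'n::finite \<Rightarrow> complex^'n"
  assumes "linear T" "\<And>u. T u = 0 \<Longrightarrow> u = 0"
  shows "det (\<chi> p. real_coords (T (real_basis p))) \<noteq> 0"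
proof -
  define g where "g = (\<lambda>x::real^('n \<times> bool). real_coords (T (\<Sum>p\<in>UNIV. (x $ p) *\<^sub>R real_basis p)))"
  have lin: "linear g" unfolding g_def
    by (intro linear_compose[OF _ linear_real_coords, unfolded o_def] linear_compose[OF _ assms(1), unfolded o_def]
        linear_compose_sum ballI linearI) (auto simp: algebra_simps)
  have "x = 0" if "g x = 0" for x
  proof -
    have "T (\<Sum>p\<in>UNIV. (x $ p) *\<^sub>R real_basis p) = 0"
      using real_coords_expansion[of "T (\<Sum>p\<in>UNIV. (x $ p) *\<^sub>R real_basis p)"] that by (simp add: g_def)
    then have "(\<Sum>p\<in>UNIV. (x $ p) *\<^sub>R real_basis p) = (0 :: complex^'n)" by (rule assms(2))
    then show ?thesis using real_coords_inverse[of x] by (simp add: linear_0[OF linear_real_coords])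
  qed
  then have "inj g" using lin by (simp add: linear_injective_0)
  then have "det (matrix g) \<noteq> 0" using lin by (simp add: det_nz_iff_inj)
  moreover have "matrix g = transpose (\<chi> p. real_coords (T (real_basis p)))"
  proof -
    have ax: "(\<Sum>q\<in>UNIV. (axis p 1 $ q) *\<^sub>R real_basis q) = (real_basis p :: complex^'n)" for p :: "'n \<times> bool"
      by (simp add: axis_def if_distrib[of "\<lambda>x. x *\<^sub>R _"] cong: if_cong)
    show ?thesis unfolding matrix_def g_def ax by (simp add: vec_eq_iff transpose_def)
  qed
  ultimately show ?thesis by simp
qed

text \<open>By the Cholesky factorization a positive form is the pullback of the standard one under an
  invertible complex matrix, so its top power does not vanish.  The segment from the standard form to the
  given one consists of positive forms; the top power is continuous along it and positive at its start.\<close>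

lemma top_wedge_power_form11_pos:
  fixes H :: "complex^'n^'n::finite"
  assumes pos: "\<And>u. u \<noteq> 0 \<Longrightarrow> 0 < form11 H u (\<i> *s u)"
  shows "0 < top_wedge_power (form11 H)"
proof -
  define Ht where "Ht = (\<lambda>t::real. (1 - t) *\<^sub>R mat 1 + t *\<^sub>R H)"
  have form_Ht: "form11 (Ht t) u v = (1 - t) * form11 (mat 1) u v + t * form11 H u v" for t u v
  proof -
    have "(\<Sum>j\<in>UNIV. \<Sum>k\<in>UNIV. Ht t $ j $ k * (u $ j * cnj (v $ k) - v $ j * cnj (u $ k)))
       = of_real (1 - t) * (\<Sum>j\<in>UNIV. \<Sum>k\<in>UNIV. mat 1 $ j $ k * (u $ j * cnj (v $ k) - v $ j * cnj (u $ k)))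
        + of_real t * (\<Sum>j\<in>UNIV. \<Sum>k\<in>UNIV. H $ j $ k * (u $ j * cnj (v $ k) - v $ j * cnj (u $ k)))"
      unfolding sum_distrib_left sum.distrib[symmetric] Ht_def
      by (intro sum.cong refl) (simp add: scaleR_conv_of_real[where 'a=complex] algebra_simps)
    then have "\<i> / 2 * (\<Sum>j\<in>UNIV. \<Sum>k\<in>UNIV. Ht t $ j $ k * (u $ j * cnj (v $ k) - v $ j * cnj (u $ k)))
       = of_real (1 - t) * (\<i> / 2 * (\<Sum>j\<in>UNIV. \<Sum>k\<in>UNIV. mat 1 $ j $ k * (u $ j * cnj (v $ k) - v $ j * cnj (u $ k))))
        + of_real t * (\<i> / 2 * (\<Sum>j\<in>UNIV. \<Sum>k\<in>UNIV. H $ j $ k * (u $ j * cnj (v $ k) - v $ j * cnj (u $ k))))"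
      by (simp add: distrib_left mult.left_commute)
    then show ?thesis unfolding form11_def by (simp only: plus_complex.sel times_complex.sel Re_complex_of_real Im_complex_of_real mult_zero_left diff_zero)
  qed
  have std_pos: "0 < form11 (mat 1) u (\<i> *s u)" if "u \<noteq> 0" for u :: "complex^'n"
  proof -
    have "form11 (mat 1) u (\<i> *s u) = (\<Sum>j\<in>UNIV. (cmod (u $ j))\<^sup>2)"
      unfolding form11_diag by (simp add: mat_def if_distrib[of "\<lambda>x. x * _"] cmod_power2 cong: if_cong)
        (simp add: power2_eq_square)
    also have "\<dots> > 0"
    proof -
      have "\<exists>i. u $ i \<noteq> 0" using that by (auto simp: vec_eq_iff)
      then obtain i where "u $ i \<noteq> 0" ..
      then show ?thesis by (intro sum_pos2[of UNIV i]) auto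
    qed
    finally show ?thesis .
  qed
  have pos_t: "0 < form11 (Ht t) u (\<i> *s u)" if "0 \<le> t" "t \<le> 1" "u \<noteq> 0" for t u
    unfolding form_Ht using std_pos[OF that(3)] pos[OF that(3)] that(1,2)
    by (cases "t = 0") (auto intro!: add_nonneg_pos mult_nonneg_nonneg simp: less_imp_le)
  have std: "0 < top_wedge_power (form11 (mat 1 :: complex^'n^'n))"
    unfolding top_wedge_power_alt_sum form11_std using alt_sum_std_symplectic_pos[where 'n='n] by simp
  have nonzero: "top_wedge_power (form11 M) \<noteq> 0"
    if M: "\<And>u. u \<noteq> 0 \<Longrightarrow> 0 < form11 M u (\<i> *s u)" for M :: "complex^'n^'n"
  proof -
    define N where "N = (\<chi> j k. (M $ j $ k + cnj (M $ k $ j)) / 2)"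
    have NM: "form11 N = form11 M" unfolding N_def by (intro ext hermitian_part_form11)
    have quad: "Re (quad_form UNIV (\<lambda>j k. N $ j $ k) (\<lambda>j. u $ j)) = form11 M u (\<i> *s u)" for u
      unfolding NM[symmetric] form11_diag quad_form_def ..
    have quad': "Re (quad_form UNIV (\<lambda>j k. N $ j $ k) a) = form11 M (\<chi> j. a j) (\<i> *s (\<chi> j. a j))" for a
      using quad[of "\<chi> j. a j"] by simp
    have pd: "0 < Re (quad_form UNIV (\<lambda>j k. N $ j $ k) a)" if "\<exists>j\<in>UNIV. a j \<noteq> 0" for a
      unfolding quad' using that by (intro M) (auto simp: vec_eq_iff)
    have psd: "0 \<le> Re (quad_form UNIV (\<lambda>j k. N $ j $ k) a)" for a
      using pd[of a] by (cases "\<exists>j\<in>UNIV. a j \<noteq> 0") (auto simp: quad_form_def less_imp_le)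
    obtain J u where "rank_factorization UNIV (\<lambda>j k. N $ j $ k) J u" "J = UNIV"
      using cholesky_decomposition[of UNIV "\<lambda>j k. N $ j $ k"] pd psd by (auto simp: N_def)
    then have fac: "N $ j $ k = (\<Sum>i\<in>UNIV. u i j * cnj (u i k))" for j k
      by (simp add: rank_factorization_def)
    define U where "U = (\<chi> i j. u i j)"
    have "form11 N v w = form11 (mat 1) (U *v v) (U *v w)" for v w
      by (rule form11_pullback)
        (simp add: fac U_def mat_def if_distrib[of "\<lambda>x. x * _"] cong: if_cong)
    then have pull: "form11 M = (\<lambda>v w. form11 (mat 1) (U *v v) (U *v w))" unfolding NM[symmetric] by blast
    have lin: "linear ((*v) U)"
      by (intro linearI matrix_vector_right_distrib) (auto simp: matrix_vector_mult_def vec_eq_iff scaleR_sum_right)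
    have "v = 0" if "U *v v = 0" for v
    proof (rule ccontr)
      assume "v \<noteq> 0"
      then have "0 < form11 M v (\<i> *s v)" by (rule M)
      then show False unfolding pull that by (simp add: form11_def)
    qed
    then show ?thesis
      unfolding pull top_wedge_power_pullback[OF bilinear_form11, of _ "(*v) U"] using det_real_coords_nonzero[OF lin] std by simp
  qed
  have cont: "continuous_on {0..1} (\<lambda>t. top_wedge_power (form11 (Ht t)))"
    unfolding top_wedge_power_def form_Ht by (intro continuous_intros) auto
  show ?thesis
  proof (rule ccontr)
    assume "\<not> ?thesis"
    then have "top_wedge_power (form11 (Ht 1)) \<le> 0" by (simp add: Ht_def)
    moreover have "0 \<le> top_wedge_power (form11 (Ht 0))" using std by (simp add: Ht_def)
    ultimately obtain t where "0 \<le> t" "t \<le> 1" "top_wedge_power (form11 (Ht t)) = 0"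
      using IVT2'[of "\<lambda>t. top_wedge_power (form11 (Ht t))" 1 0 0] cont by auto
    then show False using nonzero[of "Ht t"] pos_t by blast
  qed
qed

section \<open>Holomorphic functions of several variables\<close>

text \<open>For holomorphic \<open>f\<close> the real derivative in the direction \<open>e\<^sub>j\<close> is the complex partial derivative.\<close>

definition pd :: "'m \<Rightarrow> (complex^'m::finite \<Rightarrow> complex) \<Rightarrow> complex^'m \<Rightarrow> complex" where
  "pd j f z = frechet_derivative f (at z) (axis j 1)"

lemma pd_eqI:
  assumes "(f has_derivative (\<lambda>h. \<Sum>j\<in>UNIV. a j * h $ j)) (at z)"
  shows "pd j f z = a j"
proof -
  have "frechet_derivative f (at z) = (\<lambda>h. \<Sum>j\<in>UNIV. a j * h $ j)"
    using frechet_derivative_at[OF assms] by simp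
  then show ?thesis by (simp add: pd_def axis_def if_distrib[of "\<lambda>x. _ * x"] cong: if_cong)
qed

lemma cholo_on_open: "cholo_on f S \<Longrightarrow> open S"
  by (simp add: cholo_on_def)

lemma cholo_on_has_derivative:
  assumes "cholo_on f S" "z \<in> S"
  shows "(f has_derivative (\<lambda>h. \<Sum>j\<in>UNIV. pd j f z * h $ j)) (at z)"
proof -
  obtain a where a: "(f has_derivative (\<lambda>h. \<Sum>j\<in>UNIV. a $ j * h $ j)) (at z)"
    using assms by (auto simp: cholo_on_def)
  show ?thesis using a unfolding pd_eqI[OF a] .
qed

lemma cholo_onI:
  assumes "open S" "\<And>z. z \<in> S \<Longrightarrow> (f has_derivative (\<lambda>h. \<Sum>j\<in>UNIV. a z j * h $ j)) (at z)"
  shows "cholo_on f S"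
  unfolding cholo_on_def
proof (intro conjI ballI)
  fix z assume "z \<in> S"
  then show "\<exists>a. (f has_derivative (\<lambda>h. \<Sum>j\<in>UNIV. a $ j * h $ j)) (at z)"
    using assms(2) by (intro exI[of _ "\<chi> j. a z j"]) simp
qed fact

lemma cholo_on_continuous: "cholo_on f S \<Longrightarrow> continuous_on S f"
  by (meson cholo_on_has_derivative continuous_at_imp_continuous_on has_derivative_continuous)

lemma has_derivative_cong_open:
  assumes "(f has_derivative D) (at z)" "open S" "z \<in> S" "\<And>w. w \<in> S \<Longrightarrow> f w = g w"
  shows "(g has_derivative D) (at z)"
  using has_derivative_transform_within_open[OF assms(1-3)] assms(4) by blast

lemma cholo_on_cong:
  assumes "cholo_on f S" "\<And>z. z \<in> S \<Longrightarrow> f z = g z"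
  shows "cholo_on g S"
  using assms cholo_on_open[OF assms(1)]
  by (intro cholo_onI[where a = "\<lambda>z j. pd j f z"]) (auto intro: has_derivative_cong_open cholo_on_has_derivative)

lemma cholo_on_subset: "cholo_on f S \<Longrightarrow> open T \<Longrightarrow> T \<subseteq> S \<Longrightarrow> cholo_on f T"
  by (auto simp: cholo_on_def)

lemma cholo_on_locally:
  assumes "open S" "\<And>z. z \<in> S \<Longrightarrow> \<exists>T. z \<in> T \<and> cholo_on f T"
  shows "cholo_on f S"
  using assms unfolding cholo_on_def by blast

lemma pd_cong:
  assumes "cholo_on f S" "z \<in> S" "\<And>z. z \<in> S \<Longrightarrow> f z = g z"
  shows "pd j f z = pd j g z"
  by (rule pd_eqI[symmetric]) (use assms cholo_on_open[OF assms(1)] in \<open>auto intro: has_derivative_cong_open cholo_on_has_derivative\<close>)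

lemma has_derivative_const_sum: "((\<lambda>_. c) has_derivative (\<lambda>h. \<Sum>j\<in>UNIV. 0 * h $ j)) (at z)"
  for z :: "complex^'m::finite"
  by simp

lemma has_derivative_component_sum:
  "((\<lambda>z. z $ k) has_derivative (\<lambda>h. \<Sum>j\<in>UNIV. (if j = k then 1 else 0) * h $ j)) (at z)"
  for z :: "complex^'m::finite"
proof -
  have "((\<lambda>z::complex^'m. z $ k) has_derivative (\<lambda>h. h $ k)) (at z)"
    by (rule bounded_linear_imp_has_derivative[OF bounded_linear_vec_nth])
  then show ?thesis by (simp add: if_distrib[of "\<lambda>x. x * _"] cong: if_cong)
qed

lemma cholo_on_const: "open S \<Longrightarrow> cholo_on (\<lambda>_. c) S"
  by (rule cholo_onI[OF _ has_derivative_const_sum])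

lemma cholo_on_component: "open S \<Longrightarrow> cholo_on (\<lambda>z. z $ k) S"
  by (rule cholo_onI[OF _ has_derivative_component_sum])

lemma has_derivative_mult_sum:
  assumes "cholo_on f S" "cholo_on g S" "z \<in> S"
  shows "((\<lambda>z. f z * g z) has_derivative (\<lambda>h. \<Sum>j\<in>UNIV. (pd j f z * g z + f z * pd j g z) * h $ j)) (at z)"
  by (rule has_derivative_eq_rhs[OF has_derivative_mult[OF cholo_on_has_derivative cholo_on_has_derivative]])
    (use assms in \<open>auto simp: fun_eq_iff sum_distrib_left sum_distrib_right sum.distrib algebra_simps\<close>)

lemma has_derivative_divide_sum:
  assumes "cholo_on f S" "cholo_on g S" "z \<in> S" "g z \<noteq> 0"
  shows "((\<lambda>z. f z / g z) has_derivative (\<lambda>h. \<Sum>j\<in>UNIV. ((pd j f z * g z - f z * pd j g z) / (g z)\<^sup>2) * h $ j)) (at z)"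
proof (rule has_derivative_eq_rhs[OF has_derivative_divide'[OF cholo_on_has_derivative[OF assms(1,3)] cholo_on_has_derivative[OF assms(2,3)] assms(4)]])
  have "((\<Sum>j\<in>UNIV. pd j f z * h $ j) * g z - f z * (\<Sum>j\<in>UNIV. pd j g z * h $ j)) / (g z * g z) =
     (\<Sum>j\<in>UNIV. ((pd j f z * g z - f z * pd j g z) / (g z)\<^sup>2) * h $ j)" for h
    unfolding sum_distrib_left sum_distrib_right sum_subtractf[symmetric] sum_divide_distrib
    by (intro sum.cong refl) (simp add: field_simps power2_eq_square)
  then show "(\<lambda>h. ((\<Sum>j\<in>UNIV. pd j f z * h $ j) * g z - f z * (\<Sum>j\<in>UNIV. pd j g z * h $ j)) / (g z * g z)) =
     (\<lambda>h. \<Sum>j\<in>UNIV. ((pd j f z * g z - f z * pd j g z) / (g z)\<^sup>2) * h $ j)" by blast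
qed

lemma has_derivative_add_sum:
  assumes "cholo_on f S" "cholo_on g S" "z \<in> S"
  shows "((\<lambda>z. f z + g z) has_derivative (\<lambda>h. \<Sum>j\<in>UNIV. (pd j f z + pd j g z) * h $ j)) (at z)"
  by (rule has_derivative_eq_rhs[OF has_derivative_add[OF cholo_on_has_derivative cholo_on_has_derivative]])
    (use assms in \<open>auto simp: fun_eq_iff sum.distrib algebra_simps\<close>)

lemma has_derivative_compose_sum:
  fixes F :: "complex^'m::finite \<Rightarrow> complex^'k::finite"
  assumes F: "\<And>k. cholo_on (\<lambda>z. F z $ k) S" and g: "cholo_on g T" and z: "z \<in> S" "F z \<in> T"
  shows "((\<lambda>z. g (F z)) has_derivative (\<lambda>h. \<Sum>j\<in>UNIV. (\<Sum>k\<in>UNIV. pd k g (F z) * pd j (\<lambda>z. F z $ k) z) * h $ j)) (at z)"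
proof -
  have DF: "(F has_derivative (\<lambda>h. \<chi> k. \<Sum>j\<in>UNIV. pd j (\<lambda>z. F z $ k) z * h $ j)) (at z)"
    unfolding has_derivative_componentwise_within[of F] Basis_vec_def
  proof clarsimp
    fix k and u :: complex
    have "((\<lambda>x. F x $ k \<bullet> u) has_derivative (\<lambda>h. (\<Sum>j\<in>UNIV. pd j (\<lambda>z. F z $ k) z * h $ j) \<bullet> u)) (at z)"
      by (intro has_derivative_inner_left cholo_on_has_derivative[OF F z(1)])
    then show "((\<lambda>x. F x \<bullet> axis k u) has_derivative (\<lambda>x. (\<chi> k. \<Sum>j\<in>UNIV. pd j (\<lambda>z. F z $ k) z * x $ j) \<bullet> axis k u)) (at z)"
      by (simp add: inner_axis)
  qed
  have "((\<lambda>z. g (F z)) has_derivative (\<lambda>h. \<Sum>k\<in>UNIV. pd k g (F z) * (\<Sum>j\<in>UNIV. pd j (\<lambda>z. F z $ k) z * h $ j))) (at z)"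
    using has_derivative_compose[OF DF cholo_on_has_derivative[OF g z(2)]] by simp
  also have "(\<lambda>h. \<Sum>k\<in>UNIV. pd k g (F z) * (\<Sum>j\<in>UNIV. pd j (\<lambda>z. F z $ k) z * h $ j))
     = (\<lambda>h. \<Sum>j\<in>UNIV. (\<Sum>k\<in>UNIV. pd k g (F z) * pd j (\<lambda>z. F z $ k) z) * h $ j)"
    unfolding sum_distrib_left sum_distrib_right by (rule ext, subst sum.swap) (simp add: mult.assoc)
  finally show ?thesis .
qed

lemma cholo_on_add: "cholo_on f S \<Longrightarrow> cholo_on g S \<Longrightarrow> cholo_on (\<lambda>z. f z + g z) S"
  by (rule cholo_onI[OF cholo_on_open has_derivative_add_sum])

lemma cholo_on_mult: "cholo_on f S \<Longrightarrow> cholo_on g S \<Longrightarrow> cholo_on (\<lambda>z. f z * g z) S"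
  by (rule cholo_onI[OF cholo_on_open has_derivative_mult_sum])

lemma cholo_on_divide:
  "cholo_on f S \<Longrightarrow> cholo_on g S \<Longrightarrow> (\<And>z. z \<in> S \<Longrightarrow> g z \<noteq> 0) \<Longrightarrow> cholo_on (\<lambda>z. f z / g z) S"
  by (rule cholo_onI[OF cholo_on_open has_derivative_divide_sum])

lemma cholo_on_power: "cholo_on f S \<Longrightarrow> cholo_on (\<lambda>z. f z ^ m) S"
  by (induction m) (auto intro: cholo_on_mult cholo_on_const cholo_on_open)

lemma cholo_on_sum: "open S \<Longrightarrow> (\<And>i. i \<in> I \<Longrightarrow> cholo_on (f i) S) \<Longrightarrow> cholo_on (\<lambda>z. \<Sum>i\<in>I. f i z) S"
  by (induction I rule: infinite_finite_induct) (auto intro: cholo_on_add cholo_on_const)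

lemma cholo_on_compose:
  assumes "\<And>k. cholo_on (\<lambda>z. F z $ k) S" "cholo_on g T" "\<And>z. z \<in> S \<Longrightarrow> F z \<in> T"
  shows "cholo_on (\<lambda>z. g (F z)) S"
  by (rule cholo_onI[OF cholo_on_open has_derivative_compose_sum]) (use assms in auto)

lemmas pd_const = pd_eqI[OF has_derivative_const_sum]
lemmas pd_component = pd_eqI[OF has_derivative_component_sum]
lemmas pd_add = pd_eqI[OF has_derivative_add_sum]
lemmas pd_mult = pd_eqI[OF has_derivative_mult_sum]
lemmas pd_compose = pd_eqI[OF has_derivative_compose_sum]

lemma pd_sum:
  assumes "\<And>i. cholo_on (f i) S" "z \<in> S"
  shows "pd j (\<lambda>z. \<Sum>i\<in>I. f i z) z = (\<Sum>i\<in>I. pd j (f i) z)"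
proof (induction I rule: infinite_finite_induct)
  case (insert x I)
  have "cholo_on (\<lambda>z. \<Sum>i\<in>I. f i z) S" by (rule cholo_on_sum[OF cholo_on_open[OF assms(1)] assms(1)])
  then show ?case using insert pd_add[OF assms(1) _ assms(2)] by simp
qed (simp_all add: pd_const)

lemma cholo_on_line:
  fixes z :: "complex^'m::finite"
  assumes "cholo_on f S" "z + \<zeta> *s v \<in> S"
  shows "((\<lambda>\<zeta>. f (z + \<zeta> *s v)) has_field_derivative (\<Sum>j\<in>UNIV. pd j f (z + \<zeta> *s v) * v $ j)) (at \<zeta>)"
proof -
  have "((\<lambda>\<zeta>. z + \<zeta> *s v) has_derivative (\<lambda>h. h *s v)) (at \<zeta>)"
  proof -
    have "bounded_linear (\<lambda>h::complex. h *s v)"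
      by (intro linear_conv_bounded_linear[THEN iffD1] linearI) (auto simp: vec_eq_iff algebra_simps)
    then have "((\<lambda>\<zeta>. \<zeta> *s v) has_derivative (\<lambda>h. h *s v)) (at \<zeta>)" by (rule bounded_linear_imp_has_derivative)
    then show ?thesis by (auto intro!: derivative_eq_intros)
  qed
  from has_derivative_compose[OF this cholo_on_has_derivative[OF assms]]
  show ?thesis unfolding has_field_derivative_def
    by (rule has_derivative_eq_rhs) (auto simp: fun_eq_iff sum_distrib_left sum_distrib_right mult_ac)
qed

text \<open>Cauchy's formula for the first derivative on the complex line through \<open>z\<close> in the direction \<open>e\<^sub>j\<close>.\<close>

lemma pd_eq_circle_integral:
  fixes z :: "complex^'m::finite"
  assumes f: "cholo_on f S" and r: "0 < r" and sub: "\<And>\<zeta>. cmod \<zeta> \<le> r \<Longrightarrow> z + \<zeta> *s axis j 1 \<in> S"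
  shows "pd j f z = integral (cbox 0 1) (\<lambda>t. f (z + (of_real r * exp (2 * of_real pi * \<i> * of_real t)) *s axis j 1)
           * (1 / (of_real r * exp (2 * of_real pi * \<i> * of_real t))))"
proof -
  let ?g = "\<lambda>\<zeta>. f (z + \<zeta> *s axis j 1)"
  have D: "(?g has_field_derivative (\<Sum>k\<in>UNIV. pd k f (z + \<zeta> *s axis j 1) * axis j 1 $ k)) (at \<zeta>)"
    if "cmod \<zeta> \<le> r" for \<zeta>
    using cholo_on_line[OF f sub[OF that]] .
  have "deriv ?g 0 = (\<Sum>k\<in>UNIV. pd k f z * axis j 1 $ k)"
    using DERIV_imp_deriv[OF D[of 0]] r by simp
  also have "\<dots> = pd j f z" by (simp add: axis_def if_distrib[of "\<lambda>x. _ * x"] cong: if_cong)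
  finally have d: "deriv ?g 0 = pd j f z" .
  have "((\<lambda>u. ?g u / (u - 0) ^ Suc 1) has_contour_integral ((2 * pi * \<i>) / fact 1 * (deriv ^^ 1) ?g 0)) (circlepath 0 r)"
  proof (rule Cauchy_has_contour_integral_higher_derivative_circlepath)
    show "continuous_on (cball 0 r) ?g"
      by (intro continuous_at_imp_continuous_on ballI DERIV_isCont[OF D]) auto
    show "?g holomorphic_on ball 0 r"
      unfolding holomorphic_on_def field_differentiable_def
    proof
      fix \<zeta> :: complex assume "\<zeta> \<in> ball 0 r"
      then show "\<exists>f'. (?g has_field_derivative f') (at \<zeta> within ball 0 r)"
        using has_field_derivative_at_within[OF D, of \<zeta> "ball 0 r"] by auto
    qed
  qed (use r in auto)
  then have "((\<lambda>t. ?g (circlepath 0 r t) / (circlepath 0 r t)\<^sup>2 * (2 * of_real pi * \<i> * of_real r * exp (2 * of_real pi * \<i> * of_real t)))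
     has_integral ((2 * pi * \<i>) / fact 1 * (deriv ^^ 1) ?g 0)) {0..1}"
    unfolding has_contour_integral_def
    by (rule has_integral_eq[rotated]) (auto simp: vector_derivative_circlepath01 power2_eq_square)
  then have "((\<lambda>t. ?g (circlepath 0 r t) / (circlepath 0 r t)\<^sup>2 * (2 * of_real pi * \<i> * of_real r * exp (2 * of_real pi * \<i> * of_real t)))
     has_integral (2 * of_real pi * \<i> * pd j f z)) (cbox 0 1)"
    by (simp add: d)
  then have "((\<lambda>t. ?g (circlepath 0 r t) / (circlepath 0 r t)\<^sup>2 * (2 * of_real pi * \<i> * of_real r * exp (2 * of_real pi * \<i> * of_real t)) * (1 / (2 * of_real pi * \<i>)))
     has_integral (2 * of_real pi * \<i> * pd j f z) * (1 / (2 * of_real pi * \<i>))) (cbox 0 1)"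
    by (rule has_integral_mult_left)
  then show ?thesis
    using r by (intro integral_unique[symmetric]) (simp add: circlepath_def part_circlepath_def linepath_def field_simps power2_eq_square scaleR_conv_of_real exp_of_real)
qed

definition circ :: "real \<Rightarrow> real \<Rightarrow> complex" where
  "circ r t = of_real r * exp (2 * of_real pi * \<i> * of_real t)"

lemma continuous_on_circ: "continuous_on A (circ r)"
  unfolding circ_def by (intro continuous_intros)

text \<open>One radius serves for all points near \<open>z0\<close> and for all directions.  The last clause is the joint continuity
  needed to treat the formula as a parameter integral.\<close>

lemma pd_circle_integral_near:
  fixes f :: "complex^'m::finite \<Rightarrow> complex"
  assumes f: "cholo_on f S" and "z0 \<in> S"
  shows "\<exists>r>0. (\<forall>z\<in>ball z0 r. \<forall>t k. z + circ r t *s axis k 1 \<in> S) \<and>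
    (\<forall>z\<in>ball z0 r. \<forall>k. pd k f z = integral (cbox 0 1) (\<lambda>t. f (z + circ r t *s axis k 1) * (1 / circ r t))) \<and>
    (\<forall>g k. continuous_on S g \<longrightarrow>
       continuous_on (ball z0 r \<times> cbox 0 1) (\<lambda>(z, t). g (z + circ r t *s axis k 1) * (1 / circ r t)))"
proof -
  obtain e where e: "e > 0" "cball z0 e \<subseteq> S" using assms cholo_on_open[OF f] open_contains_cball by blast
  define r where "r = e / 2"
  have r: "0 < r" using e by (simp add: r_def)
  have c0: "circ r t \<noteq> 0" and cn: "cmod (circ r t) = r" for t using r by (auto simp: circ_def norm_mult)
  let ?U = "ball z0 r"
  have sub: "z + \<zeta> *s axis k 1 \<in> S" if "z \<in> ?U" "cmod \<zeta> \<le> r" for z \<zeta> k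
  proof -
    have "\<zeta> *s axis k 1 = (axis k \<zeta> :: complex^'m)" by (simp add: vec_eq_iff axis_def)
    then have "norm (\<zeta> *s axis k 1 :: complex^'m) = cmod \<zeta>"
      by (simp add: norm_eq_sqrt_inner inner_axis_axis)
    moreover have "dist z0 (z + \<zeta> *s axis k 1) \<le> dist z0 z + norm (\<zeta> *s axis k 1)"
      by (metis add.commute add_diff_cancel_left' dist_norm dist_triangle norm_minus_commute)
    ultimately show ?thesis using that e by (auto simp: r_def)
  qed
  show ?thesis
  proof (intro exI[of _ r] conjI r ballI allI impI)
    show "z + circ r t *s axis k 1 \<in> S" if "z \<in> ?U" for z t k using sub[OF that] cn by simp
    show "pd k f z = integral (cbox 0 1) (\<lambda>t. f (z + circ r t *s axis k 1) * (1 / circ r t))" if "z \<in> ?U" for k z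
      unfolding circ_def by (rule pd_eq_circle_integral[OF f r]) (rule sub[OF that])
    fix g :: "complex^'m \<Rightarrow> complex" and k assume g: "continuous_on S g"
    have "continuous_on (?U \<times> cbox 0 1) (\<lambda>p. fst p + circ r (snd p) *s axis k 1)"
      by (intro continuous_intros continuous_on_vec_lambda continuous_on_compose2[OF continuous_on_circ[of UNIV]]
        | simp add: vector_scalar_mult_def)+
    then have "continuous_on (?U \<times> cbox 0 1) (\<lambda>p. g (fst p + circ r (snd p) *s axis k 1))"
      by (rule continuous_on_compose2[OF g]) (use sub cn in auto)
    then show "continuous_on (?U \<times> cbox 0 1) (\<lambda>(z, t). g (z + circ r t *s axis k 1) * (1 / circ r t))"
      unfolding case_prod_unfold
      by (intro continuous_intros continuous_on_compose2[OF continuous_on_circ[of UNIV]]) (auto simp: c0)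
  qed
qed

lemma continuous_on_pd:
  assumes f: "cholo_on f S"
  shows "continuous_on S (pd k f)"
proof (rule continuous_at_imp_continuous_on[OF ballI])
  fix z0 assume z0: "z0 \<in> S"
  obtain r where r: "0 < r"
    and sub: "\<forall>z\<in>ball z0 r. \<forall>t k. z + circ r t *s axis k 1 \<in> S"
    and int: "\<forall>z\<in>ball z0 r. \<forall>k. pd k f z = integral (cbox 0 1) (\<lambda>t. f (z + circ r t *s axis k 1) * (1 / circ r t))"
    and shift: "\<forall>g k. continuous_on S g \<longrightarrow>
       continuous_on (ball z0 r \<times> cbox 0 1) (\<lambda>(z, t). g (z + circ r t *s axis k 1) * (1 / circ r t))"
    using pd_circle_integral_near[OF f z0] by blast
  note sub = sub[rule_format] and int = int[rule_format] and shift = shift[rule_format]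
  have "continuous_on (ball z0 r) (\<lambda>z. integral (cbox 0 1) (\<lambda>t. f (z + circ r t *s axis k 1) * (1 / circ r t)))"
    by (rule integral_continuous_on_param[OF shift[OF cholo_on_continuous[OF f]]])
  then have "continuous_on (ball z0 r) (pd k f)"
    by (rule continuous_on_eq) (simp add: int)
  then show "isCont (pd k f) z0" using r by (simp add: continuous_on_eq_continuous_at)
qed

lemma continuous_on_slice:
  assumes "continuous_on (U \<times> A) (\<lambda>(x, t). h x t)" "x \<in> U"
  shows "continuous_on A (h x)"
proof -
  have "continuous_on A (\<lambda>t. (\<lambda>(x, t). h x t) (x, t))"
    by (rule continuous_on_compose2[OF assms(1)]) (use assms(2) in \<open>auto intro!: continuous_intros\<close>)
  then show ?thesis by simp
qed

text \<open>The partial derivatives are continuous, being parameter integrals of \<open>f\<close>.  Therefore the same integrals may be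
  differentiated under the integral sign, and the derivative of the integrand is complex linear.\<close>

lemma cholo_on_pd:
  fixes f :: "complex^'m::finite \<Rightarrow> complex"
  assumes f: "cholo_on f S"
  shows "cholo_on (pd j f) S"
proof (rule cholo_on_locally[OF cholo_on_open[OF f]])
  fix z0 assume z0: "z0 \<in> S"
  obtain r where r: "0 < r"
    and sub: "\<forall>z\<in>ball z0 r. \<forall>t k. z + circ r t *s axis k 1 \<in> S"
    and int: "\<forall>z\<in>ball z0 r. \<forall>k. pd k f z = integral (cbox 0 1) (\<lambda>t. f (z + circ r t *s axis k 1) * (1 / circ r t))"
    and shift: "\<forall>g k. continuous_on S g \<longrightarrow>
       continuous_on (ball z0 r \<times> cbox 0 1) (\<lambda>(z, t). g (z + circ r t *s axis k 1) * (1 / circ r t))"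
    using pd_circle_integral_near[OF f z0] by blast
  note sub = sub[rule_format] and int = int[rule_format] and shift = shift[rule_format]
  define c where "c = circ r"
  note sub = sub[folded c_def] and int = int[folded c_def] and shift = shift[folded c_def]
  let ?U = "ball z0 r"
  define B where "B = (\<lambda>k. Blinfun (\<lambda>h::complex^'m. h $ k))"
  have B: "blinfun_apply (B k) h = h $ k" for k h
    unfolding B_def by (simp add: bounded_linear_Blinfun_apply bounded_linear_vec_nth)
  define a where "a = (\<lambda>z t k. pd k f (z + c t *s axis j 1) * (1 / c t))"
  define fx where "fx = (\<lambda>z t. \<Sum>k\<in>UNIV. blinfun_mult_right (a z t k) o\<^sub>L B k)"
  have fx: "blinfun_apply (fx z t) h = (\<Sum>k\<in>UNIV. a z t k * h $ k)" for z t h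
    by (simp add: fx_def blinfun.sum_left B)
  have a_cont: "continuous_on (?U \<times> cbox 0 1) (\<lambda>(z, t). a z t k)" for k
    unfolding a_def by (rule shift[OF continuous_on_pd[OF f]])
  have L: "((\<lambda>z. integral (cbox 0 1) (\<lambda>t. f (z + c t *s axis j 1) * (1 / c t))) has_derivative
      blinfun_apply (integral (cbox 0 1) (fx z))) (at z within ?U)" if z: "z \<in> ?U" for z
  proof (rule leibniz_rule)
    fix x t assume x: "x \<in> ?U" and "t \<in> cbox (0::real) 1"
    have "x + c t *s axis j 1 \<in> S" using sub[OF x] .
    from cholo_on_has_derivative[OF f this]
    have "((\<lambda>x. f (x + c t *s axis j 1)) has_derivative (\<lambda>h. \<Sum>k\<in>UNIV. pd k f (x + c t *s axis j 1) * h $ k)) (at x)"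
      by (rule has_derivative_compose[rotated]) (auto intro!: derivative_eq_intros)
    then have 1: "((\<lambda>x. f (x + c t *s axis j 1) * (1 / c t)) has_derivative (\<lambda>h. (\<Sum>k\<in>UNIV. pd k f (x + c t *s axis j 1) * h $ k) * (1 / c t))) (at x)"
      by (rule has_derivative_mult_left)
    have 2: "(\<lambda>h. (\<Sum>k\<in>UNIV. pd k f (x + c t *s axis j 1) * h $ k) * (1 / c t)) = blinfun_apply (fx x t)"
      by (auto simp: fun_eq_iff fx a_def sum_distrib_left sum_distrib_right mult_ac)
    show "((\<lambda>x. f (x + c t *s axis j 1) * (1 / c t)) has_derivative blinfun_apply (fx x t)) (at x within ?U)"
      by (rule has_derivative_at_withinI[OF 1[unfolded 2]])
  next
    fix x assume x: "x \<in> ?U"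
    have "continuous_on (cbox 0 1) (\<lambda>t. f (x + c t *s axis j 1) * (1 / c t))"
      by (rule continuous_on_slice[OF shift[OF cholo_on_continuous[OF f]] x])
    then show "(\<lambda>t. f (x + c t *s axis j 1) * (1 / c t)) integrable_on cbox 0 1" by (rule integrable_continuous)
  next
    show "continuous_on (?U \<times> cbox 0 1) (\<lambda>(x, t). fx x t)"
      unfolding fx_def case_prod_unfold
      using a_cont by (intro continuous_intros) (auto simp: case_prod_unfold)
  qed (use z in auto)
  have D: "(pd j f has_derivative blinfun_apply (integral (cbox 0 1) (fx z))) (at z)" if "z \<in> ?U" for z
  proof -
    have "((\<lambda>z. integral (cbox 0 1) (\<lambda>t. f (z + c t *s axis j 1) * (1 / c t))) has_derivative
      blinfun_apply (integral (cbox 0 1) (fx z))) (at z)"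
      using L[OF that] unfolding at_within_open[OF that open_ball] .
    then show ?thesis
      by (rule has_derivative_cong_open[OF _ open_ball that]) (rule int[symmetric])
  qed
  have "blinfun_apply (integral (cbox 0 1) (fx z)) = (\<lambda>h. \<Sum>k\<in>UNIV. integral (cbox 0 1) (\<lambda>t. a z t k) * h $ k)"
    if z: "z \<in> ?U" for z
  proof
    fix h
    have ca: "continuous_on (cbox 0 1) (\<lambda>t. a z t k)" for k
      by (rule continuous_on_slice[OF a_cont z])
    have ia: "(\<lambda>t. a z t k) integrable_on cbox 0 1" for k by (rule integrable_continuous[OF ca])
    have ifx: "fx z integrable_on cbox 0 1"
      unfolding fx_def by (intro integrable_continuous continuous_intros ca)
    have "blinfun_apply (integral (cbox 0 1) (fx z)) h = integral (cbox 0 1) (\<lambda>t. blinfun_apply (fx z t) h)"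
      using integral_linear[OF ifx bounded_linear_apply_blinfun[of h]] by (simp add: o_def)
    also have "\<dots> = (\<Sum>k\<in>UNIV. integral (cbox 0 1) (\<lambda>t. a z t k * h $ k))"
      unfolding fx by (intro integral_sum integrable_on_mult_left ia) auto
    also have "\<dots> = (\<Sum>k\<in>UNIV. integral (cbox 0 1) (\<lambda>t. a z t k) * h $ k)" by simp
    finally show "blinfun_apply (integral (cbox 0 1) (fx z)) h = (\<Sum>k\<in>UNIV. integral (cbox 0 1) (\<lambda>t. a z t k) * h $ k)" .
  qed
  then have "cholo_on (pd j f) ?U" using D by (intro cholo_onI) auto
  then show "\<exists>T. z0 \<in> T \<and> cholo_on (pd j f) T" using r by (intro exI[of _ ?U]) auto
qed

section \<open>Charts and holomorphic functions on a manifold\<close>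

lemma chart_facts:
  assumes "complex_manifold A" "(U, \<phi>) \<in> A"
  shows "open U" "open (\<phi> ` U)" "inj_on \<phi> U" "continuous_on U \<phi>" "continuous_on (\<phi> ` U) (inv_into U \<phi>)"
    "\<And>x. x \<in> U \<Longrightarrow> inv_into U \<phi> (\<phi> x) = x"
proof -
  have *: "open U" "open (\<phi> ` U)" "homeomorphism U (\<phi> ` U) \<phi> (inv_into U \<phi>)"
    using assms unfolding complex_manifold_def by fast+
  show "open U" "open (\<phi> ` U)" by fact+
  show "continuous_on U \<phi>" using *(3) by (rule homeomorphism_cont1)
  show "continuous_on (\<phi> ` U) (inv_into U \<phi>)" using *(3) by (rule homeomorphism_cont2)
  show inv: "\<And>x. x \<in> U \<Longrightarrow> inv_into U \<phi> (\<phi> x) = x" using *(3) by (rule homeomorphism_apply1)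
  show "inj_on \<phi> U" using inv by (metis inj_onI)
qed

lemma chart_at:
  assumes "complex_manifold A"
  obtains U \<phi> where "(U, \<phi>) \<in> A" "x \<in> U"
proof -
  have "x \<in> (\<Union>c\<in>A. fst c)" using assms by (simp add: complex_manifold_def)
  then obtain c where "c \<in> A" "x \<in> fst c" by blast
  then show ?thesis using that[of "fst c" "snd c"] by simp
qed

lemma open_chart_image:
  assumes "complex_manifold A" "(U, \<phi>) \<in> A" "open W"
  shows "open (\<phi> ` (U \<inter> W))"
proof -
  note c = chart_facts[OF assms(1,2)]
  have "\<phi> ` (U \<inter> W) = inv_into U \<phi> -` W \<inter> \<phi> ` U" using c(6) by auto
  then show ?thesis using continuous_open_preimage[OF c(5,2) assms(3)] by (simp add: Int_commute)
qed

lemma transition_holo: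
  assumes "complex_manifold A" "(U, \<phi>) \<in> A" "(V, \<psi>) \<in> A"
  shows "cholo_on (\<lambda>z. \<psi> (inv_into U \<phi> z) $ j) (\<phi> ` (U \<inter> V))"
  using assms unfolding complex_manifold_def by fast

lemma holo_onD: "holo_on A f W \<Longrightarrow> (U, \<phi>) \<in> A \<Longrightarrow> cholo_on (\<lambda>z. f (inv_into U \<phi> z)) (\<phi> ` (U \<inter> W))"
  unfolding holo_on_def by fast

lemma holo_onI:
  "open W \<Longrightarrow> (\<And>U \<phi>. (U, \<phi>) \<in> A \<Longrightarrow> cholo_on (\<lambda>z. f (inv_into U \<phi> z)) (\<phi> ` (U \<inter> W))) \<Longrightarrow> holo_on A f W"
  unfolding holo_on_def by fast

lemma holo_on_open: "holo_on A f W \<Longrightarrow> open W"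
  by (simp add: holo_on_def)

lemma holo_on_continuous:
  assumes A: "complex_manifold A" and f: "holo_on A f W"
  shows "continuous_on W f"
proof (rule continuous_at_imp_continuous_on[OF ballI])
  fix x assume x: "x \<in> W"
  obtain U \<phi> where U: "(U, \<phi>) \<in> A" "x \<in> U" by (rule chart_at[OF A])
  note c = chart_facts[OF A U(1)]
  have "continuous_on (U \<inter> W) (\<lambda>x. f (inv_into U \<phi> (\<phi> x)))"
    by (rule continuous_on_compose2[OF cholo_on_continuous[OF holo_onD[OF f U(1)]]])
      (auto intro: continuous_on_subset[OF c(4)])
  then have "continuous_on (U \<inter> W) f" by (rule continuous_on_eq) (use c(6) in auto)
  moreover have "open (U \<inter> W)" using c(1) holo_on_open[OF f] by blast
  ultimately show "isCont f x" using x U(2) by (simp add: continuous_on_eq_continuous_at)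
qed

lemma holo_on_subset:
  assumes "complex_manifold A" "holo_on A f W" "open W'" "W' \<subseteq> W"
  shows "holo_on A f W'"
proof (rule holo_onI[OF assms(3)])
  fix U \<phi> assume U: "(U, \<phi>) \<in> A"
  show "cholo_on (\<lambda>z. f (inv_into U \<phi> z)) (\<phi> ` (U \<inter> W'))"
    by (rule cholo_on_subset[OF holo_onD[OF assms(2) U] open_chart_image[OF assms(1) U assms(3)]])
      (use assms(4) in auto)
qed

lemma holo_on_cong:
  assumes A: "complex_manifold A" and f: "holo_on A f W" and eq: "\<And>x. x \<in> W \<Longrightarrow> f x = g x"
  shows "holo_on A g W"
proof (rule holo_onI[OF holo_on_open[OF f]])
  fix U \<phi> assume U: "(U, \<phi>) \<in> A"
  note c = chart_facts[OF A U]
  show "cholo_on (\<lambda>z. g (inv_into U \<phi> z)) (\<phi> ` (U \<inter> W))"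
    by (rule cholo_on_cong[OF holo_onD[OF f U]]) (use c(6) eq in auto)
qed

lemma holo_on_locally:
  assumes A: "complex_manifold A" and W: "open W" and loc: "\<And>x. x \<in> W \<Longrightarrow> \<exists>W'. x \<in> W' \<and> holo_on A f W'"
  shows "holo_on A f W"
proof (rule holo_onI[OF W])
  fix U \<phi> assume U: "(U, \<phi>) \<in> A"
  show "cholo_on (\<lambda>z. f (inv_into U \<phi> z)) (\<phi> ` (U \<inter> W))"
  proof (rule cholo_on_locally[OF open_chart_image[OF A U W]])
    fix z assume "z \<in> \<phi> ` (U \<inter> W)"
    then obtain x where x: "x \<in> U" "x \<in> W" "z = \<phi> x" by auto
    obtain W' where "x \<in> W'" "holo_on A f W'" using loc[OF x(2)] by blast
    then show "\<exists>T. z \<in> T \<and> cholo_on (\<lambda>z. f (inv_into U \<phi> z)) T"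
      using holo_onD[OF _ U] x by (intro exI[of _ "\<phi> ` (U \<inter> W')"]) auto
  qed
qed

lemma holo_on_const: "complex_manifold A \<Longrightarrow> open W \<Longrightarrow> holo_on A (\<lambda>_. c) W"
  by (intro holo_onI cholo_on_const open_chart_image)

lemma holo_on_mult: "holo_on A f W \<Longrightarrow> holo_on A g W \<Longrightarrow> holo_on A (\<lambda>x. f x * g x) W"
  by (rule holo_onI[OF holo_on_open], assumption) (intro cholo_on_mult holo_onD)

lemma holo_on_add: "holo_on A f W \<Longrightarrow> holo_on A g W \<Longrightarrow> holo_on A (\<lambda>x. f x + g x) W"
  by (rule holo_onI[OF holo_on_open], assumption) (intro cholo_on_add holo_onD)

lemma holo_on_power: "holo_on A f W \<Longrightarrow> holo_on A (\<lambda>x. f x ^ m) W"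
  by (rule holo_onI[OF holo_on_open], assumption) (intro cholo_on_power holo_onD)

lemma holo_on_divide:
  assumes A: "complex_manifold A" and "holo_on A f W" "holo_on A g W" "\<And>x. x \<in> W \<Longrightarrow> g x \<noteq> 0"
  shows "holo_on A (\<lambda>x. f x / g x) W"
proof (rule holo_onI[OF holo_on_open[OF assms(2)]])
  fix U \<phi> assume U: "(U, \<phi>) \<in> A"
  show "cholo_on (\<lambda>z. f (inv_into U \<phi> z) / g (inv_into U \<phi> z)) (\<phi> ` (U \<inter> W))"
    by (rule cholo_on_divide) (use assms U holo_onD chart_facts(6)[OF A U] in auto)
qed

lemma holo_on_sum:
  assumes A: "complex_manifold A" and "open W" "\<And>i. i \<in> I \<Longrightarrow> holo_on A (f i) W"
  shows "holo_on A (\<lambda>x. \<Sum>i\<in>I. f i x) W"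
  using assms(3) by (induction I rule: infinite_finite_induct) (auto intro: holo_on_add holo_on_const[OF A assms(2)])

section \<open>Polarization\<close>

definition join :: "complex^'n::finite \<Rightarrow> complex^'m::finite \<Rightarrow> complex^('n + 'm)" where
  "join u v = (\<chi> k. case k of Inl a \<Rightarrow> u $ a | Inr b \<Rightarrow> v $ b)"

definition left :: "complex^('n::finite + 'm::finite) \<Rightarrow> complex^'n" where
  "left Z = (\<chi> a. Z $ Inl a)"

definition right :: "complex^('n::finite + 'm::finite) \<Rightarrow> complex^'m" where
  "right Z = (\<chi> b. Z $ Inr b)"

definition vcnj :: "complex^'n::finite \<Rightarrow> complex^'n" where
  "vcnj v = (\<chi> j. cnj (v $ j))"

text \<open>The totally real subspace \<open>w = cnj z\<close>, where a polarized function has the values of the function it came from.\<close>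

definition diag :: "complex^'n::finite \<Rightarrow> complex^('n + 'n)" where
  "diag z = join z (vcnj z)"

lemma join_simps [simp]:
  "join u v $ Inl a = u $ a" "join u v $ Inr b = v $ b" "left (join u v) = u" "right (join u v) = v"
  "join (left Z) (right Z) = Z" "left Z $ a = Z $ Inl a" "right Z $ b = Z $ Inr b"
  "vcnj w $ j = cnj (w $ j)" "vcnj (vcnj w) = w" "left (diag z) = z" "right (diag z) = vcnj z"
  by (auto simp: join_def left_def right_def vcnj_def diag_def vec_eq_iff split: sum.split)

lemma diag_simps [simp]: "diag z $ Inl a = z $ a" "diag z $ Inr b = cnj (z $ b)"
  by (auto simp: diag_def)

lemma continuous_on_vcnj: "continuous_on S vcnj"
  unfolding vcnj_def by (intro continuous_intros)

lemma continuous_on_left: "continuous_on S left" and continuous_on_right: "continuous_on S right"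
  for S :: "(complex^('n::finite + 'm::finite)) set"
  unfolding left_def right_def by (intro continuous_intros)+

lemma continuous_on_diag: "continuous_on S diag"
  unfolding diag_def join_def
proof (rule continuous_on_vec_lambda)
  fix i :: "'a + 'a"
  show "continuous_on S (\<lambda>x. case i of Inl a \<Rightarrow> x $ a | Inr b \<Rightarrow> vcnj x $ b)"
    by (cases i) (auto intro!: continuous_intros)
qed

lemma sum_UNIV_Plus: "(\<Sum>k\<in>UNIV. f k) = (\<Sum>a\<in>UNIV. f (Inl a)) + (\<Sum>b\<in>UNIV. f (Inr b))"
  for f :: "'n::finite + 'm::finite \<Rightarrow> 'c::comm_monoid_add"
  by (simp add: UNIV_Plus_UNIV[symmetric] sum.Plus del: UNIV_Plus_UNIV)

text \<open>Where both slots of a polarized function are defined; the second variable runs over the conjugate of \<open>T\<close>.\<close>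

definition bidomain :: "(complex^'n::finite) set \<Rightarrow> (complex^'m::finite) set \<Rightarrow> (complex^('n + 'm)) set" where
  "bidomain S T = {Z. left Z \<in> S \<and> vcnj (right Z) \<in> T}"

lemma open_bidomain:
  fixes S :: "(complex^'n::finite) set" and T :: "(complex^'m::finite) set"
  assumes "open S" "open T"
  shows "open (bidomain S T)"
proof -
  have "open (left -` S :: (complex^('n + 'm)) set)"
    by (rule open_vimage[OF assms(1) continuous_on_left])
  moreover have "open ((\<lambda>Z::complex^('n + 'm). vcnj (right Z)) -` T)"
    by (rule open_vimage[OF assms(2)])
      (rule continuous_on_compose2[OF continuous_on_vcnj[of UNIV] continuous_on_right], simp)
  moreover have "bidomain S T = left -` S \<inter> (\<lambda>Z. vcnj (right Z)) -` T" by (auto simp: bidomain_def)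
  ultimately show ?thesis by auto
qed

lemma diag_bidomain: "diag z \<in> bidomain S T \<longleftrightarrow> z \<in> S \<and> z \<in> T"
  by (simp add: bidomain_def)

definition prod_chart :: "('x \<Rightarrow> complex^'n::finite) \<Rightarrow> ('x \<Rightarrow> complex^'n) \<Rightarrow> 'x \<times> 'x \<Rightarrow> complex^('n + 'n)" where
  "prod_chart \<phi> \<psi> = (\<lambda>(x, y). join (\<phi> x) (vcnj (\<psi> y)))"

lemma prod_atlas_conj_iff:
  "c \<in> prod_atlas A (conj_atlas A) \<longleftrightarrow>
    (\<exists>U \<phi> V \<psi>. (U, \<phi>) \<in> A \<and> (V, \<psi>) \<in> A \<and> c = (U \<times> V, prod_chart \<phi> \<psi>))"
proof -
  have eq: "prod_chart \<phi> \<psi> = (\<lambda>(x, y). \<chi> k. case k of Inl i \<Rightarrow> \<phi> x $ i | Inr j \<Rightarrow> (\<chi> j. cnj (\<psi> y $ j)) $ j)"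
    for \<phi> \<psi> :: "'a \<Rightarrow> complex^'b"
    by (auto simp: prod_chart_def fun_eq_iff vec_eq_iff split: sum.split)
  show ?thesis
  proof
    assume "c \<in> prod_atlas A (conj_atlas A)"
    then obtain U \<phi> V \<psi> where "(U, \<phi>) \<in> A" "(V, \<psi>) \<in> A"
      "c = (U \<times> V, \<lambda>(x, y). \<chi> k. case k of Inl i \<Rightarrow> \<phi> x $ i | Inr j \<Rightarrow> (\<chi> j. cnj (\<psi> y $ j)) $ j)"
      unfolding prod_atlas_def conj_atlas_def by auto
    then show "\<exists>U \<phi> V \<psi>. (U, \<phi>) \<in> A \<and> (V, \<psi>) \<in> A \<and> c = (U \<times> V, prod_chart \<phi> \<psi>)"
      unfolding eq by blast
  next
    assume "\<exists>U \<phi> V \<psi>. (U, \<phi>) \<in> A \<and> (V, \<psi>) \<in> A \<and> c = (U \<times> V, prod_chart \<phi> \<psi>)"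
    then obtain U \<phi> V \<psi> where U: "(U, \<phi>) \<in> A" "(V, \<psi>) \<in> A" "c = (U \<times> V, prod_chart \<phi> \<psi>)" by blast
    have V: "(V, \<lambda>y. \<chi> j. cnj (\<psi> y $ j)) \<in> conj_atlas A"
      unfolding conj_atlas_def by (rule image_eqI[OF _ U(2)]) simp
    show "c \<in> prod_atlas A (conj_atlas A)"
      unfolding prod_atlas_def U(3) eq
      by (rule image_eqI[of _ _ "((U, \<phi>), (V, \<lambda>y. \<chi> j. cnj (\<psi> y $ j)))"]) (use U(1) V in auto)
  qed
qed

lemma prod_chart_image:
  "prod_chart \<phi> \<psi> ` (U \<times> V \<inter> W1 \<times> W2) = bidomain (\<phi> ` (U \<inter> W1)) (\<psi> ` (V \<inter> W2))"
proof (intro set_eqI iffI)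
  fix Z assume "Z \<in> bidomain (\<phi> ` (U \<inter> W1)) (\<psi> ` (V \<inter> W2))"
  then obtain x y where xy: "x \<in> U \<inter> W1" "left Z = \<phi> x" "y \<in> V \<inter> W2" "vcnj (right Z) = \<psi> y"
    by (auto simp: bidomain_def)
  then have "right Z = vcnj (\<psi> y)" by (metis join_simps(9))
  then have "Z = prod_chart \<phi> \<psi> (x, y)" using xy by (metis (no_types, lifting) prod_chart_def case_prod_conv join_simps(5))
  then show "Z \<in> prod_chart \<phi> \<psi> ` (U \<times> V \<inter> W1 \<times> W2)" using xy by auto
qed (auto simp: bidomain_def prod_chart_def)

text \<open>The charts of the conjugate manifold conjugate the coordinates.  Hence a holomorphic function on the
  product of \<open>X\<close> with its conjugate, read in charts, is holomorphic in \<open>(z, w)\<close>, where \<open>w\<close> is the conjugate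
  of the coordinate of the second point.\<close>

lemma holo_on_prod_polarized:
  fixes A :: "('x::{t2_space,second_countable_topology}, 'n::finite) chart set"
  assumes A: "complex_manifold A" and U: "(U, \<phi>) \<in> A" and V: "(V, \<psi>) \<in> A"
    and g: "holo_on (prod_atlas A (conj_atlas A)) g (W1 \<times> W2)"
  shows "cholo_on (\<lambda>Z. g (inv_into U \<phi> (left Z), inv_into V \<psi> (vcnj (right Z))))
           (bidomain (\<phi> ` (U \<inter> W1)) (\<psi> ` (V \<inter> W2)))"
proof -
  define \<Phi> where "\<Phi> = prod_chart \<phi> \<psi>"
  note c = chart_facts[OF A U] and d = chart_facts[OF A V]
  have "(U \<times> V, \<Phi>) \<in> prod_atlas A (conj_atlas A)"
    using U V unfolding prod_atlas_conj_iff \<Phi>_def by blast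
  from holo_onD[OF g this]
  have h: "cholo_on (\<lambda>Z. g (inv_into (U \<times> V) \<Phi> Z)) (\<Phi> ` (U \<times> V \<inter> W1 \<times> W2))" .
  have inj: "inj_on \<Phi> (U \<times> V)"
  proof (rule inj_onI)
    fix p q assume pq: "p \<in> U \<times> V" "q \<in> U \<times> V" "\<Phi> p = \<Phi> q"
    have "left (\<Phi> p) = left (\<Phi> q)" "vcnj (right (\<Phi> p)) = vcnj (right (\<Phi> q))" using pq by auto
    then have "\<phi> (fst p) = \<phi> (fst q)" "\<psi> (snd p) = \<psi> (snd q)" by (auto simp: \<Phi>_def prod_chart_def case_prod_unfold)
    then show "p = q" using pq c(3) d(3) by (auto simp: inj_on_def prod_eq_iff mem_Times_iff)
  qed
  have img: "\<Phi> ` (U \<times> V \<inter> W1 \<times> W2) = bidomain (\<phi> ` (U \<inter> W1)) (\<psi> ` (V \<inter> W2))"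
    unfolding \<Phi>_def by (rule prod_chart_image)
  have "inv_into (U \<times> V) \<Phi> Z = (inv_into U \<phi> (left Z), inv_into V \<psi> (vcnj (right Z)))"
    if Z: "Z \<in> \<Phi> ` (U \<times> V \<inter> W1 \<times> W2)" for Z
  proof -
    obtain x y where xy: "x \<in> U" "y \<in> V" "Z = \<Phi> (x, y)" using Z by auto
    then have "inv_into (U \<times> V) \<Phi> Z = (x, y)" using inv_into_f_f[OF inj] by simp
    moreover have "left Z = \<phi> x" "vcnj (right Z) = \<psi> y" using xy by (auto simp: \<Phi>_def prod_chart_def)
    ultimately show ?thesis using c(6) d(6) xy by simp
  qed
  then show ?thesis unfolding img[symmetric] by (intro cholo_on_cong[OF h]) simp
qed

lemma holo_on_prod_subset:
  fixes A :: "('x::{t2_space,second_countable_topology}, 'n::finite) chart set"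
  assumes A: "complex_manifold A" and g: "holo_on (prod_atlas A (conj_atlas A)) g (W1 \<times> W2)"
    and W: "open W1'" "W1' \<subseteq> W1" "open W2'" "W2' \<subseteq> W2"
  shows "holo_on (prod_atlas A (conj_atlas A)) g (W1' \<times> W2')"
proof (rule holo_onI[OF open_Times[OF W(1,3)]])
  fix S \<Phi> assume S: "(S, \<Phi>) \<in> prod_atlas A (conj_atlas A)"
  then obtain U \<phi> V \<psi> where U: "(U, \<phi>) \<in> A" "(V, \<psi>) \<in> A" "S = U \<times> V" "\<Phi> = prod_chart \<phi> \<psi>"
    unfolding prod_atlas_conj_iff by auto
  show "cholo_on (\<lambda>z. g (inv_into S \<Phi> z)) (\<Phi> ` (S \<inter> W1' \<times> W2'))"
  proof (rule cholo_on_subset[OF holo_onD[OF g S]])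
    show "open (\<Phi> ` (S \<inter> W1' \<times> W2'))"
      unfolding U(3,4) prod_chart_image
      by (intro open_bidomain open_chart_image[OF A U(1) W(1)] open_chart_image[OF A U(2) W(3)])
    show "\<Phi> ` (S \<inter> W1' \<times> W2') \<subseteq> \<Phi> ` (S \<inter> W1 \<times> W2)" using W(2,4) by blast
  qed
qed

lemma holo_on_slice:
  fixes A :: "('x::{t2_space,second_countable_topology}, 'n::finite) chart set"
  assumes A: "complex_manifold A" and g: "holo_on (prod_atlas A (conj_atlas A)) g (W1 \<times> W2)"
    and W1: "open W1" and y: "y \<in> W2"
  shows "holo_on A (\<lambda>x. g (x, y)) W1"
proof (rule holo_onI[OF W1])
  fix U \<phi> assume U: "(U, \<phi>) \<in> A"
  obtain V \<psi> where V: "(V, \<psi>) \<in> A" "y \<in> V" by (rule chart_at[OF A])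
  have op: "open (\<phi> ` (U \<inter> W1))" by (rule open_chart_image[OF A U W1])
  have "cholo_on (\<lambda>z. join z (vcnj (\<psi> y)) $ k) (\<phi> ` (U \<inter> W1))" for k
    by (cases k) (auto intro: cholo_on_component cholo_on_const op)
  from cholo_on_compose[OF this holo_on_prod_polarized[OF A U V(1) g]]
  have "cholo_on (\<lambda>z. g (inv_into U \<phi> z, inv_into V \<psi> (\<psi> y))) (\<phi> ` (U \<inter> W1))"
    using V(2) y by (simp add: bidomain_def)
  then show "cholo_on (\<lambda>z. g (inv_into U \<phi> z, y)) (\<phi> ` (U \<inter> W1))"
    using chart_facts(6)[OF A V(1,2)] by simp
qed

section \<open>Line bundles and Hermitian algebraic functions in trivializations\<close>

lemma line_bundle_facts:
  assumes "holomorphic_line_bundle A F"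
  shows "open (lb_dom F i)" "\<exists>i. x \<in> lb_dom F i"
    "holo_on A (lb_trans F i j) (lb_dom F i \<inter> lb_dom F j)"
    "x \<in> lb_dom F i \<Longrightarrow> lb_trans F i i x = 1"
    "x \<in> lb_dom F i \<Longrightarrow> x \<in> lb_dom F j \<Longrightarrow> x \<in> lb_dom F k \<Longrightarrow> lb_trans F i j x * lb_trans F j k x = lb_trans F i k x"
    "x \<in> lb_dom F (idx F x)"
    "x \<in> lb_dom F i \<Longrightarrow> x \<in> lb_dom F j \<Longrightarrow> lb_trans F i j x \<noteq> 0"
    "x \<in> lb_dom F i \<Longrightarrow> x \<in> lb_dom F j \<Longrightarrow> lb_trans F i j x * lb_trans F j i x = 1"
proof -
  show *: "open (lb_dom F i)" "holo_on A (lb_trans F i j) (lb_dom F i \<inter> lb_dom F j)"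
    "x \<in> lb_dom F i \<Longrightarrow> lb_trans F i i x = 1"
    "x \<in> lb_dom F i \<Longrightarrow> x \<in> lb_dom F j \<Longrightarrow> x \<in> lb_dom F k \<Longrightarrow> lb_trans F i j x * lb_trans F j k x = lb_trans F i k x"
    for x i j k
    using assms unfolding holomorphic_line_bundle_def by blast+
  show ex: "\<exists>i. x \<in> lb_dom F i" using assms unfolding holomorphic_line_bundle_def by blast
  show "x \<in> lb_dom F (idx F x)" unfolding idx_def using someI_ex[OF ex] .
  show "x \<in> lb_dom F i \<Longrightarrow> x \<in> lb_dom F j \<Longrightarrow> lb_trans F i j x * lb_trans F j i x = 1"
    using *(3,4) by metis
  then show "x \<in> lb_dom F i \<Longrightarrow> x \<in> lb_dom F j \<Longrightarrow> lb_trans F i j x \<noteq> 0"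
    by (metis mult_zero_left zero_neq_one)
qed

lemma herm_lb_simps [simp]:
  "lb_dom (herm_lb F) (i, j) = lb_dom F i \<times> lb_dom F j"
  "lb_trans (herm_lb F) (i, j) (k, l) (x, y) = lb_trans F i k x * cnj (lb_trans F j l y)"
  by (auto simp: herm_lb_def tensor_lb_def pullback_lb_def conj_lb_def)

lemma hermitian_facts:
  assumes "hermitian_algebraic A F Q"
  shows "holo_on (prod_atlas A (conj_atlas A)) (\<lambda>p. Q p (i, j)) (lb_dom F i \<times> lb_dom F j)"
    "Q (x, y) (i, j) = cnj (Q (y, x) (j, i))"
    "x \<notin> lb_dom F i \<or> y \<notin> lb_dom F j \<Longrightarrow> Q (x, y) (i, j) = 0"
    "x \<in> lb_dom F i \<Longrightarrow> x \<in> lb_dom F k \<Longrightarrow> y \<in> lb_dom F j \<Longrightarrow> y \<in> lb_dom F l \<Longrightarrow>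
       Q (x, y) (i, j) = lb_trans F i k x * cnj (lb_trans F j l y) * Q (x, y) (k, l)"
proof -
  have s: "hol_section (prod_atlas A (conj_atlas A)) (herm_lb F) Q"
    and h: "\<And>x y i j. Q (x, y) (i, j) = cnj (Q (y, x) (j, i))"
    using assms unfolding hermitian_algebraic_def by blast+
  have fib: "Q p \<in> fibre (herm_lb F) p" and hol: "holo_on (prod_atlas A (conj_atlas A)) (\<lambda>p. Q p k) (lb_dom (herm_lb F) k)" for p k
    using s unfolding hol_section_def by blast+
  show "holo_on (prod_atlas A (conj_atlas A)) (\<lambda>p. Q p (i, j)) (lb_dom F i \<times> lb_dom F j)"
    using hol[of "(i, j)"] by simp
  show "Q (x, y) (i, j) = cnj (Q (y, x) (j, i))" by (rule h)
  have f1: "(x, y) \<notin> lb_dom (herm_lb F) (i, j) \<Longrightarrow> Q (x, y) (i, j) = 0"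
    and f2: "(x, y) \<in> lb_dom (herm_lb F) (i, j) \<inter> lb_dom (herm_lb F) (k, l) \<Longrightarrow>
      Q (x, y) (i, j) = lb_trans (herm_lb F) (i, j) (k, l) (x, y) * Q (x, y) (k, l)"
    using fib[of "(x, y)"] unfolding fibre_def by blast+
  show "x \<notin> lb_dom F i \<or> y \<notin> lb_dom F j \<Longrightarrow> Q (x, y) (i, j) = 0" using f1 by auto
  show "x \<in> lb_dom F i \<Longrightarrow> x \<in> lb_dom F k \<Longrightarrow> y \<in> lb_dom F j \<Longrightarrow> y \<in> lb_dom F l \<Longrightarrow>
       Q (x, y) (i, j) = lb_trans F i k x * cnj (lb_trans F j l y) * Q (x, y) (k, l)"
    using f2 by auto
qed

lemma idx_herm_lb:
  assumes "holomorphic_line_bundle A F"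
  obtains i j where "idx (herm_lb F) (x, y) = (i, j)" "x \<in> lb_dom F i" "y \<in> lb_dom F j"
proof -
  obtain i j where ij: "idx (herm_lb F) (x, y) = (i, j)" by fastforce
  have "\<exists>k. (x, y) \<in> lb_dom (herm_lb F) k"
    using line_bundle_facts(2)[OF assms, of x] line_bundle_facts(2)[OF assms, of y] by (metis SigmaI herm_lb_simps(1))
  then have "(x, y) \<in> lb_dom (herm_lb F) (idx (herm_lb F) (x, y))" unfolding idx_def by (rule someI_ex)
  then show ?thesis using that ij by auto
qed

lemma dual_lb_simps [simp]: "lb_dom (dual_lb F) = lb_dom F" "lb_trans (dual_lb F) i j x = inverse (lb_trans F i j x)"
  by (simp_all add: dual_lb_def)

lemma idx_dual_lb [simp]: "idx (dual_lb F) x = idx F x"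
  by (simp add: idx_def)

lemma fibreD:
  assumes "v \<in> fibre F x"
  shows "x \<notin> lb_dom F i \<Longrightarrow> v i = 0" "x \<in> lb_dom F i \<Longrightarrow> x \<in> lb_dom F j \<Longrightarrow> v i = lb_trans F i j x * v j"
  using assms unfolding fibre_def by blast+

lemma fibreI:
  assumes "\<And>i. x \<notin> lb_dom F i \<Longrightarrow> v i = 0"
    "\<And>i j. x \<in> lb_dom F i \<Longrightarrow> x \<in> lb_dom F j \<Longrightarrow> v i = lb_trans F i j x * v j"
  shows "v \<in> fibre F x"
  using assms unfolding fibre_def by blast

text \<open>Used to read \<open>h\<^sub>Q\<close> off from the diagonal entries of \<open>Q\<close>.\<close>

lemma frame_in_dual_fibre:
  assumes F: "holomorphic_line_bundle A F" and x: "x \<in> lb_dom F i"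
  shows "frame (dual_lb F) i x \<in> fibre (dual_lb F) x" "frame (dual_lb F) i x i = 1"
proof -
  note lb = line_bundle_facts[OF F]
  show "frame (dual_lb F) i x i = 1" using x lb(4)[OF x] by (simp add: frame_def)
  show "frame (dual_lb F) i x \<in> fibre (dual_lb F) x"
    by (rule fibreI) (use x lb(5) in \<open>auto simp: frame_def inverse_mult_distrib[symmetric]\<close>)
qed

text \<open>Another trivialization multiplies \<open>Q\<close> and the two dual vectors by mutually inverse factors, so the
  choice made by \<open>idx\<close> is immaterial.\<close>

lemma heval_eq:
  assumes F: "holomorphic_line_bundle A F" and Q: "hermitian_algebraic A F Q"
    and v: "v \<in> fibre (dual_lb F) x" and w: "w \<in> fibre (dual_lb F) y"
    and i: "x \<in> lb_dom F i" and j: "y \<in> lb_dom F j"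
  shows "heval F Q x v y w = Q (x, y) (i, j) * v i * cnj (w j)"
proof -
  obtain k l where kl: "idx (herm_lb F) (x, y) = (k, l)" "x \<in> lb_dom F k" "y \<in> lb_dom F l"
    by (rule idx_herm_lb[OF F])
  have "v k = inverse (lb_trans F k i x) * v i" "w l = inverse (lb_trans F l j y) * w j"
    using fibreD(2)[OF v, of k i] fibreD(2)[OF w, of l j] kl i j by simp_all
  moreover have "Q (x, y) (k, l) = lb_trans F k i x * cnj (lb_trans F l j y) * Q (x, y) (i, j)"
    by (rule hermitian_facts(4)[OF Q kl(2) i kl(3) j])
  moreover have "lb_trans F k i x \<noteq> 0" "lb_trans F l j y \<noteq> 0"
    using line_bundle_facts(7)[OF F] kl i j by blast+
  ultimately have "v i = v k * lb_trans F k i x" "w j = w l * lb_trans F l j y"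
    and "Q (x, y) (k, l) = lb_trans F k i x * cnj (lb_trans F l j y) * Q (x, y) (i, j)"
    by (simp_all add: field_simps)
  then show ?thesis
    by (simp add: heval_def pairing_def kl(1) vtensor_def vconj_def)
qed

lemma metric_of_frame:
  assumes "holomorphic_line_bundle A F" "hermitian_algebraic A F Q" "x \<in> lb_dom F i"
  shows "metric_of F Q x (frame (dual_lb F) i x) (frame (dual_lb F) i x) = Q (x, x) (i, i)"
  unfolding metric_of_def
  by (subst heval_eq[OF assms(1,2) frame_in_dual_fibre(1)[OF assms(1,3)] frame_in_dual_fibre(1)[OF assms(1,3)] assms(3,3)])
    (simp add: frame_in_dual_fibre(2)[OF assms(1,3)])

lemma positive_diagonal:
  assumes F: "holomorphic_line_bundle A F" and Q: "positive_hermitian_algebraic A F Q" and x: "x \<in> lb_dom F i"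
  shows "Q (x, x) (i, i) = of_real (Re (Q (x, x) (i, i)))" "0 < Re (Q (x, x) (i, i))"
proof -
  have h: "hermitian_algebraic A F Q" using Q by (simp add: positive_hermitian_algebraic_def)
  have "Q (x, x) (i, i) = cnj (Q (x, x) (i, i))" by (rule hermitian_facts(2)[OF h])
  then have "Im (Q (x, x) (i, i)) = - Im (Q (x, x) (i, i))" by (metis cnj.sel(2))
  then show "Q (x, x) (i, i) = of_real (Re (Q (x, x) (i, i)))" by (simp add: complex_eq_iff)
  have "frame (dual_lb F) i x \<noteq> (\<lambda>_. 0)" using frame_in_dual_fibre(2)[OF F x] by (metis zero_neq_one)
  then have "0 < Re (metric_of F Q x (frame (dual_lb F) i x) (frame (dual_lb F) i x))"
    using Q frame_in_dual_fibre(1)[OF F x] unfolding positive_hermitian_algebraic_def metric_of_def by blast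
  then show "0 < Re (Q (x, x) (i, i))" unfolding metric_of_frame[OF F h x] .
qed

section \<open>Mixed logarithmic derivatives of a polarized function\<close>

lemma has_derivative_diag:
  fixes q :: "complex^('n::finite + 'n) \<Rightarrow> complex"
  assumes "cholo_on q D" "diag z \<in> D"
  shows "((\<lambda>z. q (diag z)) has_derivative
    (\<lambda>h. (\<Sum>a\<in>UNIV. pd (Inl a) q (diag z) * h $ a) + (\<Sum>b\<in>UNIV. pd (Inr b) q (diag z) * cnj (h $ b)))) (at z)"
proof -
  have "bounded_linear (diag :: complex^'n \<Rightarrow> _)"
    by (intro linear_conv_bounded_linear[THEN iffD1] linearI)
      (auto simp: vec_eq_iff diag_def join_def vcnj_def split: sum.split)
  then have "(diag has_derivative diag) (at z)" by (rule bounded_linear_imp_has_derivative)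
  from has_derivative_compose[OF this cholo_on_has_derivative[OF assms]]
  show ?thesis by (simp add: sum_UNIV_Plus)
qed

lemma wirtinger_eqI:
  assumes "(f has_derivative (\<lambda>h. (\<Sum>a\<in>UNIV. p a * h $ a) + (\<Sum>b\<in>UNIV. q b * cnj (h $ b)))) (at z)"
  shows "wirtinger j f z = p j" "wirtinger_bar j f z = q j"
proof -
  have D: "frechet_derivative f (at z) = (\<lambda>h. (\<Sum>a\<in>UNIV. p a * h $ a) + (\<Sum>b\<in>UNIV. q b * cnj (h $ b)))"
    using frechet_derivative_at[OF assms] by simp
  have ax: "(\<Sum>a\<in>UNIV. r a * axis j c $ a) = r j * c" "(\<Sum>a\<in>UNIV. r a * cnj (axis j c $ a)) = r j * cnj c" for r :: "'a \<Rightarrow> complex" and c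
    by (simp_all add: axis_def if_distrib[of "\<lambda>x. _ * x"] if_distrib[of cnj] cong: if_cong)
  show "wirtinger j f z = p j" "wirtinger_bar j f z = q j"
    unfolding wirtinger_def wirtinger_bar_def D ax by (simp_all add: algebra_simps)
qed

text \<open>The matrix of mixed derivatives of \<open>log r\<close>, one in each slot, written without a branch of the logarithm.\<close>

definition log_hess :: "(complex^('n::finite + 'n) \<Rightarrow> complex) \<Rightarrow> complex^('n + 'n) \<Rightarrow> complex^'n^'n" where
  "log_hess r Z = (\<chi> j k. pd (Inl j) (\<lambda>Z. pd (Inr k) r Z / r Z) Z)"

lemma cholo_on_log_deriv:
  assumes "cholo_on r D" "\<And>Z. Z \<in> D \<Longrightarrow> r Z \<noteq> 0"
  shows "cholo_on (\<lambda>Z. pd k r Z / r Z) D"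
  by (intro cholo_on_divide cholo_on_pd assms)

lemma open_nonzero_set:
  assumes "cholo_on r D"
  shows "open {Z \<in> D. r Z \<noteq> 0}"
proof -
  have "open (D \<inter> r -` (- {0}))"
    by (rule continuous_open_preimage[OF cholo_on_continuous cholo_on_open]) (use assms in auto)
  moreover have "D \<inter> r -` (- {0}) = {Z \<in> D. r Z \<noteq> 0}" by auto
  ultimately show ?thesis by simp
qed

text \<open>Along \<open>w = cnj z\<close> the two Wirtinger operators become the holomorphic partial derivatives in the first
  and in the second slot.  As \<open>r\<close> is real there, so is its derivative along the diagonal, and the derivative of
  \<open>ln (Re r)\<close> is the logarithmic derivative of \<open>r\<close> itself.\<close>

lemma wirtinger_log_polarized:
  fixes r :: "complex^('n::finite + 'n) \<Rightarrow> complex"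
  assumes r: "cholo_on r D" and S: "open S" "z \<in> S" and D: "\<And>z. z \<in> S \<Longrightarrow> diag z \<in> D"
    and pos: "\<And>z. z \<in> S \<Longrightarrow> r (diag z) = of_real (Re (r (diag z)))" "\<And>z. z \<in> S \<Longrightarrow> 0 < Re (r (diag z))"
    and f: "\<And>z. z \<in> S \<Longrightarrow> f z = of_real (ln (Re (r (diag z))))"
  shows "wirtinger j (wirtinger_bar k f) z = log_hess r (diag z) $ j $ k"
proof -
  have bar: "wirtinger_bar k f z = pd (Inr k) r (diag z) / r (diag z)" if z: "z \<in> S" for z
  proof -
    define L where "L = (\<lambda>h::complex^'n. (\<Sum>a\<in>UNIV. pd (Inl a) r (diag z) * h $ a) + (\<Sum>b\<in>UNIV. pd (Inr b) r (diag z) * cnj (h $ b)))"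
    have DL: "((\<lambda>z. r (diag z)) has_derivative L) (at z)"
      unfolding L_def by (rule has_derivative_diag[OF r D[OF z]])
    have "((\<lambda>z. Im (r (diag z))) has_derivative (\<lambda>h. Im (L h))) (at z)"
      by (rule has_derivative_Im[OF DL])
    moreover have "((\<lambda>z. Im (r (diag z))) has_derivative (\<lambda>h. 0)) (at z)"
    proof (rule has_derivative_cong_open[OF has_derivative_const[of 0] S(1) z])
      fix w assume "w \<in> S"
      then show "0 = Im (r (diag w))" using pos(1)[of w] by (simp add: complex_eq_iff)
    qed
    ultimately have "(\<lambda>h. Im (L h)) = (\<lambda>h. 0)" by (rule has_derivative_unique)
    then have L_real: "L h = of_real (Re (L h))" for h by (simp add: complex_eq_iff fun_eq_iff)
    have "((\<lambda>z. ln (Re (r (diag z)))) has_derivative (\<lambda>h. Re (L h) * inverse (Re (r (diag z))))) (at z)"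
      using has_derivative_ln[OF pos(2)[OF z] has_derivative_Re[OF DL]] by simp
    then have "((\<lambda>z. of_real (ln (Re (r (diag z)))) :: complex) has_derivative (\<lambda>h. of_real (Re (L h) * inverse (Re (r (diag z)))))) (at z)"
      by (rule has_derivative_of_real)
    moreover have "of_real (Re (L h) * inverse (Re (r (diag z))))
       = (\<Sum>a\<in>UNIV. pd (Inl a) r (diag z) / r (diag z) * h $ a) + (\<Sum>b\<in>UNIV. pd (Inr b) r (diag z) / r (diag z) * cnj (h $ b))" for h
    proof -
      have "of_real (Re (L h) * inverse (Re (r (diag z)))) = L h / r (diag z)"
        using L_real[of h] pos(1)[OF z] by (metis divide_inverse of_real_inverse of_real_mult)
      then show ?thesis unfolding L_def by (simp add: add_divide_distrib sum_divide_distrib)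
    qed
    ultimately have "((\<lambda>z. of_real (ln (Re (r (diag z)))) :: complex) has_derivative
       (\<lambda>h. (\<Sum>a\<in>UNIV. pd (Inl a) r (diag z) / r (diag z) * h $ a) + (\<Sum>b\<in>UNIV. pd (Inr b) r (diag z) / r (diag z) * cnj (h $ b)))) (at z)"
      by simp
    then have "(f has_derivative
       (\<lambda>h. (\<Sum>a\<in>UNIV. pd (Inl a) r (diag z) / r (diag z) * h $ a) + (\<Sum>b\<in>UNIV. pd (Inr b) r (diag z) / r (diag z) * cnj (h $ b)))) (at z)"
      by (rule has_derivative_cong_open[OF _ S(1) z]) (simp add: f)
    then show ?thesis by (rule wirtinger_eqI(2))
  qed
  let ?D = "{Z \<in> D. r Z \<noteq> 0}"
  have q: "cholo_on (\<lambda>Z. pd (Inr k) r Z / r Z) ?D"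
    by (intro cholo_on_log_deriv cholo_on_subset[OF r open_nonzero_set[OF r]]) auto
  have "diag z \<in> ?D" using D[OF S(2)] pos(2)[OF S(2)] by auto
  from has_derivative_diag[OF q this] have "wirtinger j (\<lambda>z. pd (Inr k) r (diag z) / r (diag z)) z = pd (Inl j) (\<lambda>Z. pd (Inr k) r Z / r Z) (diag z)"
    by (rule wirtinger_eqI(1))
  moreover have "wirtinger j (wirtinger_bar k f) z = wirtinger j (\<lambda>z. pd (Inr k) r (diag z) / r (diag z)) z"
  proof -
    have "((\<lambda>z. pd (Inr k) r (diag z) / r (diag z)) has_derivative D') (at z) \<longleftrightarrow> (wirtinger_bar k f has_derivative D') (at z)" for D'
      using has_derivative_cong_open[OF _ S] bar by (metis (no_types, lifting))
    then show ?thesis unfolding wirtinger_def frechet_derivative_def by simp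
  qed
  ultimately show ?thesis by (simp add: log_hess_def)
qed

lemma cholo_on_left_right:
  assumes "open D" 
  shows "cholo_on (\<lambda>Z. left Z $ a) D" "cholo_on (\<lambda>Z. right Z $ b) D"
  using assms by (auto intro: cholo_on_component)

lemma pd_left_function:
  fixes g :: "complex^'n::finite \<Rightarrow> complex" and Z :: "complex^('n + 'm::finite)"
  assumes "cholo_on g S" "left Z \<in> S"
  shows "pd (Inl a) (\<lambda>Z. g (left Z)) Z = pd a g (left Z)" "pd (Inr b) (\<lambda>Z. g (left Z)) Z = 0"
proof -
  have "pd K (\<lambda>Z. g (left Z)) Z = (\<Sum>k\<in>UNIV. pd k g (left Z) * pd K (\<lambda>Z. left Z $ k) Z)" for K :: "'n + 'm"
    by (rule pd_compose[OF cholo_on_left_right(1)[OF open_UNIV] assms(1) UNIV_I assms(2)])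
  then show "pd (Inl a) (\<lambda>Z. g (left Z)) Z = pd a g (left Z)" "pd (Inr b) (\<lambda>Z. g (left Z)) Z = 0"
    by (simp_all add: pd_component if_distrib[of "\<lambda>x. _ * x"] cong: if_cong)
qed

lemma pd_right_function:
  fixes g :: "complex^'m::finite \<Rightarrow> complex" and Z :: "complex^('n::finite + 'm)"
  assumes "cholo_on g S" "right Z \<in> S"
  shows "pd (Inr b) (\<lambda>Z. g (right Z)) Z = pd b g (right Z)" "pd (Inl a) (\<lambda>Z. g (right Z)) Z = 0"
proof -
  have "pd K (\<lambda>Z. g (right Z)) Z = (\<Sum>k\<in>UNIV. pd k g (right Z) * pd K (\<lambda>Z. right Z $ k) Z)" for K :: "'n + 'm"
    by (rule pd_compose[OF cholo_on_left_right(2)[OF open_UNIV] assms(1) UNIV_I assms(2)])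
  then show "pd (Inr b) (\<lambda>Z. g (right Z)) Z = pd b g (right Z)" "pd (Inl a) (\<lambda>Z. g (right Z)) Z = 0"
    by (simp_all add: pd_component if_distrib[of "\<lambda>x. _ * x"] cong: if_cong)
qed

lemma open_vimage_left: "open S \<Longrightarrow> open (left -` S)" and open_vimage_right: "open T \<Longrightarrow> open (right -` T)"
  by (auto intro: open_vimage continuous_on_left continuous_on_right)

lemma cholo_on_left_function:
  "cholo_on g S \<Longrightarrow> cholo_on (\<lambda>Z. g (left Z)) (left -` S)"
  by (rule cholo_on_compose[OF cholo_on_left_right(1)]) (auto intro: open_vimage_left cholo_on_open)

lemma cholo_on_right_function:
  "cholo_on g S \<Longrightarrow> cholo_on (\<lambda>Z. g (right Z)) (right -` S)"
  by (rule cholo_on_compose[OF cholo_on_left_right(2)]) (auto intro: open_vimage_right cholo_on_open)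

text \<open>The two conjugations cancel in the derivative, which is therefore complex linear.\<close>

lemma cholo_on_reflect:
  fixes g :: "complex^'n::finite \<Rightarrow> complex"
  assumes g: "cholo_on g S"
  shows "cholo_on (\<lambda>w. cnj (g (vcnj w))) (vcnj -` S)"
    and "vcnj w \<in> S \<Longrightarrow> pd k (\<lambda>w. cnj (g (vcnj w))) w = cnj (pd k g (vcnj w))"
proof -
  have D: "((\<lambda>w. cnj (g (vcnj w))) has_derivative (\<lambda>h. \<Sum>k\<in>UNIV. cnj (pd k g (vcnj w)) * h $ k)) (at w)"
    if "vcnj w \<in> S" for w
  proof -
    have "bounded_linear (vcnj :: complex^'n \<Rightarrow> _)"
      by (intro linear_conv_bounded_linear[THEN iffD1] linearI) (auto simp: vec_eq_iff)
    then have "(vcnj has_derivative vcnj) (at w)" by (rule bounded_linear_imp_has_derivative)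
    from has_derivative_cnj[OF has_derivative_compose[OF this cholo_on_has_derivative[OF g that]]]
    show ?thesis by simp
  qed
  show "vcnj w \<in> S \<Longrightarrow> pd k (\<lambda>w. cnj (g (vcnj w))) w = cnj (pd k g (vcnj w))"
    by (rule pd_eqI[OF D])
  show "cholo_on (\<lambda>w. cnj (g (vcnj w))) (vcnj -` S)"
    by (rule cholo_onI[OF open_vimage[OF cholo_on_open[OF g] continuous_on_vcnj] D]) auto
qed

lemma log_hess_cong:
  assumes r: "cholo_on r D" and Z: "Z \<in> D" and nz: "\<And>Z. Z \<in> D \<Longrightarrow> r Z \<noteq> 0" and eq: "\<And>Z. Z \<in> D \<Longrightarrow> r Z = q Z"
  shows "log_hess r Z = log_hess q Z"
proof -
  have "pd (Inl j) (\<lambda>Z. pd (Inr k) r Z / r Z) Z = pd (Inl j) (\<lambda>Z. pd (Inr k) q Z / q Z) Z" for j k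
    by (rule pd_cong[OF cholo_on_log_deriv[OF r nz] Z]) (simp_all add: eq pd_cong[OF r _ eq])
  then show ?thesis by (simp add: log_hess_def)
qed

text \<open>The pluriharmonicity of \<open>log |g|\<^sup>2\<close>: one factor contributes nothing to the derivative in the second slot, and
  the contribution of the other is killed by the derivative in the first slot.\<close>

lemma log_hess_scale:
  fixes q :: "complex^('n::finite + 'n) \<Rightarrow> complex"
  assumes q: "cholo_on q D" and nzq: "\<And>Z. Z \<in> D \<Longrightarrow> q Z \<noteq> 0"
    and g: "cholo_on g S" "\<And>z. z \<in> S \<Longrightarrow> g z \<noteq> 0" and D: "\<And>Z. Z \<in> D \<Longrightarrow> left Z \<in> S \<and> vcnj (right Z) \<in> S"
    and Z: "Z \<in> D"
  shows "log_hess (\<lambda>Z. g (left Z) * cnj (g (vcnj (right Z))) * q Z) Z = log_hess q Z"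
proof -
  have oD: "open D" by (rule cholo_on_open[OF q])
  define b where "b = (\<lambda>w. cnj (g (vcnj w)))"
  have b: "cholo_on b (vcnj -` S)" unfolding b_def by (rule cholo_on_reflect(1)[OF g(1)])
  have gl: "cholo_on (\<lambda>Z. g (left Z)) D" by (rule cholo_on_subset[OF cholo_on_left_function[OF g(1)] oD]) (use D in auto)
  have br: "cholo_on (\<lambda>Z. b (right Z)) D" by (rule cholo_on_subset[OF cholo_on_right_function[OF b] oD]) (use D in auto)
  have gb: "cholo_on (\<lambda>Z. g (left Z) * b (right Z)) D" by (rule cholo_on_mult[OF gl br])
  have nz: "g (left Z) \<noteq> 0" "b (right Z) \<noteq> 0" if "Z \<in> D" for Z using D[OF that] g(2) by (auto simp: b_def)
  define c where "c = (\<lambda>k w. pd k b w / b w)"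
  have c: "cholo_on (c k) (vcnj -` S)" for k
    unfolding c_def by (intro cholo_on_divide cholo_on_pd b) (use g(2) in \<open>auto simp: b_def\<close>)
  have cr: "cholo_on (\<lambda>Z. c k (right Z)) D" for k
    by (rule cholo_on_subset[OF cholo_on_right_function[OF c] oD]) (use D in auto)
  have qd: "cholo_on (\<lambda>Z. pd (Inr k) q Z / q Z) D" for k by (rule cholo_on_log_deriv[OF q nzq])
  have first: "pd (Inr k) (\<lambda>Z. g (left Z) * b (right Z) * q Z) Z / (g (left Z) * b (right Z) * q Z) = c k (right Z) + pd (Inr k) q Z / q Z"
    if Z: "Z \<in> D" for k Z
  proof -
    have "pd (Inr k) (\<lambda>Z. g (left Z) * b (right Z)) Z = g (left Z) * pd k b (right Z)"
      using D[OF Z] by (simp add: pd_mult[OF gl br Z] pd_left_function[OF g(1)] pd_right_function[OF b])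
    then have "pd (Inr k) (\<lambda>Z. g (left Z) * b (right Z) * q Z) Z
        = g (left Z) * pd k b (right Z) * q Z + g (left Z) * b (right Z) * pd (Inr k) q Z"
      by (simp add: pd_mult[OF gb q Z])
    then show ?thesis using nz[OF Z] nzq[OF Z] by (simp add: c_def field_simps)
  qed
  have "pd (Inl j) (\<lambda>Z. pd (Inr k) (\<lambda>Z. g (left Z) * b (right Z) * q Z) Z / (g (left Z) * b (right Z) * q Z)) Z
      = pd (Inl j) (\<lambda>Z. pd (Inr k) q Z / q Z) Z" for j k
  proof -
    have "pd (Inl j) (\<lambda>Z. pd (Inr k) (\<lambda>Z. g (left Z) * b (right Z) * q Z) Z / (g (left Z) * b (right Z) * q Z)) Z
      = pd (Inl j) (\<lambda>Z. c k (right Z) + pd (Inr k) q Z / q Z) Z"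
      by (rule pd_cong[OF cholo_on_cong[OF cholo_on_add[OF cr qd]] Z]) (simp_all add: first)
    also have "\<dots> = pd (Inl j) (\<lambda>Z. pd (Inr k) q Z / q Z) Z"
      using D[OF Z] by (simp add: pd_add[OF cr qd Z] pd_right_function[OF c])
    finally show ?thesis .
  qed
  then show ?thesis by (simp add: log_hess_def b_def)
qed

text \<open>Each slot of the substituted map depends on one of the two variables only.  Hence the chain rule contracts one
  index of the mixed derivatives with the Jacobian of \<open>T\<close> and the other with its conjugate, as for a form of type (1,1).\<close>

lemma log_hess_compose:
  fixes r :: "complex^('n::finite + 'n) \<Rightarrow> complex" and T :: "complex^'n \<Rightarrow> complex^'n"
  assumes r: "cholo_on r D" and nz: "\<And>Z. Z \<in> D \<Longrightarrow> r Z \<noteq> 0"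
    and T: "\<And>l. cholo_on (\<lambda>z. T z $ l) S" and S: "z \<in> S" "diag (T z) \<in> D"
  shows "log_hess (\<lambda>Z. r (join (T (left Z)) (vcnj (T (vcnj (right Z)))))) (diag z) $ j $ k
    = (\<Sum>l\<in>UNIV. \<Sum>m\<in>UNIV. log_hess r (diag (T z)) $ l $ m * pd j (\<lambda>z. T z $ l) z * cnj (pd k (\<lambda>z. T z $ m) z))"
proof -
  define G where "G = (\<lambda>Z. join (T (left Z)) (vcnj (T (vcnj (right Z)))))"
  define V where "V = (\<lambda>m w. cnj (T (vcnj w) $ m))"
  have V: "cholo_on (V m) (vcnj -` S)" for m unfolding V_def by (rule cholo_on_reflect(1)[OF T])
  have oS: "open S" by (rule cholo_on_open[OF T])
  let ?B = "bidomain S S"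
  have oB: "open ?B" by (rule open_bidomain[OF oS oS])
  have G_B: "cholo_on (\<lambda>Z. G Z $ K) ?B" for K
  proof (cases K)
    case (Inl l)
    show ?thesis unfolding Inl G_def join_simps
      by (rule cholo_on_subset[OF cholo_on_left_function[OF T] oB]) (auto simp: bidomain_def)
  next
    case (Inr m)
    show ?thesis unfolding Inr G_def join_simps
      by (rule cholo_on_subset[OF cholo_on_right_function[OF V[unfolded V_def]] oB]) (auto simp: bidomain_def)
  qed
  define B where "B = ?B \<inter> G -` D"
  have contG: "continuous_on ?B G"
  proof -
    have "continuous_on ?B (\<lambda>Z. \<chi> K. G Z $ K)"
      by (intro continuous_on_vec_lambda cholo_on_continuous G_B)
    then show ?thesis by simp
  qed
  have oBB: "open B"
    unfolding B_def by (rule continuous_open_preimage[OF contG oB cholo_on_open[OF r]])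
  have GB: "cholo_on (\<lambda>Z. G Z $ K) B" for K by (rule cholo_on_subset[OF G_B oBB]) (auto simp: B_def)
  have inB: "left Z \<in> S" "vcnj (right Z) \<in> S" "G Z \<in> D" if "Z \<in> B" for Z
    using that by (auto simp: B_def bidomain_def)
  have Gz: "G (diag z) = diag (T z)" by (simp add: G_def diag_def)
  have zB: "diag z \<in> B" using S by (simp add: B_def diag_bidomain Gz)
  have rG: "cholo_on (\<lambda>Z. r (G Z)) B" by (rule cholo_on_compose[OF GB r]) (rule inB)
  have pdG: "pd (Inl j) (\<lambda>Z. G Z $ Inl l) Z = pd j (\<lambda>z. T z $ l) (left Z)" "pd (Inl j) (\<lambda>Z. G Z $ Inr m) Z = 0"
    "pd (Inr k) (\<lambda>Z. G Z $ Inl l) Z = 0" "pd (Inr k) (\<lambda>Z. G Z $ Inr m) Z = pd k (V m) (right Z)" if "Z \<in> B" for Z j k l m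
    using inB[OF that] pd_left_function[OF T[of l], of Z] pd_right_function[OF V[of m], of Z]
    by (simp_all add: G_def V_def)
  define q where "q = (\<lambda>m Z. pd (Inr m) r Z / r Z)"
  have q: "cholo_on (q m) D" for m unfolding q_def by (rule cholo_on_log_deriv[OF r nz])
  have qG: "cholo_on (\<lambda>Z. q m (G Z)) B" for m by (rule cholo_on_compose[OF GB q]) (rule inB)
  have PV: "cholo_on (\<lambda>Z. pd k (V m) (right Z)) B" for k m
    by (rule cholo_on_subset[OF cholo_on_right_function[OF cholo_on_pd[OF V]] oBB]) (use inB in auto)
  have first: "pd (Inr k) (\<lambda>Z. r (G Z)) Z / r (G Z) = (\<Sum>m\<in>UNIV. q m (G Z) * pd k (V m) (right Z))" if Z: "Z \<in> B" for Z k
  proof -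
    have "pd (Inr k) (\<lambda>Z. r (G Z)) Z = (\<Sum>m\<in>UNIV. pd (Inr m) r (G Z) * pd k (V m) (right Z))"
      unfolding pd_compose[OF GB r Z inB(3)[OF Z]] sum_UNIV_Plus by (simp add: pdG[OF Z])
    then show ?thesis by (simp add: q_def sum_divide_distrib)
  qed
  have summand: "pd (Inl j) (\<lambda>Z. q m (G Z) * pd k (V m) (right Z)) (diag z)
      = (\<Sum>l\<in>UNIV. log_hess r (diag (T z)) $ l $ m * pd j (\<lambda>z. T z $ l) z) * cnj (pd k (\<lambda>z. T z $ m) z)" for m
  proof -
    have "pd (Inl j) (\<lambda>Z. pd k (V m) (right Z)) (diag z) = 0"
      by (rule pd_right_function(2)[OF cholo_on_pd[OF V]]) (use S in simp)
    moreover have "pd k (V m) (right (diag z)) = cnj (pd k (\<lambda>z. T z $ m) z)"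
      using cholo_on_reflect(2)[OF T[of m], of "vcnj z" k] S(1) by (simp add: V_def)
    moreover have "pd (Inl j) (\<lambda>Z. q m (G Z)) (diag z) = (\<Sum>l\<in>UNIV. log_hess r (diag (T z)) $ l $ m * pd j (\<lambda>z. T z $ l) z)"
      unfolding pd_compose[OF GB q zB inB(3)[OF zB]] sum_UNIV_Plus
      by (simp add: pdG[OF zB] Gz log_hess_def q_def)
    ultimately show ?thesis by (simp add: pd_mult[OF qG PV zB])
  qed
  have "pd (Inl j) (\<lambda>Z. pd (Inr k) (\<lambda>Z. r (G Z)) Z / r (G Z)) (diag z)
      = pd (Inl j) (\<lambda>Z. \<Sum>m\<in>UNIV. q m (G Z) * pd k (V m) (right Z)) (diag z)"
    by (rule pd_cong[OF cholo_on_log_deriv[OF rG] zB]) (use nz inB first in auto)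
  also have "\<dots> = (\<Sum>m\<in>UNIV. pd (Inl j) (\<lambda>Z. q m (G Z) * pd k (V m) (right Z)) (diag z))"
    by (rule pd_sum[OF cholo_on_mult[OF qG PV] zB]) 
  also have "\<dots> = (\<Sum>l\<in>UNIV. \<Sum>m\<in>UNIV. log_hess r (diag (T z)) $ l $ m * pd j (\<lambda>z. T z $ l) z * cnj (pd k (\<lambda>z. T z $ m) z))"
    unfolding summand sum_distrib_right by (rule sum.swap)
  finally show ?thesis by (simp add: log_hess_def G_def)
qed

section \<open>The volume density in charts\<close>

definition polar :: "'x set \<Rightarrow> ('x \<Rightarrow> complex^'n::finite) \<Rightarrow> ('x, 'i) herm_fun \<Rightarrow> 'i \<Rightarrow> complex^('n + 'n) \<Rightarrow> complex" where
  "polar U \<phi> R i Z = R (inv_into U \<phi> (left Z), inv_into U \<phi> (vcnj (right Z))) (i, i)"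

lemma polar_holo:
  assumes "complex_manifold A" "(U, \<phi>) \<in> A" "hermitian_algebraic A L R"
  shows "cholo_on (polar U \<phi> R i) (bidomain (\<phi> ` (U \<inter> lb_dom L i)) (\<phi> ` (U \<inter> lb_dom L i)))"
  unfolding polar_def
  by (rule holo_on_prod_polarized[OF assms(1,2,2) hermitian_facts(1)[OF assms(3)]])

lemma polar_diag:
  assumes "complex_manifold A" "(U, \<phi>) \<in> A" "x \<in> U"
  shows "polar U \<phi> R i (diag (\<phi> x)) = R (x, x) (i, i)"
  using chart_facts(6)[OF assms] by (simp add: polar_def)

text \<open>The pairing of the frame with itself is the diagonal entry of \<open>R\<close>, whose polarization is \<open>polar\<close>.\<close>

lemma curvature_eq_form11:
  assumes A: "complex_manifold A" and U: "(U, \<phi>) \<in> A" and L: "holomorphic_line_bundle A L"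
    and R: "positive_hermitian_algebraic A L R" and x: "x \<in> U"
  shows "curvature (dual_lb L) (metric_of L R) (U, \<phi>) x u v
    = - form11 (log_hess (polar U \<phi> R (idx L x)) (diag (\<phi> x))) u v"
proof -
  define i where "i = idx L x"
  have h: "hermitian_algebraic A L R" using R by (simp add: positive_hermitian_algebraic_def)
  have xi: "x \<in> lb_dom L i" unfolding i_def by (rule line_bundle_facts(6)[OF L])
  define f where "f = (\<lambda>z. of_real (ln (Re (metric_of L R (inv_into U \<phi> z) (frame (dual_lb L) i (inv_into U \<phi> z)) (frame (dual_lb L) i (inv_into U \<phi> z))))) :: complex)"
  let ?S = "\<phi> ` (U \<inter> lb_dom L i)"
  have W: "wirtinger j (wirtinger_bar k f) (\<phi> x) = log_hess (polar U \<phi> R i) (diag (\<phi> x)) $ j $ k" for j k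
  proof (rule wirtinger_log_polarized[OF polar_holo[OF A U h] open_chart_image[OF A U line_bundle_facts(1)[OF L]]])
    show "\<phi> x \<in> ?S" using x xi by auto
  next
    fix z assume z: "z \<in> ?S"
    then obtain y where y: "y \<in> U" "y \<in> lb_dom L i" "z = \<phi> y" by auto
    note pd = polar_diag[OF A U y(1), of R i] and pos = positive_diagonal[OF L R y(2)]
    show "diag z \<in> bidomain ?S ?S" using z by (simp add: diag_bidomain)
    show "polar U \<phi> R i (diag z) = of_real (Re (polar U \<phi> R i (diag z)))"
      unfolding y(3) pd by (rule pos(1))
    show "0 < Re (polar U \<phi> R i (diag z))" unfolding y(3) pd by (rule pos(2))
    show "f z = of_real (ln (Re (polar U \<phi> R i (diag z))))"
      unfolding y(3) pd f_def chart_facts(6)[OF A U y(1)] metric_of_frame[OF L h y(2)] ..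
  qed
  have "ddbar f (\<phi> x) u v = (\<Sum>j\<in>UNIV. \<Sum>k\<in>UNIV. log_hess (polar U \<phi> R i) (diag (\<phi> x)) $ j $ k * (u $ j * cnj (v $ k) - v $ j * cnj (u $ k)))"
    unfolding ddbar_def W ..
  moreover have "curvature (dual_lb L) (metric_of L R) (U, \<phi>) x u v = Re (- (\<i> / 2) * ddbar f (\<phi> x) u v)"
    by (simp add: curvature_def Let_def f_def i_def)
  ultimately show ?thesis unfolding form11_def i_def[symmetric] by simp
qed

text \<open>A change of trivialization multiplies the polarized function by \<open>g(z) cnj (g(cnj w))\<close>, which \<open>log_hess\<close> does not see;
  a change of chart composes it with the transition map in both slots.\<close>

lemma log_hess_transform:
  assumes A: "complex_manifold A" and U: "(U, \<phi>) \<in> A" and V: "(V, \<psi>) \<in> A"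
    and L: "holomorphic_line_bundle A L" and R: "positive_hermitian_algebraic A L R"
    and x: "x \<in> U" "x \<in> V" "x \<in> lb_dom L i" "x \<in> lb_dom L i'"
  defines "T \<equiv> \<lambda>z. \<psi> (inv_into U \<phi> z)"
  shows "log_hess (polar U \<phi> R i) (diag (\<phi> x)) $ j $ k = (\<Sum>l\<in>UNIV. \<Sum>m\<in>UNIV.
    log_hess (polar V \<psi> R i') (diag (\<psi> x)) $ l $ m * pd j (\<lambda>z. T z $ l) (\<phi> x) * cnj (pd k (\<lambda>z. T z $ m) (\<phi> x)))"
proof -
  have h: "hermitian_algebraic A L R" using R by (simp add: positive_hermitian_algebraic_def)
  note lb = line_bundle_facts[OF L]
  define W where "W = U \<inter> V \<inter> lb_dom L i \<inter> lb_dom L i'"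
  define S where "S = \<phi> ` W"
  have oW: "open W" unfolding W_def using chart_facts(1)[OF A U] chart_facts(1)[OF A V] lb(1) by auto
  have "W = U \<inter> W" by (auto simp: W_def)
  then have oS: "open S" unfolding S_def using open_chart_image[OF A U oW] by simp
  have inv: "inv_into U \<phi> (\<phi> y) = y" if "y \<in> W" for y using chart_facts(6)[OF A U] that by (auto simp: W_def)
  have invV: "inv_into V \<psi> (\<psi> y) = y" if "y \<in> W" for y using chart_facts(6)[OF A V] that by (auto simp: W_def)
  have xW: "x \<in> W" using x by (simp add: W_def)
  have xS: "\<phi> x \<in> S" using xW by (simp add: S_def)
  have oB: "open (bidomain S S)" by (rule open_bidomain[OF oS oS])
  have p_holo: "cholo_on (polar U \<phi> R k) (bidomain S S)" if "k = i \<or> k = i'" for k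
    by (rule cholo_on_subset[OF polar_holo[OF A U h] oB])
      (use that in \<open>auto simp: bidomain_def S_def W_def\<close>)
  define g where "g = (\<lambda>z. lb_trans L i i' (inv_into U \<phi> z))"
  have g: "cholo_on g S" unfolding g_def
    by (rule cholo_on_subset[OF holo_onD[OF lb(3) U] oS]) (auto simp: S_def W_def)
  have gnz: "g z \<noteq> 0" if "z \<in> S" for z
    using that lb(7) inv by (auto simp: g_def S_def W_def)
  have scale: "polar U \<phi> R i Z = g (left Z) * cnj (g (vcnj (right Z))) * polar U \<phi> R i' Z" if Z: "Z \<in> bidomain S S" for Z
  proof -
    obtain a b where ab: "left Z = \<phi> a" "a \<in> W" "vcnj (right Z) = \<phi> b" "b \<in> W"
      using Z by (auto simp: bidomain_def S_def)
    have "R (a, b) (i, i) = lb_trans L i i' a * cnj (lb_trans L i i' b) * R (a, b) (i', i')"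
      by (rule hermitian_facts(4)[OF h]) (use ab in \<open>auto simp: W_def\<close>)
    then show ?thesis unfolding polar_def g_def ab(1,3) inv[OF ab(2)] inv[OF ab(4)] .
  qed
  have comp: "polar U \<phi> R i' Z = polar V \<psi> R i' (join (T (left Z)) (vcnj (T (vcnj (right Z)))))" if Z: "Z \<in> bidomain S S" for Z
  proof -
    obtain a b where ab: "left Z = \<phi> a" "a \<in> W" "vcnj (right Z) = \<phi> b" "b \<in> W"
      using Z by (auto simp: bidomain_def S_def)
    then show ?thesis by (simp add: polar_def T_def inv invV)
  qed
  let ?D = "{Z \<in> bidomain S S. polar U \<phi> R i' Z \<noteq> 0}"
  have oD: "open ?D" by (rule open_nonzero_set[OF p_holo]) simp
  have diagS: "diag (\<phi> x) \<in> bidomain S S" using xS by (simp add: diag_bidomain)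
  have nz_x: "polar U \<phi> R i' (diag (\<phi> x)) \<noteq> 0"
    unfolding polar_diag[OF A U x(1)] using positive_diagonal(2)[OF L R x(4)] by auto
  have pi': "cholo_on (polar U \<phi> R i') ?D" by (rule cholo_on_subset[OF p_holo oD]) auto
  have gg: "Z \<in> ?D \<Longrightarrow> g (left Z) * cnj (g (vcnj (right Z))) \<noteq> 0" for Z using gnz by (auto simp: bidomain_def)
  have "log_hess (polar U \<phi> R i) (diag (\<phi> x)) = log_hess (\<lambda>Z. g (left Z) * cnj (g (vcnj (right Z))) * polar U \<phi> R i' Z) (diag (\<phi> x))"
  proof (rule log_hess_cong)
    show "cholo_on (polar U \<phi> R i) ?D" by (rule cholo_on_subset[OF p_holo oD]) auto
    show "polar U \<phi> R i Z \<noteq> 0" if "Z \<in> ?D" for Z using gg[OF that] scale[of Z] that by auto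
  qed (use scale diagS nz_x in auto)
  also have "\<dots> = log_hess (polar U \<phi> R i') (diag (\<phi> x))"
    by (rule log_hess_scale[OF pi' _ g gnz]) (use diagS nz_x in \<open>auto simp: bidomain_def\<close>)
  also have "\<dots> = log_hess (\<lambda>Z. polar V \<psi> R i' (join (T (left Z)) (vcnj (T (vcnj (right Z)))))) (diag (\<phi> x))"
    by (rule log_hess_cong[OF pi']) (use diagS nz_x comp in auto)
  finally have eq: "log_hess (polar U \<phi> R i) (diag (\<phi> x)) = \<dots>" .
  have Tx: "T (\<phi> x) = \<psi> x" using inv[OF xW] by (simp add: T_def)
  have T: "cholo_on (\<lambda>z. T z $ l) S" for l
    unfolding T_def by (rule cholo_on_subset[OF transition_holo[OF A U V] oS]) (auto simp: S_def W_def)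
  show ?thesis unfolding eq Tx[symmetric]
  proof (rule log_hess_compose[OF _ _ T xS])
    let ?B = "bidomain (\<psi> ` (V \<inter> lb_dom L i')) (\<psi> ` (V \<inter> lb_dom L i'))"
    let ?D = "{Z \<in> ?B. polar V \<psi> R i' Z \<noteq> 0}"
    show "cholo_on (polar V \<psi> R i') ?D"
      by (rule cholo_on_subset[OF polar_holo[OF A V h] open_nonzero_set[OF polar_holo[OF A V h]]]) auto
    show "polar V \<psi> R i' Z \<noteq> 0" if "Z \<in> ?D" for Z using that by auto
    show "diag (T (\<phi> x)) \<in> ?D"
      unfolding Tx using x positive_diagonal(2)[OF L R x(4)]
      by (auto simp: diag_bidomain polar_diag[OF A V x(2)])
  qed
qed

text \<open>The case of a single chart, where the transition map is the identity.  It makes the density continuous although the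
  trivialization chosen by \<open>idx\<close> may jump from point to point.\<close>

lemma log_hess_index:
  assumes A: "complex_manifold A" and U: "(U, \<phi>) \<in> A"
    and L: "holomorphic_line_bundle A L" and R: "positive_hermitian_algebraic A L R"
    and x: "x \<in> U" "x \<in> lb_dom L i" "x \<in> lb_dom L i'"
  shows "log_hess (polar U \<phi> R i) (diag (\<phi> x)) = log_hess (polar U \<phi> R i') (diag (\<phi> x))"
proof -
  have "pd j (\<lambda>z. \<phi> (inv_into U \<phi> z) $ l) (\<phi> x) = (if j = l then 1 else 0)" for j l
  proof -
    have "pd j (\<lambda>z. \<phi> (inv_into U \<phi> z) $ l) (\<phi> x) = pd j (\<lambda>z. z $ l) (\<phi> x)"
      by (rule pd_cong[OF transition_holo[OF A U U]]) (use x chart_facts(6)[OF A U] in auto)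
    then show ?thesis by (simp add: pd_component)
  qed
  then have "log_hess (polar U \<phi> R i) (diag (\<phi> x)) $ j $ k = log_hess (polar U \<phi> R i') (diag (\<phi> x)) $ j $ k" for j k
    unfolding log_hess_transform[OF A U U L R x(1,1,2,3)]
    by (simp add: if_distrib[of "\<lambda>x. _ * x"] if_distrib[of cnj] cong: if_cong)
  then show ?thesis by (simp add: vec_eq_iff)
qed

lemma vol_density_eq:
  fixes A :: "('x::{t2_space,second_countable_topology}, 'n::finite) chart set"
  assumes A: "complex_manifold A" and U: "(U, \<phi>) \<in> A"
    and L: "holomorphic_line_bundle A L" and R: "positive_hermitian_algebraic A L R"
    and x: "x \<in> U" "x \<in> lb_dom L i"
  shows "vol_density L R (U, \<phi>) x
    = top_wedge_power (form11 (log_hess (polar U \<phi> R i) (diag (\<phi> x)))) / fact CARD('n)"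
  unfolding vol_density_def curvature_eq_form11[OF A U L R x(1)] minus_minus
    log_hess_index[OF A U L R x(1) line_bundle_facts(6)[OF L] x(2)] ..

lemma vol_density_pos:
  assumes A: "complex_manifold A" and U: "(U, \<phi>) \<in> A"
    and L: "holomorphic_line_bundle A L" and R: "positive_hermitian_algebraic A L R"
    and S: "SGCS A L R" and x: "x \<in> U"
  shows "0 < vol_density L R (U, \<phi>) x"
proof -
  note xi = line_bundle_facts(6)[OF L, of x]
  have "curvature (dual_lb L) (metric_of L R) (U, \<phi>) x u (\<i> *s u) < 0" if "u \<noteq> 0" for u
    using S U x that unfolding SGCS_def neg_def_curvature_def by fastforce
  then have "0 < form11 (log_hess (polar U \<phi> R (idx L x)) (diag (\<phi> x))) u (\<i> *s u)" if "u \<noteq> 0" for u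
    using that unfolding curvature_eq_form11[OF A U L R x] by fastforce
  then show ?thesis unfolding vol_density_eq[OF A U L R x xi]
    by (intro divide_pos_pos top_wedge_power_form11_pos) auto
qed

definition jacobian :: "(complex^'n::finite \<Rightarrow> complex^'n) \<Rightarrow> complex^'n \<Rightarrow> complex^'n^'n" where
  "jacobian T z = (\<chi> l j. pd j (\<lambda>z. T z $ l) z)"

lemma vol_density_transform:
  fixes A :: "('x::{t2_space,second_countable_topology}, 'n::finite) chart set"
  assumes A: "complex_manifold A" and U: "(U, \<phi>) \<in> A" and V: "(V, \<psi>) \<in> A"
    and L: "holomorphic_line_bundle A L" and R: "positive_hermitian_algebraic A L R"
    and x: "x \<in> U" "x \<in> V"
  shows "vol_density L R (U, \<phi>) x
    = det (\<chi> p. real_coords (jacobian (\<lambda>z. \<psi> (inv_into U \<phi> z)) (\<phi> x) *v real_basis p)) * vol_density L R (V, \<psi>) x"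
proof -
  define J where "J = jacobian (\<lambda>z. \<psi> (inv_into U \<phi> z)) (\<phi> x)"
  note xi = line_bundle_facts(6)[OF L, of x]
  have "form11 (log_hess (polar U \<phi> R (idx L x)) (diag (\<phi> x)))
    = (\<lambda>u v. form11 (log_hess (polar V \<psi> R (idx L x)) (diag (\<psi> x))) (J *v u) (J *v v))"
    by (intro ext form11_pullback) (simp add: log_hess_transform[OF A U V L R x xi xi] J_def jacobian_def)
  then show ?thesis
    unfolding vol_density_eq[OF A U L R x(1) xi] vol_density_eq[OF A V L R x(2) xi] J_def[symmetric]
    by (simp add: top_wedge_power_pullback[OF bilinear_form11, of _ "(*v) J"])
qed

lemma transition_has_derivative:
  assumes A: "complex_manifold A" and U: "(U, \<phi>) \<in> A" and V: "(V, \<psi>) \<in> A" and z: "z \<in> \<phi> ` (U \<inter> V)"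
  shows "((\<lambda>z. \<psi> (inv_into U \<phi> z)) has_derivative (*v) (jacobian (\<lambda>z. \<psi> (inv_into U \<phi> z)) z)) (at z)"
  unfolding has_derivative_componentwise_within[of "\<lambda>z. \<psi> (inv_into U \<phi> z)"] Basis_vec_def
proof clarsimp
  fix k and u :: complex
  have "((\<lambda>x. \<psi> (inv_into U \<phi> x) $ k \<bullet> u) has_derivative
      (\<lambda>h. (\<Sum>j\<in>UNIV. pd j (\<lambda>z. \<psi> (inv_into U \<phi> z) $ k) z * h $ j) \<bullet> u)) (at z)"
    by (intro has_derivative_inner_left cholo_on_has_derivative[OF transition_holo[OF A U V] z])
  then show "((\<lambda>x. \<psi> (inv_into U \<phi> x) \<bullet> axis k u) has_derivative
      (\<lambda>x. (jacobian (\<lambda>z. \<psi> (inv_into U \<phi> z)) z *v x) \<bullet> axis k u)) (at z)"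
    by (simp add: inner_axis matrix_vector_mult_def jacobian_def)
qed

lemma continuous_on_top_wedge_form11:
  assumes "\<And>j k. continuous_on S (\<lambda>z. H z $ j $ k)"
  shows "continuous_on S (\<lambda>z. top_wedge_power (form11 (H z)))"
proof -
  have "continuous_on S (\<lambda>z. form11 (H z) u v)" for u v
    unfolding form11_def
    by (intro continuous_on_Re continuous_on_mult continuous_on_sum continuous_on_const assms)
  then show ?thesis unfolding top_wedge_power_def
    by (intro continuous_on_divide continuous_on_sum continuous_on_mult continuous_on_prod continuous_on_const) simp_all
qed

lemma vol_density_continuous:
  assumes A: "complex_manifold A" and U: "(U, \<phi>) \<in> A"
    and L: "holomorphic_line_bundle A L" and R: "positive_hermitian_algebraic A L R"
  shows "continuous_on (\<phi> ` U) (\<lambda>z. vol_density L R (U, \<phi>) (inv_into U \<phi> z))"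
proof (rule continuous_at_imp_continuous_on[OF ballI])
  fix z0 assume "z0 \<in> \<phi> ` U"
  then obtain x0 where x0: "x0 \<in> U" "z0 = \<phi> x0" by auto
  define i where "i = idx L x0"
  have xi: "x0 \<in> lb_dom L i" unfolding i_def by (rule line_bundle_facts(6)[OF L])
  have h: "hermitian_algebraic A L R" using R by (simp add: positive_hermitian_algebraic_def)
  let ?S = "\<phi> ` (U \<inter> lb_dom L i)"
  let ?D = "{Z \<in> bidomain ?S ?S. polar U \<phi> R i Z \<noteq> 0}"
  have oS: "open ?S" by (rule open_chart_image[OF A U line_bundle_facts(1)[OF L]])
  have "cholo_on (polar U \<phi> R i) ?D"
    by (rule cholo_on_subset[OF polar_holo[OF A U h] open_nonzero_set[OF polar_holo[OF A U h]]]) auto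
  then have "continuous_on ?D (\<lambda>Z. log_hess (polar U \<phi> R i) Z $ j $ k)" for j k
    unfolding log_hess_def vec_lambda_beta
    by (intro cholo_on_continuous[OF cholo_on_pd[OF cholo_on_log_deriv]]) auto
  then have "continuous_on ?S (\<lambda>z. log_hess (polar U \<phi> R i) (diag z) $ j $ k)" for j k
  proof (rule continuous_on_compose2[OF _ continuous_on_diag])
    show "diag ` ?S \<subseteq> ?D"
    proof (intro subsetI)
      fix Z assume "Z \<in> diag ` ?S"
      then obtain y where y: "y \<in> U" "y \<in> lb_dom L i" "Z = diag (\<phi> y)" by blast
      have "polar U \<phi> R i Z \<noteq> 0"
        unfolding y(3) polar_diag[OF A U y(1)] using positive_diagonal(2)[OF L R y(2)] by auto
      moreover have "Z \<in> bidomain ?S ?S" using y by (auto simp: diag_bidomain)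
      ultimately show "Z \<in> ?D" by simp
    qed
  qed
  then have "continuous_on ?S (\<lambda>z. top_wedge_power (form11 (log_hess (polar U \<phi> R i) (diag z))) / fact CARD('b))"
    by (intro continuous_on_divide continuous_on_top_wedge_form11 continuous_on_const) simp_all
  then have "continuous_on ?S (\<lambda>z. vol_density L R (U, \<phi>) (inv_into U \<phi> z))"
    by (rule continuous_on_eq) (auto simp: chart_facts(6)[OF A U] vol_density_eq[OF A U L R, where i = i])
  then show "isCont (\<lambda>z. vol_density L R (U, \<phi>) (inv_into U \<phi> z)) z0"
    using oS x0 xi by (auto simp: continuous_on_eq_continuous_at)
qed

section \<open>Change of variables\<close>

text \<open>Real functions are viewed as maps to \<open>real^1\<close>; nonnegativity allows passing from absolute integrability to
  Lebesgue integrals with values in the extended reals.\<close>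

lemma nn_change_of_variables:
  fixes g :: "real^'m::{finite,wellorder} \<Rightarrow> real^'m::_" and F :: "real^'m::_ \<Rightarrow> real"
  assumes S: "S \<in> sets lebesgue" and D: "\<And>x. x \<in> S \<Longrightarrow> (g has_derivative g' x) (at x within S)"
    and inj: "inj_on g S" and F: "F absolutely_integrable_on g ` S" and nonneg: "\<And>x. x \<in> g ` S \<Longrightarrow> 0 \<le> F x"
  shows "(\<integral>\<^sup>+ x\<in>g ` S. ennreal (F x) \<partial>lborel) = (\<integral>\<^sup>+ x\<in>S. ennreal (\<bar>det (matrix (g' x))\<bar> * F (g x)) \<partial>lborel)"
proof -
  define f :: "real^'m::_ \<Rightarrow> real^1" where "f = (\<lambda>x. vec (F x))"
  have bl: "bounded_linear (vec :: real \<Rightarrow> real^1)"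
    by (intro linear_conv_bounded_linear[THEN iffD1] linearI) (auto simp: vec_eq_iff)
  have f: "f absolutely_integrable_on g ` S"
    using absolutely_integrable_linear[OF F bl] by (simp add: f_def o_def)
  define b where "b = integral (g ` S) f"
  have "(\<lambda>x. \<bar>det (matrix (g' x))\<bar> *\<^sub>R f (g x)) absolutely_integrable_on S \<and>
      integral S (\<lambda>x. \<bar>det (matrix (g' x))\<bar> *\<^sub>R f (g x)) = b"
    using has_absolute_integral_change_of_variables[OF S D inj, of f b] f by (simp add: b_def)
  then have "((\<lambda>x. \<bar>det (matrix (g' x))\<bar> *\<^sub>R f (g x)) has_integral b) S"
    using set_lebesgue_integral_eq_integral(1) integrable_integral by blast
  from has_integral_linear[OF this bounded_linear_vec_nth[of 1]]
  have 1: "((\<lambda>x. \<bar>det (matrix (g' x))\<bar> * F (g x)) has_integral b $ 1) S"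
    by (simp add: f_def o_def)
  have "(f has_integral b) (g ` S)"
    using f set_lebesgue_integral_eq_integral(1) integrable_integral unfolding b_def by blast
  from has_integral_linear[OF this bounded_linear_vec_nth[of 1]]
  have 2: "(F has_integral b $ 1) (g ` S)" by (simp add: f_def o_def)
  have "(\<integral>\<^sup>+ x\<in>g ` S. ennreal (F x) \<partial>lborel) = integral\<^sup>N lborel (\<lambda>x. indicator (g ` S) x * F x)"
    by (intro nn_integral_cong) (auto simp: indicator_def)
  also have "\<dots> = ennreal (b $ 1)" by (rule nn_integral_has_integral_lebesgue[OF nonneg 2])
  also have "\<dots> = integral\<^sup>N lborel (\<lambda>x. indicator S x * (\<bar>det (matrix (g' x))\<bar> * F (g x)))"
    by (rule nn_integral_has_integral_lebesgue[OF _ 1, symmetric]) (use nonneg in auto)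
  also have "\<dots> = (\<integral>\<^sup>+ x\<in>S. ennreal (\<bar>det (matrix (g' x))\<bar> * F (g x)) \<partial>lborel)"
    by (intro nn_integral_cong) (auto simp: indicator_def)
  finally show ?thesis .
qed

text \<open>Real coordinates on \<open>complex^'n\<close> are indexed by \<open>'n bit0\<close>: it has twice as many elements as \<open>'n\<close>
  and is well-ordered, as the formula above asks of an index type.\<close>

definition pair_index :: "'n::finite bit0 \<Rightarrow> 'n \<times> bool" where
  "pair_index = (SOME e. bij e)"

lemma bij_pair_index: "bij (pair_index :: 'n::finite bit0 \<Rightarrow> _)"
proof -
  have "\<exists>e::'n bit0 \<Rightarrow> 'n \<times> bool. bij e"
    by (rule finite_same_card_bij) (auto simp: card_UNIV_bool card_prod mult.commute)
  then show ?thesis unfolding pair_index_def by (rule someI_ex)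
qed

definition rcoord :: "complex^'n::finite \<Rightarrow> real ^ 'n bit0" where
  "rcoord z = (\<chi> q. real_coords z $ pair_index q)"

definition of_rcoord :: "real ^ 'n::finite bit0 \<Rightarrow> complex^'n" where
  "of_rcoord x = (\<Sum>q\<in>UNIV. (x $ q) *\<^sub>R real_basis (pair_index q))"

lemma of_rcoord_alt: "of_rcoord x = (\<Sum>p\<in>UNIV. ((\<chi> p. x $ inv pair_index p) $ p) *\<^sub>R real_basis p)"
  unfolding of_rcoord_def
  by (subst sum.reindex_bij_betw[OF bij_pair_index, symmetric])
    (simp add: inv_f_f bij_is_inj[OF bij_pair_index])

lemma rcoord_inverse [simp]: "rcoord (of_rcoord x) = x"
  unfolding of_rcoord_alt rcoord_def real_coords_inverse
  by (simp add: vec_eq_iff inv_f_f bij_is_inj[OF bij_pair_index])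

lemma of_rcoord_inverse [simp]: "of_rcoord (rcoord z) = z"
  unfolding of_rcoord_def rcoord_def vec_lambda_beta
  by (subst sum.reindex_bij_betw[OF bij_pair_index, of "\<lambda>p. real_coords z $ p *\<^sub>R real_basis p"])
    (rule real_coords_expansion[symmetric])

lemma linear_rcoord: "linear rcoord" and linear_of_rcoord: "linear of_rcoord"
  by (intro linearI; simp add: rcoord_def vec_eq_iff linear_add[OF linear_real_coords] linear_cmul[OF linear_real_coords])
    (intro linearI; simp add: of_rcoord_def scaleR_add_left sum.distrib scaleR_sum_right)

lemma bounded_linear_rcoord: "bounded_linear rcoord" and bounded_linear_of_rcoord: "bounded_linear of_rcoord"
  using linear_rcoord linear_of_rcoord by (auto simp: linear_conv_bounded_linear)

lemma continuous_on_rcoord: "continuous_on S rcoord" and continuous_on_of_rcoord: "continuous_on T of_rcoord"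
  by (simp_all add: linear_continuous_on bounded_linear_rcoord bounded_linear_of_rcoord)

lemma det_reindex:
  fixes M :: "real^'b::finite^'b" and e :: "'a::finite \<Rightarrow> 'b"
  assumes e: "bij e"
  shows "det (\<chi> i j. M $ e i $ e j) = det M"
proof -
  have inj: "inj e" and surj: "e ` UNIV = UNIV" using e by (auto simp: bij_def)
  have mp: "map_permutation UNIV e \<sigma> (e i) = e (\<sigma> i)" for \<sigma> i
    using inj by (simp add: map_permutation_def restrict_id_def surj inv_f_f)
  have bij: "bij_betw (map_permutation UNIV e) {\<sigma>. \<sigma> permutes UNIV} {\<sigma>. \<sigma> permutes UNIV}"
    using bij_betw_permutations[OF e] by (simp add: map_permutation_def[abs_def] surj restrict_id_def o_def)
  have "det M = (\<Sum>\<sigma>\<in>{\<sigma>. \<sigma> permutes UNIV}. of_int (sign (map_permutation UNIV e \<sigma>)) * (\<Prod>i\<in>UNIV. M $ i $ map_permutation UNIV e \<sigma> i))"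
    unfolding det_def by (rule sum.reindex_bij_betw[OF bij, symmetric])
  also have "\<dots> = (\<Sum>\<sigma>\<in>{\<sigma>. \<sigma> permutes UNIV}. of_int (sign \<sigma>) * (\<Prod>i\<in>UNIV. M $ e i $ e (\<sigma> i)))"
  proof (intro sum.cong refl)
    fix \<sigma> :: "'a \<Rightarrow> 'a" assume "\<sigma> \<in> {\<sigma>. \<sigma> permutes UNIV}"
    then have s: "sign (map_permutation UNIV e \<sigma>) = sign \<sigma>" using sign_map_permutation[OF inj] by auto
    have "(\<Prod>i\<in>UNIV. M $ i $ map_permutation UNIV e \<sigma> i) = (\<Prod>i\<in>UNIV. M $ e i $ map_permutation UNIV e \<sigma> (e i))"
      by (rule prod.reindex_bij_betw[OF e, symmetric])
    then show "of_int (sign (map_permutation UNIV e \<sigma>)) * (\<Prod>i\<in>UNIV. M $ i $ map_permutation UNIV e \<sigma> i)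
      = of_int (sign \<sigma>) * (\<Prod>i\<in>UNIV. M $ e i $ e (\<sigma> i))" by (simp add: s mp)
  qed
  finally show ?thesis by (simp add: det_def)
qed

lemma det_matrix_rcoord:
  fixes D :: "complex^'n::finite \<Rightarrow> complex^'n"
  shows "det (matrix (\<lambda>x. rcoord (D (of_rcoord x)))) = det (\<chi> p. real_coords (D (real_basis p)))"
proof -
  have ax: "of_rcoord (axis q 1) = real_basis (pair_index q)" for q :: "'n bit0"
    unfolding of_rcoord_def by (simp add: axis_def if_distrib[of "\<lambda>x. x *\<^sub>R _"] cong: if_cong)
  have m: "matrix (\<lambda>x. rcoord (D (of_rcoord x)))
      = transpose (\<chi> p q. (\<chi> p. real_coords (D (real_basis p))) $ pair_index p $ pair_index q)"
    unfolding matrix_def ax by (simp add: vec_eq_iff transpose_def rcoord_def)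
  show ?thesis unfolding m det_transpose det_reindex[OF bij_pair_index] ..
qed

text \<open>The coordinates are taken in an orthonormal basis and thus map boxes to boxes of the same volume.\<close>

lemma lborel_of_rcoord: "distr lborel borel of_rcoord = (lborel :: (complex^'n::finite) measure)"
proof (rule lborel_eqI[symmetric])
  have m: "of_rcoord \<in> borel_measurable (borel :: (real^'n bit0) measure)"
    by (intro borel_measurable_continuous_onI continuous_on_of_rcoord)
  have inner: "z \<bullet> real_basis p = real_coords z $ p" for z :: "complex^'n" and p
    by (cases p) (simp add: real_basis_def real_coords_def inner_axis inner_complex_def)
  have Basis: "bij_betw (real_basis \<circ> pair_index) (UNIV :: 'n bit0 set) (Basis :: (complex^'n) set)"
  proof -
    have "bij_betw real_basis UNIV (Basis :: (complex^'n) set)"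
    proof (rule bij_betwI')
      fix p q :: "'n \<times> bool" show "(real_basis p = (real_basis q :: complex^'n)) = (p = q)"
        by (cases p; cases q) (auto simp: real_basis_def axis_eq_axis)
    next
      fix p :: "'n \<times> bool" show "real_basis p \<in> (Basis :: (complex^'n) set)"
        by (cases p) (auto simp: real_basis_def Basis_vec_def Basis_complex_def)
    next
      fix b :: "complex^'n" assume "b \<in> Basis"
      then obtain j c where "b = axis j c" "c = 1 \<or> c = \<i>" by (auto simp: Basis_vec_def Basis_complex_def)
      then show "\<exists>p\<in>UNIV. b = real_basis p" by (intro bexI[of _ "(j, c = \<i>)"]) (auto simp: real_basis_def)
    qed
    then show ?thesis by (rule bij_betw_trans[OF bij_pair_index])
  qed
  have inner': "z \<bullet> (real_basis \<circ> pair_index) q = rcoord z $ q" for z :: "complex^'n" and q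
    by (simp add: inner rcoord_def)
  fix l u :: "complex^'n" assume lu: "\<And>b. b \<in> Basis \<Longrightarrow> l \<bullet> b \<le> u \<bullet> b"
  have "box l u = {z. \<forall>q. rcoord l $ q < rcoord z $ q \<and> rcoord z $ q < rcoord u $ q}"
    unfolding box_def bij_betw_imp_surj_on[OF Basis, symmetric] by (simp add: inner'[unfolded o_def])
  then have "of_rcoord -` box l u = box (rcoord l) (rcoord u)"
    by (auto simp: mem_box_cart)
  then have "emeasure (distr lborel borel of_rcoord) (box l u) = emeasure lborel (box (rcoord l) (rcoord u))"
    using m by (subst emeasure_distr) auto
  also have "\<dots> = (\<Prod>b\<in>Basis. (rcoord u - rcoord l) \<bullet> b)"
  proof (rule emeasure_lborel_box)
    fix b :: "real^'n bit0" assume "b \<in> Basis"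
    then obtain q where "b = axis q 1" by (auto simp: Basis_vec_def)
    moreover have "l \<bullet> (real_basis \<circ> pair_index) q \<le> u \<bullet> (real_basis \<circ> pair_index) q"
      by (rule lu) (use bij_betw_imp_surj_on[OF Basis] in auto)
    ultimately show "rcoord l \<bullet> b \<le> rcoord u \<bullet> b" unfolding inner' by (simp add: inner_axis)
  qed
  also have "(\<Prod>b\<in>Basis. (rcoord u - rcoord l) \<bullet> b) = (\<Prod>q\<in>UNIV. (rcoord u - rcoord l) $ q)"
  proof -
    have "bij_betw (\<lambda>q. axis q 1) (UNIV :: 'n bit0 set) (Basis :: (real^'n bit0) set)"
      by (auto simp: bij_betw_def inj_on_def axis_eq_axis Basis_vec_def)
    then have "(\<Prod>b\<in>Basis. (rcoord u - rcoord l) \<bullet> b) = (\<Prod>q\<in>UNIV. (rcoord u - rcoord l) \<bullet> axis q 1)"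
      by (rule prod.reindex_bij_betw[symmetric])
    then show ?thesis by (simp add: inner_axis)
  qed
  also have "\<dots> = (\<Prod>b\<in>Basis. (u - l) \<bullet> b)"
  proof -
    have "(\<Prod>b\<in>Basis. (u - l) \<bullet> b) = (\<Prod>q\<in>UNIV. (u - l) \<bullet> (real_basis \<circ> pair_index) q)"
      by (rule prod.reindex_bij_betw[OF Basis, symmetric])
    then show ?thesis unfolding inner' by (simp add: linear_diff[OF linear_rcoord])
  qed
  finally show "emeasure (distr lborel borel of_rcoord) (box l u) = (\<Prod>b\<in>Basis. (u - l) \<bullet> b)" .
qed simp

lemma nn_integral_rcoord:
  fixes h :: "complex^'n::finite \<Rightarrow> ennreal"
  assumes "(\<lambda>z. h z * indicator B z) \<in> borel_measurable borel"
  shows "(\<integral>\<^sup>+ z\<in>B. h z \<partial>lborel) = (\<integral>\<^sup>+ x\<in>rcoord ` B. h (of_rcoord x) \<partial>lborel)"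
proof -
  have m: "of_rcoord \<in> measurable lborel (borel :: (complex^'n) measure)"
    by (simp add: borel_measurable_continuous_onI continuous_on_of_rcoord)
  have "(\<integral>\<^sup>+ z\<in>B. h z \<partial>lborel) = (\<integral>\<^sup>+ z\<in>B. h z \<partial>distr lborel borel of_rcoord)"
    by (simp add: lborel_of_rcoord)
  also have "\<dots> = (\<integral>\<^sup>+ x. h (of_rcoord x) * indicator B (of_rcoord x) \<partial>lborel)"
    using nn_integral_distr[OF m, of "\<lambda>z. h z * indicator B z"] assms by simp
  also have "\<dots> = (\<integral>\<^sup>+ x\<in>rcoord ` B. h (of_rcoord x) \<partial>lborel)"
  proof (intro nn_integral_cong)
    fix x
    have "of_rcoord x \<in> B \<longleftrightarrow> x \<in> rcoord ` B" by (metis image_iff of_rcoord_inverse rcoord_inverse)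
    then show "h (of_rcoord x) * indicator B (of_rcoord x) = h (of_rcoord x) * indicator (rcoord ` B) x"
      by (simp add: indicator_def)
  qed
  finally show ?thesis .
qed

lemma borel_measurable_ennreal_indicator:
  fixes f :: "'a::topological_space \<Rightarrow> real"
  assumes "continuous_on O' f" "B \<in> sets borel" "B \<subseteq> O'"
  shows "(\<lambda>z. ennreal (f z) * indicator B z) \<in> borel_measurable borel"
proof -
  have "(\<lambda>z. indicator B z *\<^sub>R f z) \<in> borel_measurable borel"
    by (rule borel_measurable_continuous_on_indicator[OF assms(2) continuous_on_subset[OF assms(1,3)]])
  then have "(\<lambda>z. ennreal (indicator B z *\<^sub>R f z)) \<in> borel_measurable borel" by measurable
  moreover have "ennreal (indicator B z *\<^sub>R f z) = ennreal (f z) * indicator B z" for z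
    by (simp add: indicator_def)
  ultimately show ?thesis by simp
qed

lemma homeomorphic_image_borel:
  assumes h: "homeomorphism O' O'' T T'" and op: "open O''" and B: "B \<in> sets borel" "B \<subseteq> O'"
  shows "T ` B \<in> sets borel"
proof -
  have "T ` B = T' -` B \<inter> O''"
    using h B(2) by (auto simp: homeomorphism_def)
  moreover have "T' -` B \<inter> space (restrict_space borel O'') \<in> sets (restrict_space borel O'')"
    using homeomorphism_cont2[OF h] B(1) borel_measurable_continuous_on_restrict[of O'' T'] measurable_sets by blast
  ultimately show ?thesis using op by (auto simp: sets_restrict_space space_restrict_space)
qed

text \<open>Inside a compact set both integrals are finite.  Positivity of the two densities forces the Jacobian
  determinant to be positive, so no absolute value appears in the relation between them.\<close>

lemma change_of_variables_compact_piece: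
  fixes T :: "complex^'n::finite \<Rightarrow> complex^'n"
  assumes h: "homeomorphism O' O'' T T'" and op: "open O'" "open O''"
    and D: "\<And>z. z \<in> O' \<Longrightarrow> (T has_derivative D z) (at z)"
    and \<rho>': "continuous_on O'' \<rho>'" "\<And>w. w \<in> O'' \<Longrightarrow> 0 < \<rho>' w"
    and \<rho>: "continuous_on O' \<rho>" "\<And>z. z \<in> O' \<Longrightarrow> 0 < \<rho> z"
    and eq: "\<And>z. z \<in> O' \<Longrightarrow> \<rho> z = det (\<chi> p. real_coords (D z (real_basis p))) * \<rho>' (T z)"
    and B: "B \<in> sets borel" "B \<subseteq> K" "compact K" "K \<subseteq> O'"
  shows "(\<integral>\<^sup>+ w\<in>T ` B. ennreal (\<rho>' w) \<partial>lborel) = (\<integral>\<^sup>+ z\<in>B. ennreal (\<rho> z) \<partial>lborel)"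
proof -
  have BO: "B \<subseteq> O'" using B by auto
  have TB: "T ` B \<in> sets borel" "T ` B \<subseteq> O''"
    using homeomorphic_image_borel[OF h op(2) B(1) BO] BO homeomorphism_image1[OF h] by auto
  define g where "g = (\<lambda>x. rcoord (T (of_rcoord x)))"
  define g' where "g' = (\<lambda>x y. rcoord (D (of_rcoord x) (of_rcoord y)))"
  define F where "F = (\<lambda>x. \<rho>' (of_rcoord x))"
  let ?S = "rcoord ` B"
  have gS: "g ` ?S = rcoord ` (T ` B)" by (auto simp: g_def image_iff)
  have hr: "homeomorphism UNIV UNIV rcoord of_rcoord" "homeomorphism UNIV UNIV of_rcoord rcoord"
    by (auto simp: homeomorphism_def continuous_on_rcoord continuous_on_of_rcoord image_iff intro: sym[OF rcoord_inverse] sym[OF of_rcoord_inverse])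
  have S: "?S \<in> sets borel" "g ` ?S \<in> sets borel"
    unfolding gS using homeomorphic_image_borel[OF hr(1) open_UNIV] B(1) TB(1) by auto
  have F_cont: "continuous_on (rcoord ` T ` K) F"
    unfolding F_def by (rule continuous_on_compose2[OF \<rho>'(1) continuous_on_of_rcoord])
      (use B(4) homeomorphism_image1[OF h] in auto)
  have comp: "compact (rcoord ` T ` K)"
    by (intro compact_continuous_image continuous_on_rcoord B(3) continuous_on_subset[OF homeomorphism_cont1[OF h] B(4)])
  have "set_integrable lborel (rcoord ` T ` K) F"
    using borel_integrable_compact[OF comp F_cont] by (simp add: set_integrable_def)
  then have "set_integrable lborel (g ` ?S) F"
    by (rule set_integrable_subset) (use S B(2) gS in auto)
  then have F: "F absolutely_integrable_on g ` ?S"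
    unfolding set_integrable_def by (subst integrable_completion) (auto dest: borel_measurable_integrable)
  have inj: "inj_on g ?S"
    using homeomorphism_apply1[OF h] BO unfolding g_def
    by (intro inj_onI) (metis imageE of_rcoord_inverse subsetD)
  have det: "\<bar>det (matrix (g' x))\<bar> * F (g x) = \<rho> (of_rcoord x)" if "x \<in> ?S" for x
  proof -
    have z: "of_rcoord x \<in> O'" using that BO by auto
    then have "T (of_rcoord x) \<in> O''" using homeomorphism_image1[OF h] by auto
    then have "0 < det (\<chi> p. real_coords (D (of_rcoord x) (real_basis p)))"
      using eq[OF z] \<rho>(2)[OF z] \<rho>'(2) by (metis zero_less_mult_pos2)
    then show ?thesis unfolding g'_def det_matrix_rcoord F_def g_def eq[OF z] by simp
  qed
  have "(\<integral>\<^sup>+ w\<in>T ` B. ennreal (\<rho>' w) \<partial>lborel) = (\<integral>\<^sup>+ x\<in>g ` ?S. ennreal (F x) \<partial>lborel)"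
    unfolding gS F_def by (rule nn_integral_rcoord[OF borel_measurable_ennreal_indicator[OF \<rho>'(1) TB]])
  also have "\<dots> = (\<integral>\<^sup>+ x\<in>?S. ennreal (\<bar>det (matrix (g' x))\<bar> * F (g x)) \<partial>lborel)"
  proof (rule nn_change_of_variables[OF _ _ inj F])
    show "(g has_derivative g' x) (at x within ?S)" if "x \<in> ?S" for x
    proof (rule has_derivative_at_withinI)
      have z: "of_rcoord x \<in> O'" using that BO by auto
      have "((\<lambda>x. T (of_rcoord x)) has_derivative (\<lambda>y. D (of_rcoord x) (of_rcoord y))) (at x)"
        by (rule has_derivative_compose[OF bounded_linear_imp_has_derivative[OF bounded_linear_of_rcoord] D[OF z]])
      then show "(g has_derivative g' x) (at x)" unfolding g_def g'_def
        by (rule has_derivative_compose[OF _ bounded_linear_imp_has_derivative[OF bounded_linear_rcoord]])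
    qed
    show "0 \<le> F x" if "x \<in> g ` ?S" for x
      using that \<rho>'(2) TB(2) unfolding gS F_def by (auto intro!: less_imp_le)
  qed (use S in auto)
  also have "\<dots> = (\<integral>\<^sup>+ x\<in>?S. ennreal (\<rho> (of_rcoord x)) \<partial>lborel)"
    by (intro nn_integral_cong) (use det in \<open>auto simp: indicator_def\<close>)
  also have "\<dots> = (\<integral>\<^sup>+ z\<in>B. ennreal (\<rho> z) \<partial>lborel)"
    by (rule nn_integral_rcoord[OF borel_measurable_ennreal_indicator[OF \<rho>(1) B(1) BO], symmetric])
  finally show ?thesis .
qed

text \<open>Exhaustion of the open set by compact subsets.\<close>

lemma change_of_variables_complex:
  fixes T :: "complex^'n::finite \<Rightarrow> complex^'n"
  assumes h: "homeomorphism O' O'' T T'" and op: "open O'" "open O''"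
    and D: "\<And>z. z \<in> O' \<Longrightarrow> (T has_derivative D z) (at z)"
    and \<rho>': "continuous_on O'' \<rho>'" "\<And>w. w \<in> O'' \<Longrightarrow> 0 < \<rho>' w"
    and \<rho>: "continuous_on O' \<rho>" "\<And>z. z \<in> O' \<Longrightarrow> 0 < \<rho> z"
    and eq: "\<And>z. z \<in> O' \<Longrightarrow> \<rho> z = det (\<chi> p. real_coords (D z (real_basis p))) * \<rho>' (T z)"
    and B: "B \<in> sets borel" "B \<subseteq> O'"
  shows "(\<integral>\<^sup>+ w\<in>T ` B. ennreal (\<rho>' w) \<partial>lborel) = (\<integral>\<^sup>+ z\<in>B. ennreal (\<rho> z) \<partial>lborel)"
proof -
  obtain C where C: "\<And>n. compact (C n)" "\<And>n. C n \<subseteq> O'" "\<And>n. C n \<subseteq> interior (C (Suc n))" "\<Union>(range C) = O'"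
    using open_Union_compact_subsets[OF op(1)] by metis
  have incC: "incseq C" using C(3) interior_subset by (intro incseq_SucI) blast
  define M where "M = density lborel (\<lambda>z. ennreal (\<rho> z) * indicator O' z)"
  define N where "N = density lborel (\<lambda>w. ennreal (\<rho>' w) * indicator O'' w)"
  have M: "emeasure M A = (\<integral>\<^sup>+ z\<in>A. ennreal (\<rho> z) \<partial>lborel)" if "A \<in> sets borel" "A \<subseteq> O'" for A
    unfolding M_def using that op(1) borel_measurable_ennreal_indicator[OF \<rho>(1), of O']
    by (subst emeasure_density) (auto intro!: nn_integral_cong simp: indicator_def)
  have N: "emeasure N A = (\<integral>\<^sup>+ w\<in>A. ennreal (\<rho>' w) \<partial>lborel)" if "A \<in> sets borel" "A \<subseteq> O''" for A
    unfolding N_def using that op(2) borel_measurable_ennreal_indicator[OF \<rho>'(1), of O'']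
    by (subst emeasure_density) (auto intro!: nn_integral_cong simp: indicator_def)
  have BC: "B \<inter> C n \<in> sets borel" "B \<inter> C n \<subseteq> O'" for n
    using sets.Int[OF B(1) borel_closed[OF compact_imp_closed[OF C(1)]]] B(2) by auto
  have mono: "B \<inter> C m \<subseteq> B \<inter> C n" if "m \<le> n" for m n using incseqD[OF incC that] by blast
  have img: "T ` A \<in> sets borel" "T ` A \<subseteq> O''" if "A \<in> sets borel" "A \<subseteq> O'" for A
    using homeomorphic_image_borel[OF h op(2) that] that(2) homeomorphism_image1[OF h] by auto
  have B_eq: "B = (\<Union>n. B \<inter> C n)" using B(2) C(4) by auto
  have TB_eq: "T ` B = (\<Union>n. T ` (B \<inter> C n))" by (subst B_eq) (rule image_UN)
  have "(\<integral>\<^sup>+ z\<in>B. ennreal (\<rho> z) \<partial>lborel) = emeasure M (\<Union>n. B \<inter> C n)"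
    using M[OF B] B_eq by simp
  also have "\<dots> = (SUP n. emeasure M (B \<inter> C n))"
    by (rule SUP_emeasure_incseq[symmetric]) (use BC mono in \<open>simp_all add: M_def incseq_def image_subset_iff\<close>)
  also have "\<dots> = (SUP n. emeasure N (T ` (B \<inter> C n)))"
  proof (rule SUP_cong[OF refl])
    fix n
    show "emeasure M (B \<inter> C n) = emeasure N (T ` (B \<inter> C n))"
      unfolding M[OF BC] N[OF img[OF BC]]
      by (rule change_of_variables_compact_piece[OF h op D \<rho>' \<rho> eq BC(1) _ C(1,2), symmetric]) auto
  qed
  also have "\<dots> = emeasure N (\<Union>n. T ` (B \<inter> C n))"
    by (rule SUP_emeasure_incseq) (use img[OF BC] image_mono[OF mono, of _ _ T] in \<open>simp_all add: N_def incseq_def image_subset_iff del: image_mono\<close>)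
  also have "\<dots> = (\<integral>\<^sup>+ w\<in>T ` B. ennreal (\<rho>' w) \<partial>lborel)"
    using N[OF img[OF B]] TB_eq by simp
  finally show ?thesis by simp
qed

section \<open>The volume measure\<close>

locale polarized_manifold =
  fixes A :: "('x::{t2_space,second_countable_topology}, 'n::finite) chart set"
    and L :: "('x, 'i) line_bundle" and R :: "('x, 'i) herm_fun"
  assumes A: "complex_manifold A" and compact_X: "compact (UNIV :: 'x set)"
    and L: "holomorphic_line_bundle A L" and R: "positive_hermitian_algebraic A L R"
    and SGCS: "SGCS A L R"
begin

definition chart_mass :: "('x, 'n) chart \<Rightarrow> 'x set \<Rightarrow> ennreal" where
  "chart_mass c B = (\<integral>\<^sup>+ z\<in>snd c ` B. ennreal (vol_density L R c (inv_into (fst c) (snd c) z)) \<partial>lborel)"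

lemma chart_homeomorphism:
  assumes "(U, \<phi>) \<in> A"
  shows "homeomorphism U (\<phi> ` U) \<phi> (inv_into U \<phi>)"
  using chart_facts[OF A assms] by (auto simp: homeomorphism_def)

lemma chart_image_borel:
  assumes "(U, \<phi>) \<in> A" "B \<in> sets borel" "B \<subseteq> U"
  shows "\<phi> ` B \<in> sets borel"
  by (rule homeomorphic_image_borel[OF chart_homeomorphism[OF assms(1)] chart_facts(2)[OF A assms(1)] assms(2,3)])

lemma chart_mass_independent:
  assumes U: "(U, \<phi>) \<in> A" and V: "(V, \<psi>) \<in> A" and B: "B \<in> sets borel" "B \<subseteq> U" "B \<subseteq> V"
  shows "chart_mass (V, \<psi>) B = chart_mass (U, \<phi>) B"
proof -
  define T where "T = (\<lambda>z. \<psi> (inv_into U \<phi> z))"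
  define T' where "T' = (\<lambda>w. \<phi> (inv_into V \<psi> w))"
  note c = chart_facts[OF A U] and d = chart_facts[OF A V]
  let ?O = "\<phi> ` (U \<inter> V)" and ?O' = "\<psi> ` (U \<inter> V)"
  have o1: "open ?O" using open_chart_image[OF A U d(1)] .
  have o2: "open ?O'" using open_chart_image[OF A V c(1)] by (simp add: Int_commute)
  have h: "homeomorphism ?O ?O' T T'"
  proof (rule homeomorphismI)
    show "continuous_on ?O T" unfolding T_def
      by (rule continuous_on_compose2[OF d(4) continuous_on_subset[OF c(5)]]) (use c(6) in auto)
    show "continuous_on ?O' T'" unfolding T'_def
      by (rule continuous_on_compose2[OF c(4) continuous_on_subset[OF d(5)]]) (use d(6) in auto)
  qed (use c(6) d(6) in \<open>auto simp: T_def T'_def\<close>)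
  have img: "T ` \<phi> ` B = \<psi> ` B" using B c(6) by (auto simp: T_def image_iff subset_iff)
  have "(\<integral>\<^sup>+ w\<in>T ` \<phi> ` B. ennreal (vol_density L R (V, \<psi>) (inv_into V \<psi> w)) \<partial>lborel)
      = (\<integral>\<^sup>+ z\<in>\<phi> ` B. ennreal (vol_density L R (U, \<phi>) (inv_into U \<phi> z)) \<partial>lborel)"
  proof (rule change_of_variables_complex[OF h o1 o2])
    show "(T has_derivative (*v) (jacobian T z)) (at z)" if "z \<in> ?O" for z
      unfolding T_def by (rule transition_has_derivative[OF A U V that])
    show "continuous_on ?O' (\<lambda>w. vol_density L R (V, \<psi>) (inv_into V \<psi> w))"
      by (rule continuous_on_subset[OF vol_density_continuous[OF A V L R]]) auto
    show "continuous_on ?O (\<lambda>z. vol_density L R (U, \<phi>) (inv_into U \<phi> z))"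
      by (rule continuous_on_subset[OF vol_density_continuous[OF A U L R]]) auto
    show "0 < vol_density L R (V, \<psi>) (inv_into V \<psi> w)" if "w \<in> ?O'" for w
      using that by (intro vol_density_pos[OF A V L R SGCS]) (auto simp: d(6))
    show "0 < vol_density L R (U, \<phi>) (inv_into U \<phi> z)" if "z \<in> ?O" for z
      using that by (intro vol_density_pos[OF A U L R SGCS]) (auto simp: c(6))
    show "vol_density L R (U, \<phi>) (inv_into U \<phi> z) =
        det (\<chi> p. real_coords (jacobian T z *v real_basis p)) * vol_density L R (V, \<psi>) (inv_into V \<psi> (T z))"
      if z: "z \<in> ?O" for z
    proof -
      obtain x where x: "x \<in> U" "x \<in> V" "z = \<phi> x" using z by auto
      show ?thesis unfolding T_def x(3) c(6)[OF x(1)] d(6)[OF x(2)]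
        by (rule vol_density_transform[OF A U V L R x(1,2)])
    qed
  qed (use chart_image_borel[OF U B(1,2)] B in auto)
  then show ?thesis unfolding img by (simp add: chart_mass_def)
qed

lemma chart_mass_suminf:
  assumes c: "c \<in> A" and B: "\<And>i::nat. B i \<in> sets borel" "\<And>i. B i \<subseteq> fst c" "disjoint_family B"
  shows "(\<Sum>i. chart_mass c (B i)) = chart_mass c (\<Union>i. B i)"
proof -
  obtain U \<phi> where U: "c = (U, \<phi>)" by fastforce
  note U' = c[unfolded U] and sub = B(2)[unfolded U fst_conv]
  let ?\<rho> = "\<lambda>z. vol_density L R (U, \<phi>) (inv_into U \<phi> z)"
  define M where "M = density lborel (\<lambda>z. ennreal (?\<rho> z) * indicator (\<phi> ` U) z)"
  have M: "chart_mass c B = emeasure M (\<phi> ` B)" if "B \<in> sets borel" "B \<subseteq> U" for B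
    unfolding M_def chart_mass_def U fst_conv snd_conv
  proof (subst emeasure_density)
    show "\<phi> ` B \<in> sets lborel" using chart_image_borel[OF U' that] by simp
    show "(\<lambda>z. ennreal (?\<rho> z) * indicator (\<phi> ` U) z) \<in> borel_measurable lborel"
      using borel_measurable_ennreal_indicator[OF vol_density_continuous[OF A U' L R] borel_open[OF chart_facts(2)[OF A U']]]
      by simp
    have "indicator (\<phi> ` U) z * indicator (\<phi> ` B) z = (indicator (\<phi> ` B) z :: ennreal)" for z
      by (cases "z \<in> \<phi> ` B") (simp_all add: subsetD[OF image_mono[OF that(2)]])
    then show "(\<integral>\<^sup>+ z\<in>\<phi> ` B. ennreal (?\<rho> z) \<partial>lborel) = (\<integral>\<^sup>+ z\<in>\<phi> ` B. (ennreal (?\<rho> z) * indicator (\<phi> ` U) z) \<partial>lborel)"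
      by (simp add: mult.assoc)
  qed
  have img: "\<phi> ` B i \<in> sets borel" for i by (rule chart_image_borel[OF U' B(1) sub])
  have "disjoint_family (\<lambda>i. \<phi> ` B i)"
    using B(3) chart_facts(3)[OF A U'] sub unfolding disjoint_family_on_def
    by (metis (no_types, lifting) image_is_empty inj_on_image_Int)
  then have "(\<Sum>i. emeasure M (\<phi> ` B i)) = emeasure M (\<Union>i. \<phi> ` B i)"
    by (intro suminf_emeasure) (use img in \<open>auto simp: M_def\<close>)
  moreover have "chart_mass c (\<Union>i. B i) = emeasure M (\<Union>i. \<phi> ` B i)"
    using M[of "\<Union>i. B i"] B(1) sub by (simp add: image_UN UN_least)
  ultimately show ?thesis by (simp add: M[OF B(1) sub])
qed

text \<open>Countably many chart domains cover the manifold, by the Lindeloef property; each is reduced by its predecessors.\<close>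

lemma chart_partition_exists: "\<exists>D. chart_partition A D"
proof -
  have cover: "\<Union>(fst ` A) = UNIV" using A by (simp add: complex_manifold_def)
  have op: "open S" if "S \<in> fst ` A" for S using that chart_facts(1)[OF A] by auto
  obtain F where F: "F \<subseteq> fst ` A" "countable F" "\<Union>F = \<Union>(fst ` A)"
    using Lindelof[of "fst ` A"] op by metis
  have "F \<noteq> {}" using F(3) cover by auto
  then have rF: "range (from_nat_into F) = F" by (rule range_from_nat_into[OF _ F(2)])
  have "\<exists>c. \<forall>k. c k \<in> A \<and> fst (c k) = from_nat_into F k"
  proof (intro choice allI)
    fix k have "from_nat_into F k \<in> fst ` A" using rF F(1) by auto
    then show "\<exists>c. c \<in> A \<and> fst c = from_nat_into F k" by auto
  qed
  then obtain c where c: "\<And>k. c k \<in> A" "\<And>k. fst (c k) = from_nat_into F k" by metis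
  have ob: "fst (c k) \<in> sets borel" for k using op c(1) by auto
  have "chart_partition A (\<lambda>k. (disjointed (\<lambda>k. fst (c k)) k, c k))"
    unfolding chart_partition_def
  proof (intro conjI allI)
    fix k
    show "snd (disjointed (\<lambda>k. fst (c k)) k, c k) \<in> A" using c(1) by simp
    show "fst (disjointed (\<lambda>k. fst (c k)) k, c k) \<in> sets borel"
      using sets.range_disjointed_sets[of "\<lambda>k. fst (c k)" borel] ob by auto
    show "fst (disjointed (\<lambda>k. fst (c k)) k, c k) \<subseteq> fst (snd (disjointed (\<lambda>k. fst (c k)) k, c k))"
      using disjointed_subset[of "\<lambda>k. fst (c k)" k] by simp
    show "disjoint_family (\<lambda>k. fst (disjointed (\<lambda>k. fst (c k)) k, c k))"
      by (simp add: disjoint_family_disjointed)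
    show "(\<Union>k. fst (disjointed (\<lambda>k. fst (c k)) k, c k)) = UNIV"
      using rF F(3) cover by (simp add: UN_disjointed_eq c(2))
  qed
  then show ?thesis by blast
qed

abbreviation \<Omega> :: "'x measure" where "\<Omega> \<equiv> volume_measure A L R"

lemma suminf_swap_ennreal: "(\<Sum>i::nat. \<Sum>k::nat. f i k) = (\<Sum>k. \<Sum>i. f i k)" for f :: "nat \<Rightarrow> nat \<Rightarrow> ennreal"
proof -
  have "(\<Sum>k. \<Sum>i. f i k) = (\<integral>\<^sup>+ k. (\<Sum>i. f i k) \<partial>count_space UNIV)"
    by (simp add: nn_integral_count_space_nat)
  also have "\<dots> = (\<Sum>i. \<integral>\<^sup>+ k. f i k \<partial>count_space UNIV)" by (rule nn_integral_suminf) simp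
  finally show ?thesis by (simp add: nn_integral_count_space_nat)
qed

lemma space_sets_volume_measure: "space \<Omega> = UNIV" "sets \<Omega> = sets borel"
proof -
  show "space \<Omega> = UNIV" unfolding volume_measure_def Let_def
    by (rule space_measure_of) simp
  show "sets \<Omega> = sets borel" unfolding volume_measure_def Let_def
    using sets.sigma_sets_eq[of borel] by simp
qed

text \<open>\<open>measure_of\<close> yields the intended values only if the given set function is countably additive.  It is, because each piece
  of the partition contributes a measure with a density.\<close>

lemma emeasure_volume_measure_partition:
  obtains D where "chart_partition A D"
    and "\<And>B. B \<in> sets borel \<Longrightarrow> emeasure \<Omega> B = (\<Sum>k. chart_mass (snd (D k)) (B \<inter> fst (D k)))"
proof -
  define D where "D = (SOME D. chart_partition A D)"
  have D: "chart_partition A D" unfolding D_def by (rule someI_ex[OF chart_partition_exists])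
  have Dk: "snd (D k) \<in> A" "fst (D k) \<in> sets borel" "fst (D k) \<subseteq> fst (snd (D k))" for k
    using D unfolding chart_partition_def by blast+
  define \<mu> where "\<mu> = (\<lambda>B. \<Sum>k. chart_mass (snd (D k)) (B \<inter> fst (D k)))"
  have \<Omega>_eq: "\<Omega> = measure_of UNIV (sets borel) \<mu>"
    unfolding volume_measure_def Let_def D_def[symmetric] \<mu>_def chart_mass_def
    by (intro arg_cong[of _ _ "measure_of UNIV (sets borel)"] ext suminf_cong) (simp add: case_prod_unfold)
  have "emeasure \<Omega> B = \<mu> B" if "B \<in> sets borel" for B
    unfolding \<Omega>_eq
  proof (rule emeasure_measure_of_sigma[OF _ _ _ that])
    show "sigma_algebra UNIV (sets (borel :: 'x measure))" by (metis sets.sigma_algebra_axioms space_borel)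
    show "positive (sets borel) \<mu>" by (simp add: positive_def \<mu>_def chart_mass_def)
    show "countably_additive (sets borel) \<mu>"
    proof (rule countably_additiveI)
      fix B :: "nat \<Rightarrow> 'x set" assume B: "range B \<subseteq> sets borel" "disjoint_family B"
      have "(\<Sum>i. \<mu> (B i)) = (\<Sum>k. \<Sum>i. chart_mass (snd (D k)) (B i \<inter> fst (D k)))"
        unfolding \<mu>_def by (rule suminf_swap_ennreal)
      also have "\<dots> = \<mu> (\<Union>i. B i)" unfolding \<mu>_def
      proof (rule suminf_cong)
        fix k
        have "(\<Sum>i. chart_mass (snd (D k)) (B i \<inter> fst (D k))) = chart_mass (snd (D k)) (\<Union>i. B i \<inter> fst (D k))"
          by (rule chart_mass_suminf) (use B Dk[of k] in \<open>auto simp: disjoint_family_on_def\<close>)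
        then show "(\<Sum>i. chart_mass (snd (D k)) (B i \<inter> fst (D k))) = chart_mass (snd (D k)) (\<Union> (range B) \<inter> fst (D k))"
          by simp
      qed
      finally show "(\<Sum>i. \<mu> (B i)) = \<mu> (\<Union>i. B i)" .
    qed
  qed
  then show ?thesis using that D unfolding \<mu>_def by blast
qed

text \<open>On each piece of the chosen partition the chart may be exchanged for \<open>\<phi>\<close>, so the partition disappears.\<close>

lemma emeasure_volume_measure_chart:
  assumes U: "(U, \<phi>) \<in> A" and B: "B \<in> sets borel" "B \<subseteq> U"
  shows "emeasure \<Omega> B = chart_mass (U, \<phi>) B"
proof -
  obtain D where D: "chart_partition A D"
    and em: "\<And>B. B \<in> sets borel \<Longrightarrow> emeasure \<Omega> B = (\<Sum>k. chart_mass (snd (D k)) (B \<inter> fst (D k)))"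
    by (rule emeasure_volume_measure_partition) blast
  have Dk: "snd (D k) \<in> A" "fst (D k) \<in> sets borel" "fst (D k) \<subseteq> fst (snd (D k))" for k
    using D unfolding chart_partition_def by blast+
  have disj: "disjoint_family (\<lambda>k. fst (D k))" and un: "(\<Union>k. fst (D k)) = UNIV"
    using D unfolding chart_partition_def by blast+
  have "emeasure \<Omega> B = (\<Sum>k. chart_mass (U, \<phi>) (B \<inter> fst (D k)))"
    unfolding em[OF B(1)]
  proof (rule suminf_cong)
    fix k
    obtain V \<psi> where V: "snd (D k) = (V, \<psi>)" by fastforce
    show "chart_mass (snd (D k)) (B \<inter> fst (D k)) = chart_mass (U, \<phi>) (B \<inter> fst (D k))"
      unfolding V by (rule chart_mass_independent[OF U]) (use Dk[of k] B V in auto)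
  qed
  also have "\<dots> = chart_mass (U, \<phi>) (\<Union>k. B \<inter> fst (D k))"
  proof (rule chart_mass_suminf[OF U])
    show "disjoint_family (\<lambda>k. B \<inter> fst (D k))" using disj unfolding disjoint_family_on_def by blast
  qed (use B Dk(2) in auto)
  also have "(\<Union>k. B \<inter> fst (D k)) = B" using un by auto
  finally show ?thesis .
qed

lemma finite_volume_near:
  "\<exists>W. open W \<and> x \<in> W \<and> emeasure \<Omega> W < \<infinity>"
proof -
  obtain U \<phi> where U: "(U, \<phi>) \<in> A" "x \<in> U" by (rule chart_at[OF A])
  note c = chart_facts[OF A U(1)]
  obtain r where r: "r > 0" "cball (\<phi> x) r \<subseteq> \<phi> ` U" using c(2) U(2) open_contains_cball by (metis imageI)
  define W where "W = U \<inter> \<phi> -` ball (\<phi> x) r"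
  let ?\<rho> = "\<lambda>z. vol_density L R (U, \<phi>) (inv_into U \<phi> z)"
  have W: "open W" "x \<in> W" "W \<subseteq> U"
    using continuous_open_preimage[OF c(4,1) open_ball] U(2) r(1) by (auto simp: W_def)
  have "compact (?\<rho> ` cball (\<phi> x) r)"
    by (intro compact_continuous_image continuous_on_subset[OF vol_density_continuous[OF A U(1) L R] r(2)] compact_cball)
  then obtain M where M: "\<And>z. z \<in> cball (\<phi> x) r \<Longrightarrow> ?\<rho> z \<le> M"
    using compact_imp_bounded[of "?\<rho> ` cball (\<phi> x) r"] unfolding bounded_iff by (metis abs_le_D1 imageI real_norm_def)
  have "emeasure \<Omega> W = (\<integral>\<^sup>+ z\<in>\<phi> ` W. ennreal (?\<rho> z) \<partial>lborel)"
    using emeasure_volume_measure_chart[OF U(1) borel_open[OF W(1)] W(3)] by (simp add: chart_mass_def)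
  also have "\<dots> \<le> (\<integral>\<^sup>+ z. ennreal M * indicator (cball (\<phi> x) r) z \<partial>lborel)"
    by (intro nn_integral_mono) (auto simp: indicator_def W_def intro!: ennreal_leI M)
  also have "\<dots> = ennreal M * emeasure lborel (cball (\<phi> x) r)"
    by (rule nn_integral_cmult_indicator) simp
  also have "\<dots> < \<infinity>"
    using emeasure_bounded_finite[of "cball (\<phi> x) r"] by (simp add: ennreal_mult_less_top)
  finally show ?thesis using W by blast
qed

sublocale \<Omega>: finite_measure \<Omega>
proof
  have "\<exists>W. \<forall>x. open (W x) \<and> x \<in> W x \<and> emeasure \<Omega> (W x) < \<infinity>"
    using finite_volume_near by (intro choice allI) blast
  then obtain W where W: "\<And>x. open (W x)" "\<And>x. x \<in> W x" "\<And>x. emeasure \<Omega> (W x) < \<infinity>" by blast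
  have "UNIV \<subseteq> \<Union>(range W)" using W(2) by blast
  then obtain C where C: "finite C" "UNIV \<subseteq> (\<Union>x\<in>C. W x)"
    using compactE_image[OF compact_X, of UNIV W] W(1) by (metis subset_UNIV)
  have "open (\<Union>x\<in>C. W x)" using W(1) by auto
  then have "emeasure \<Omega> UNIV \<le> emeasure \<Omega> (\<Union>x\<in>C. W x)"
    using C(2) by (intro emeasure_mono) (auto simp: space_sets_volume_measure)
  also have "\<dots> \<le> (\<Sum>x\<in>C. emeasure \<Omega> (W x))"
    using C(1) W(1) by (intro emeasure_subadditive_finite) (auto simp: space_sets_volume_measure)
  also have "\<dots> < \<infinity>" using W(3) C(1) by (simp add: ennreal_sum_less_top)
  finally show "emeasure \<Omega> (space \<Omega>) \<noteq> \<infinity>" by (simp add: space_sets_volume_measure)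
qed

lemma volume_open_pos:
  assumes W: "open W" "W \<noteq> {}"
  shows "emeasure \<Omega> W \<noteq> 0"
proof
  assume 0: "emeasure \<Omega> W = 0"
  obtain x where "x \<in> W" using W(2) by blast
  obtain U \<phi> where U: "(U, \<phi>) \<in> A" "x \<in> U" by (rule chart_at[OF A])
  note c = chart_facts[OF A U(1)]
  let ?\<rho> = "\<lambda>z. vol_density L R (U, \<phi>) (inv_into U \<phi> z)"
  let ?B = "\<phi> ` (U \<inter> W)"
  have o: "open (U \<inter> W)" "open ?B" using c(1) W(1) open_chart_image[OF A U(1) W(1)] by auto
  have "emeasure \<Omega> (U \<inter> W) \<le> emeasure \<Omega> W"
    using W(1) by (intro emeasure_mono) (auto simp: space_sets_volume_measure)
  then have "(\<integral>\<^sup>+ z\<in>?B. ennreal (?\<rho> z) \<partial>lborel) = 0"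
    using 0 emeasure_volume_measure_chart[OF U(1) borel_open[OF o(1)]] by (simp add: chart_mass_def)
  moreover have "(\<lambda>z. ennreal (?\<rho> z) * indicator ?B z) \<in> borel_measurable borel"
    by (rule borel_measurable_ennreal_indicator[OF vol_density_continuous[OF A U(1) L R] borel_open[OF o(2)]]) auto
  ultimately have "AE z in lborel. ennreal (?\<rho> z) * indicator ?B z = 0"
    by (subst (asm) nn_integral_0_iff_AE) auto
  then have "AE z in lborel. z \<notin> ?B"
  proof (rule AE_mp, intro AE_I2 impI notI)
    fix z assume "ennreal (?\<rho> z) * indicator ?B z = 0" "z \<in> ?B"
    then have "ennreal (?\<rho> z) = 0" by simp
    moreover have "0 < ?\<rho> z" using \<open>z \<in> ?B\<close> by (intro vol_density_pos[OF A U(1) L R SGCS]) (auto simp: c(6))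
    ultimately show False by simp
  qed
  then have "?B \<in> null_sets lborel"
    using AE_iff_null_sets[of ?B lborel] o(2) by simp
  then have "negligible ?B" by (simp add: negligible_iff_null_sets null_sets_completionI)
  then show False using open_not_negligible[OF o(2)] \<open>x \<in> W\<close> U(2) by blast
qed

end

section \<open>Holomorphic sections on a compact manifold\<close>

lemma norm_vector_smult: "norm (c *s v) = cmod c * norm v" for v :: "complex^'n::finite"
  by (simp add: norm_vec_def L2_set_def norm_mult power_mult_distrib sum_distrib_left[symmetric] real_sqrt_mult)

locale hermitian_bundle =
  fixes A :: "('x::{t2_space,second_countable_topology}, 'n::finite) chart set"
    and F :: "('x, 'i) line_bundle" and Q :: "('x, 'i) herm_fun"
  assumes A: "complex_manifold A" and compact_X: "compact (UNIV :: 'x set)"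
    and F: "holomorphic_line_bundle A F" and Q: "positive_hermitian_algebraic A F Q"
begin

lemma Q_herm: "hermitian_algebraic A F Q"
  using Q by (simp add: positive_hermitian_algebraic_def)

lemmas lb = line_bundle_facts[OF F]
lemmas Q_facts = hermitian_facts[OF Q_herm]
lemmas Q_pos = positive_diagonal[OF F Q]

lemma H0_D:
  assumes "s \<in> H0 A F"
  shows "holo_on A (\<lambda>x. s x i) (lb_dom F i)" "x \<notin> lb_dom F i \<Longrightarrow> s x i = 0"
    "x \<in> lb_dom F i \<Longrightarrow> x \<in> lb_dom F j \<Longrightarrow> s x i = lb_trans F i j x * s x j"
proof -
  have h: "hol_section A F s" using assms by (simp add: H0_def)
  then show "holo_on A (\<lambda>x. s x i) (lb_dom F i)" by (simp add: hol_section_def)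
  have f: "s x \<in> fibre F x" using h by (simp add: hol_section_def)
  show "x \<notin> lb_dom F i \<Longrightarrow> s x i = 0" using fibreD(1)[OF f] .
  show "x \<in> lb_dom F i \<Longrightarrow> x \<in> lb_dom F j \<Longrightarrow> s x i = lb_trans F i j x * s x j" using fibreD(2)[OF f] .
qed

lemma H0_I:
  assumes "\<And>i. holo_on A (\<lambda>x. s x i) (lb_dom F i)" "\<And>x i. x \<notin> lb_dom F i \<Longrightarrow> s x i = 0"
    "\<And>x i j. x \<in> lb_dom F i \<Longrightarrow> x \<in> lb_dom F j \<Longrightarrow> s x i = lb_trans F i j x * s x j"
  shows "s \<in> H0 A F"
  unfolding H0_def hol_section_def mem_Collect_eq by (intro conjI allI fibreI assms)

lemma H0_lincomb:
  assumes "\<And>p. p \<in> P \<Longrightarrow> e p \<in> H0 A F"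
  shows "(\<lambda>x i. \<Sum>p\<in>P. c p * e p x i) \<in> H0 A F"
proof (rule H0_I)
  fix i
  show "holo_on A (\<lambda>x. \<Sum>p\<in>P. c p * e p x i) (lb_dom F i)"
    by (rule holo_on_sum[OF A lb(1)]) (rule holo_on_mult[OF holo_on_const[OF A lb(1)] H0_D(1)[OF assms]])
  show "(\<Sum>p\<in>P. c p * e p x i) = 0" if "x \<notin> lb_dom F i" for x
    using H0_D(2)[OF assms that] by (intro sum.neutral ballI) simp
  show "(\<Sum>p\<in>P. c p * e p x i) = lb_trans F i j x * (\<Sum>p\<in>P. c p * e p x j)"
    if x: "x \<in> lb_dom F i" "x \<in> lb_dom F j" for x j
    unfolding sum_distrib_left
  proof (rule sum.cong[OF refl])
    fix p assume "p \<in> P"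
    from H0_D(3)[OF assms[OF this] x] show "c p * e p x i = lb_trans F i j x * (c p * e p x j)" by simp
  qed
qed

lemma section_zero_iff:
  assumes "s \<in> H0 A F" "x \<in> lb_dom F i"
  shows "s x i = 0 \<longleftrightarrow> (\<forall>j. s x j = 0)"
  using H0_D(2)[OF assms(1), of x] H0_D(3)[OF assms(1), of x _ i] assms(2) by (metis mult_zero_right)

text \<open>The pointwise scalar product of sections, in the metric whose dual is \<open>h\<^sub>Q\<close>.\<close>

definition ip :: "('x \<Rightarrow> 'i \<Rightarrow> complex) \<Rightarrow> ('x \<Rightarrow> 'i \<Rightarrow> complex) \<Rightarrow> 'x \<Rightarrow> complex" where
  "ip s t x = (let i = idx F x in s x i * cnj (t x i) / Q (x, x) (i, i))"

lemma ip_eq2: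
  assumes "s \<in> H0 A F" "t \<in> H0 A F" "x \<in> lb_dom F i" "x \<in> lb_dom F j"
  shows "ip s t x = s x i * cnj (t x j) / Q (x, x) (i, j)"
proof -
  define k where "k = idx F x"
  have k: "x \<in> lb_dom F k" unfolding k_def by (rule lb(6))
  have "s x i = lb_trans F i k x * s x k" "t x j = lb_trans F j k x * t x k"
    "Q (x, x) (i, j) = lb_trans F i k x * cnj (lb_trans F j k x) * Q (x, x) (k, k)"
    using H0_D(3)[OF assms(1)] H0_D(3)[OF assms(2)] Q_facts(4) assms(3,4) k by blast+
  moreover have "lb_trans F i k x \<noteq> 0" "lb_trans F j k x \<noteq> 0" using lb(7) assms(3,4) k by blast+
  ultimately show ?thesis by (simp add: ip_def k_def[symmetric] Let_def)
qed

lemmas ip_eq = ip_eq2[where j = i and i = i for i]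

lemma continuous_diagonal: "continuous_on (lb_dom F i) (\<lambda>x. Q (x, x) (i, i))"
proof (rule continuous_at_imp_continuous_on[OF ballI])
  fix x assume x: "x \<in> lb_dom F i"
  obtain U \<phi> where U: "(U, \<phi>) \<in> A" "x \<in> U" by (rule chart_at[OF A])
  note c = chart_facts[OF A U(1)]
  let ?W = "U \<inter> lb_dom F i"
  have "continuous_on ?W (\<lambda>x. polar U \<phi> Q i (diag (\<phi> x)))"
  proof (rule continuous_on_compose2[OF cholo_on_continuous[OF polar_holo[OF A U(1) Q_herm]]])
    show "continuous_on ?W (\<lambda>x. diag (\<phi> x))"
      by (rule continuous_on_compose2[OF continuous_on_diag continuous_on_subset[OF c(4)]]) auto
  qed (auto simp: diag_bidomain)
  then have "continuous_on ?W (\<lambda>x. Q (x, x) (i, i))"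
    by (rule continuous_on_eq) (simp add: polar_diag[OF A U(1)])
  then show "isCont (\<lambda>x. Q (x, x) (i, i)) x"
    using x U(2) open_Int[OF c(1) lb(1)] by (simp add: continuous_on_eq_continuous_at)
qed

lemma continuous_ip:
  assumes s: "s \<in> H0 A F" and t: "t \<in> H0 A F"
  shows "continuous_on UNIV (ip s t)"
proof (rule continuous_at_imp_continuous_on[OF ballI])
  fix x
  define i where "i = idx F x"
  have x: "x \<in> lb_dom F i" unfolding i_def by (rule lb(6))
  have "continuous_on (lb_dom F i) (\<lambda>x. s x i * cnj (t x i) / Q (x, x) (i, i))"
    using Q_pos(2) by (intro continuous_on_divide continuous_on_mult continuous_on_cnj continuous_diagonal
      holo_on_continuous[OF A H0_D(1)[OF s]] holo_on_continuous[OF A H0_D(1)[OF t]]) fastforce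
  then have "continuous_on (lb_dom F i) (ip s t)"
    by (rule continuous_on_eq) (simp add: ip_eq[OF s t])
  then show "isCont (ip s t) x" using x lb(1) by (simp add: continuous_on_eq_continuous_at)
qed

lemma ip_self:
  assumes s: "s \<in> H0 A F" and x: "x \<in> lb_dom F i"
  shows "ip s s x = of_real ((cmod (s x i))\<^sup>2 / Re (Q (x, x) (i, i)))"
proof -
  have "ip s s x = of_real ((cmod (s x i))\<^sup>2) / of_real (Re (Q (x, x) (i, i)))"
    unfolding ip_eq[OF s s x x] complex_norm_square using Q_pos(1)[OF x] by simp
  then show ?thesis by simp
qed

lemma ip_self_nonneg: "s \<in> H0 A F \<Longrightarrow> 0 \<le> Re (ip s s x)"
  using ip_self[OF _ lb(6)] Q_pos(2)[OF lb(6), of x] by simp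

lemma ip_self_zero_iff: "s \<in> H0 A F \<Longrightarrow> Re (ip s s x) = 0 \<longleftrightarrow> (\<forall>j. s x j = 0)"
  using ip_self[OF _ lb(6)] Q_pos(2)[OF lb(6), of x] section_zero_iff[OF _ lb(6)] by fastforce

lemma cnj_ip: "cnj (ip s t x) = ip t s x"
proof -
  obtain q where "Q (x, x) (idx F x, idx F x) = of_real q" using Q_pos(1)[OF lb(6)] by blast
  then show ?thesis by (simp add: ip_def Let_def mult.commute)
qed

text \<open>Take a \<open>\<delta>\<close>-net of a coordinate ball of radius \<open>r\<close> and a section that vanishes on it.  On the complex line from a net point
  to a nearby point the section is a holomorphic function on a disc of radius \<open>r\<close> which vanishes at the
  centre, so by the Schwarz lemma its size at that point is at most \<open>\<delta> / r\<close> times its bound.  The oscillation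
  \<open>M1 / m\<close> of \<open>Q\<close> on the ball enters as a constant factor, and \<open>\<delta>\<close> is chosen to compensate for it.\<close>

lemma local_determination:
  "\<exists>W Z. open W \<and> p \<in> W \<and> finite Z \<and> (\<forall>s\<in>H0 A F. \<forall>M>0. (\<forall>y. Re (ip s s y) \<le> M) \<longrightarrow>
     (\<forall>z\<in>Z. \<forall>j. s z j = 0) \<longrightarrow> (\<forall>x\<in>W. Re (ip s s x) \<le> M / 2))"
proof -
  define i where "i = idx F p"
  have p: "p \<in> lb_dom F i" unfolding i_def by (rule lb(6))
  obtain U \<phi> where U: "(U, \<phi>) \<in> A" "p \<in> U" by (rule chart_at[OF A])
  note c = chart_facts[OF A U(1)]
  let ?O = "\<phi> ` (U \<inter> lb_dom F i)"
  define a where "a = \<phi> p"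
  have "open ?O" by (rule open_chart_image[OF A U(1) lb(1)])
  moreover have "a \<in> ?O" using p U(2) by (simp add: a_def)
  ultimately obtain r0 where r0: "r0 > 0" "cball a r0 \<subseteq> ?O" by (meson open_contains_cball)
  define r where "r = r0 / 2"
  have r: "r > 0" "cball a (2 * r) \<subseteq> ?O" using r0 by (simp_all add: r_def)
  have inv: "inv_into U \<phi> z \<in> U" "inv_into U \<phi> z \<in> lb_dom F i" if "z \<in> cball a (2 * r)" for z
    using that r(2) c(6) by auto
  define q where "q = (\<lambda>z. Re (Q (inv_into U \<phi> z, inv_into U \<phi> z) (i, i)))"
  have q_cont: "continuous_on (cball a (2 * r)) q" unfolding q_def
    by (intro continuous_on_Re continuous_on_compose2[OF continuous_diagonal] continuous_on_subset[OF c(5)]) (use inv r(2) in auto)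
  have q_pos: "0 < q z" if "z \<in> cball a (2 * r)" for z unfolding q_def by (rule Q_pos(2)[OF inv(2)[OF that]])
  have ne: "cball a (2 * r) \<noteq> {}" using r(1) by auto
  obtain z1 where z1: "z1 \<in> cball a (2 * r)" "\<And>z. z \<in> cball a (2 * r) \<Longrightarrow> q z1 \<le> q z"
    using continuous_attains_inf[OF compact_cball ne q_cont] by blast
  obtain z2 where z2: "z2 \<in> cball a (2 * r)" "\<And>z. z \<in> cball a (2 * r) \<Longrightarrow> q z \<le> q z2"
    using continuous_attains_sup[OF compact_cball ne q_cont] by blast
  define m where "m = q z1"
  define M1 where "M1 = q z2"
  have m: "0 < m" "m \<le> M1" "0 < M1" using q_pos[OF z1(1)] q_pos[OF z2(1)] z2(2)[OF z1(1)] by (auto simp: m_def M1_def)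
  define \<delta> where "\<delta> = r * sqrt (m / M1) / 2"
  have \<delta>: "0 < \<delta>" "\<delta>\<^sup>2 = r\<^sup>2 * (m / M1) / 4"
    using r(1) m by (simp_all add: \<delta>_def power_mult_distrib power_divide)
  obtain Z0 where Z0: "finite Z0" "Z0 \<subseteq> cball a r" "cball a r \<subseteq> (\<Union>z\<in>Z0. ball z \<delta>)"
  proof (rule compactE_image[OF compact_cball[of a r], of "cball a r" "\<lambda>z. ball z \<delta>"])
    show "cball a r \<subseteq> (\<Union>z\<in>cball a r. ball z \<delta>)" using \<delta>(1) by (meson UN_I centre_in_ball subsetI)
  qed auto
  define W where "W = U \<inter> \<phi> -` ball a r"
  have W: "open W" "p \<in> W"
    using continuous_open_preimage[OF c(4,1) open_ball] U(2) r(1) by (auto simp: W_def a_def)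
  have main: "Re (ip s s x) \<le> M / 2"
    if s: "s \<in> H0 A F" and M: "M > 0" "\<And>y. Re (ip s s y) \<le> M" and van: "\<And>z j. z \<in> inv_into U \<phi> ` Z0 \<Longrightarrow> s z j = 0"
      and x: "x \<in> W" for s M x
  proof -
    define h where "h = (\<lambda>z. s (inv_into U \<phi> z) i)"
    have h: "cholo_on h ?O" unfolding h_def by (rule holo_onD[OF H0_D(1)[OF s] U(1)])
    have h_sq: "(cmod (h z))\<^sup>2 = Re (ip s s (inv_into U \<phi> z)) * q z" if "z \<in> cball a (2 * r)" for z
      using ip_self[OF s inv(2)[OF that]] q_pos[OF that] by (simp add: h_def q_def)
    define B where "B = sqrt (2 * M * M1)"
    have B: "0 < B" "B\<^sup>2 = 2 * M * M1" using M(1) m by (auto simp: B_def)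
    have h_lt: "cmod (h z) < B" if z: "z \<in> cball a (2 * r)" for z
    proof -
      have "(cmod (h z))\<^sup>2 \<le> M * M1" unfolding h_sq[OF z]
        using M z2(2)[OF z] q_pos[OF z] ip_self_nonneg[OF s] by (intro mult_mono) (auto simp: M1_def)
      also have "\<dots> < B\<^sup>2" using B M(1) m by simp
      finally show ?thesis using B(1) by (simp add: power_less_imp_less_base)
    qed
    define z where "z = \<phi> x"
    have zx: "inv_into U \<phi> z = x" "z \<in> ball a r" using x c(6) by (auto simp: z_def W_def)
    have "z \<in> (\<Union>z\<in>Z0. ball z \<delta>)" using zx(2) Z0(3) by (meson ball_subset_cball subsetD)
    then obtain z0 where z0: "z0 \<in> Z0" "dist z0 z < \<delta>" by (auto simp: mem_ball)
    have z0a: "dist a z0 \<le> r" using z0(1) Z0(2) by auto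
    have hz0: "h z0 = 0" unfolding h_def using van z0(1) by auto
    define d where "d = norm (z - z0)"
    have z2r: "z \<in> cball a (2 * r)" using zx(2) r(1) by auto
    have "cmod (h z) \<le> B * \<delta> / r"
    proof (cases "d = 0")
      case True
      then have "z = z0" by (simp add: d_def)
      then show ?thesis using hz0 B(1) \<delta>(1) r(1) by simp
    next
      case False
      then have d: "d > 0" "d < \<delta>" using z0(2) by (auto simp: d_def dist_norm norm_minus_commute)
      define v where "v = of_real (r / d) *s (z - z0)"
      have nv: "norm (\<zeta> *s v) = cmod \<zeta> * r" for \<zeta>
      proof -
        have "\<zeta> *s v = (\<zeta> * of_real (r / d)) *s (z - z0)" by (simp add: v_def vec_eq_iff mult.assoc)
        then have "norm (\<zeta> *s v) = cmod (\<zeta> * of_real (r / d)) * d" by (simp only: norm_vector_smult d_def)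
        then show ?thesis using d r(1) by (simp add: norm_mult norm_divide)
      qed
      have inball: "z0 + \<zeta> *s v \<in> cball a (2 * r)" if "cmod \<zeta> < 1" for \<zeta>
      proof -
        have "dist a (z0 + \<zeta> *s v) \<le> dist a z0 + norm (\<zeta> *s v)"
          by (metis add.commute add_diff_cancel_left' dist_norm dist_triangle norm_minus_commute)
        also have "\<dots> \<le> r + 1 * r" unfolding nv using that z0a r(1) by (intro add_mono mult_right_mono) auto
        finally show ?thesis by simp
      qed
      define g where "g = (\<lambda>\<zeta>. h (z0 + \<zeta> *s v) / of_real B)"
      have "norm (g (of_real (d / r))) \<le> norm (of_real (d / r) :: complex)" if dr: "d < r"
      proof (rule Schwarz_Lemma(1))
        show "g holomorphic_on ball 0 1"
          unfolding g_def holomorphic_on_def field_differentiable_def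
        proof
          fix \<zeta> :: complex assume "\<zeta> \<in> ball 0 1"
          then have "z0 + \<zeta> *s v \<in> ?O" using inball r(2) by auto
          from has_field_derivative_at_within[OF DERIV_cdivide[OF cholo_on_line[OF h this]], of "of_real B" "ball 0 1"]
          show "\<exists>f'. ((\<lambda>\<zeta>. h (z0 + \<zeta> *s v) / of_real B) has_field_derivative f') (at \<zeta> within ball 0 1)" by blast
        qed
        show "g 0 = 0" using hz0 by (simp add: g_def)
        show "norm (g \<zeta>) < 1" if "norm \<zeta> < 1" for \<zeta>
          using h_lt[OF inball[OF that]] B(1) by (simp add: g_def norm_divide)
        show "norm (of_real (d / r) :: complex) < 1" using dr d(1) r(1) by (simp add: norm_divide)
      qed
      moreover have "\<delta> \<le> r"
      proof -
        have "\<delta>\<^sup>2 \<le> r\<^sup>2" unfolding \<delta>(2) using m r(1) by (simp add: field_simps mult_mono')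
        then show ?thesis by (rule power2_le_imp_le) (use r(1) in simp)
      qed
      moreover have "z0 + of_real (d / r) *s v = z" using d(1) r(1) by (simp add: v_def vec_eq_iff)
      ultimately have "cmod (h z) / B \<le> d / r" using d r(1) B(1) by (simp add: g_def norm_divide)
      then have "cmod (h z) \<le> B * d / r" using B(1) by (simp add: field_simps)
      also have "\<dots> \<le> B * \<delta> / r" using d(2) B(1) r(1) by (intro divide_right_mono mult_left_mono) auto
      finally show ?thesis .
    qed
    then have "(cmod (h z))\<^sup>2 \<le> (B * \<delta> / r)\<^sup>2" by (intro power_mono) auto
    also have "\<dots> = M * m / 2"
      using r(1) m by (simp add: power_divide power_mult_distrib B(2) \<delta>(2))
    also have "\<dots> \<le> M * q z / 2" using z1(2)[OF z2r] M(1) by (simp add: m_def)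
    finally have "Re (ip s s x) * q z \<le> M / 2 * q z" unfolding h_sq[OF z2r] zx(1) by simp
    then show ?thesis using q_pos[OF z2r] by (simp add: mult_le_cancel_right)
  qed
  show ?thesis
    by (intro exI[of _ W] exI[of _ "inv_into U \<phi> ` Z0"] conjI W finite_imageI Z0(1) ballI allI impI) (rule main, auto)
qed

text \<open>By compactness finitely many of these neighbourhoods suffice, and the estimate at a point where the norm of the
  section is maximal gives \<open>M \<le> M / 2\<close>.\<close>

lemma finite_determination:
  "\<exists>Z. finite Z \<and> (\<forall>s\<in>H0 A F. (\<forall>z\<in>Z. \<forall>j. s z j = 0) \<longrightarrow> (\<forall>x j. s x j = 0))"
proof -
  obtain W Z where WZ: "\<And>p. open (W p)" "\<And>p. p \<in> W p" "\<And>p. finite (Z p)"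
    "\<And>p s M x. s \<in> H0 A F \<Longrightarrow> M > 0 \<Longrightarrow> (\<forall>y. Re (ip s s y) \<le> M) \<Longrightarrow> (\<forall>z\<in>Z p. \<forall>j. s z j = 0) \<Longrightarrow> x \<in> W p \<Longrightarrow> Re (ip s s x) \<le> M / 2"
    using local_determination by metis
  obtain C where C: "finite C" "UNIV \<subseteq> (\<Union>p\<in>C. W p)"
    using compactE_image[OF compact_X, of UNIV W] WZ(1,2) by (metis UN_I UNIV_I subsetI)
  have "s x j = 0" if s: "s \<in> H0 A F" and van: "\<forall>z\<in>(\<Union>p\<in>C. Z p). \<forall>j. s z j = 0" for s x j
  proof -
    obtain x0 where x0: "\<And>y. Re (ip s s y) \<le> Re (ip s s x0)"
      using continuous_attains_sup[OF compact_X _ continuous_on_Re[OF continuous_ip[OF s s]]] by auto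
    define M where "M = Re (ip s s x0)"
    have "\<not> 0 < M"
    proof
      assume M: "0 < M"
      obtain p where "p \<in> C" "x0 \<in> W p" using C(2) by auto
      then have "M \<le> M / 2" using WZ(4)[OF s M, of p x0] van x0 unfolding M_def by blast
      then show False using M by simp
    qed
    then have "Re (ip s s x) = 0" using x0[of x] ip_self_nonneg[OF s, of x] by (simp add: M_def)
    then show ?thesis using ip_self_zero_iff[OF s] by blast
  qed
  then show ?thesis using C(1) WZ(3) by (intro exI[of _ "\<Union>p\<in>C. Z p"]) auto
qed

text \<open>In a determining set of least cardinality no point is superfluous, which produces the dual basis.  In particular
  \<open>H\<^sup>0(X, F)\<close> has finite dimension.\<close>

lemma interpolation_basis:
  obtains P e where "finite P" "\<And>p. p \<in> P \<Longrightarrow> e p \<in> H0 A F"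
    "\<And>p q. p \<in> P \<Longrightarrow> q \<in> P \<Longrightarrow> e p (fst q) (snd q) = (if p = q then 1 else 0)"
    "\<And>s x i. s \<in> H0 A F \<Longrightarrow> s x i = (\<Sum>p\<in>P. s (fst p) (snd p) * e p x i)"
proof -
  define determining where "determining = (\<lambda>P. finite P \<and> (\<forall>s\<in>H0 A F. (\<forall>p\<in>P. s (fst p) (snd p) = 0) \<longrightarrow> (\<forall>x j. s x j = 0)))"
  obtain Z where Z: "finite Z" "\<And>s. s \<in> H0 A F \<Longrightarrow> (\<forall>z\<in>Z. \<forall>j. s z j = 0) \<Longrightarrow> (\<forall>x j. s x j = 0)"
    using finite_determination by blast
  have "determining ((\<lambda>z. (z, idx F z)) ` Z)"
    unfolding determining_def
  proof (intro conjI ballI impI)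
    fix s assume s: "s \<in> H0 A F" and "\<forall>p\<in>(\<lambda>z. (z, idx F z)) ` Z. s (fst p) (snd p) = 0"
    then have "\<forall>z\<in>Z. \<forall>j. s z j = 0" using section_zero_iff[OF s lb(6)] by auto
    then show "\<forall>x j. s x j = 0" by (rule Z(2)[OF s])
  qed (use Z(1) in simp)
  then obtain P where P: "determining P" "\<And>P'. determining P' \<Longrightarrow> card P \<le> card P'"
    using ex_has_least_nat[of determining _ card] by blast
  have fin: "finite P" using P(1) by (simp add: determining_def)
  \<comment> \<open>By minimality every point of \<open>P\<close> is seen by a section vanishing at the other points.\<close>
  have "\<exists>s\<in>H0 A F. (\<forall>q\<in>P - {p}. s (fst q) (snd q) = 0) \<and> s (fst p) (snd p) = 1" if p: "p \<in> P" for p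
  proof -
    have "card (P - {p}) < card P" using p fin by (meson card_Diff1_less)
    then have "\<not> determining (P - {p})" using P(2)[of "P - {p}"] by linarith
    then obtain s where s: "s \<in> H0 A F" "\<forall>q\<in>P - {p}. s (fst q) (snd q) = 0" "\<not> (\<forall>x j. s x j = 0)"
      using fin by (auto simp: determining_def)
    define w where "w = s (fst p) (snd p)"
    have "w \<noteq> 0" using P(1) s unfolding determining_def w_def by (metis DiffI singletonD)
    moreover have "(\<lambda>x i. \<Sum>k\<in>{()}. inverse w * s x i) \<in> H0 A F" by (rule H0_lincomb) (rule s(1))
    ultimately show ?thesis using s(2) by (intro bexI[of _ "\<lambda>x i. inverse w * s x i"]) (auto simp: w_def)
  qed
  then obtain e where e: "\<And>p. p \<in> P \<Longrightarrow> e p \<in> H0 A F" "\<And>p q. p \<in> P \<Longrightarrow> q \<in> P - {p} \<Longrightarrow> e p (fst q) (snd q) = 0"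
    "\<And>p. p \<in> P \<Longrightarrow> e p (fst p) (snd p) = 1" by metis
  have dual: "e p (fst q) (snd q) = (if p = q then 1 else 0)" if "p \<in> P" "q \<in> P" for p q
    using e that by auto
  show ?thesis
  proof (rule that[OF fin e(1) dual])
    fix s x i assume s: "s \<in> H0 A F"
    define t where "t = (\<lambda>x i. \<Sum>b\<in>{True, False}. (if b then 1 else - 1) * (if b then s else (\<lambda>x i. \<Sum>p\<in>P. s (fst p) (snd p) * e p x i)) x i)"
    have t_eq: "t x i = s x i - (\<Sum>p\<in>P. s (fst p) (snd p) * e p x i)" for x i by (simp add: t_def)
    have t: "t \<in> H0 A F" unfolding t_def by (rule H0_lincomb) (use s H0_lincomb[of P e] e(1) in auto)
    have "t (fst q) (snd q) = 0" if q: "q \<in> P" for q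
    proof -
      have "(\<Sum>p\<in>P. s (fst p) (snd p) * e p (fst q) (snd q)) = (\<Sum>p\<in>P. s (fst p) (snd p) * (if p = q then 1 else 0))"
        by (intro sum.cong refl) (simp add: dual q)
      then show ?thesis using q fin by (simp add: t_eq if_distrib[of "\<lambda>x. _ * x"] cong: if_cong)
    qed
    then have "t x i = 0" using P(1) t unfolding determining_def by blast
    then show "s x i = (\<Sum>p\<in>P. s (fst p) (snd p) * e p x i)" by (simp add: t_eq)
  qed
qed

lemma slice_section: "(\<lambda>x i. Q (x, y) (i, j)) \<in> H0 A F"
proof (cases "y \<in> lb_dom F j")
  case True
  show ?thesis
  proof (rule H0_I)
    show "holo_on A (\<lambda>x. Q (x, y) (i, j)) (lb_dom F i)" for i
      by (rule holo_on_slice[OF A Q_facts(1) lb(1) True])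
    show "Q (x, y) (i, j) = 0" if "x \<notin> lb_dom F i" for x i using Q_facts(3) that by blast
    show "Q (x, y) (i, j) = lb_trans F i k x * Q (x, y) (k, j)" if "x \<in> lb_dom F i" "x \<in> lb_dom F k" for x i k
      using Q_facts(4)[OF that True True] lb(4)[OF True] by simp
  qed
next
  case False
  then have "(\<lambda>x i. Q (x, y) (i, j)) = (\<lambda>x i. \<Sum>p\<in>{}. 0 * Q (x, y) (i, j))" using Q_facts(3) by fastforce
  then show ?thesis using H0_lincomb[of "{}"] by simp
qed

text \<open>For a fixed second argument \<open>Q\<close> is a section in the first one.  The coefficients of its expansion are again
  slices of \<open>Q\<close>, conjugated by Hermitian symmetry, and can be expanded in turn.\<close>

lemma kernel_expansion:
  assumes P: "\<And>s x i. s \<in> H0 A F \<Longrightarrow> s x i = (\<Sum>p\<in>P. s (fst p) (snd p) * e p x i)"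
  shows "Q (x, y) (i, j) = (\<Sum>p\<in>P. \<Sum>q\<in>P. Q (fst p, fst q) (snd p, snd q) * e p x i * cnj (e q y j))"
proof -
  have "Q (x, y) (i, j) = (\<Sum>p\<in>P. Q (fst p, y) (snd p, j) * e p x i)"
    by (rule P[OF slice_section])
  also have "\<dots> = (\<Sum>p\<in>P. \<Sum>q\<in>P. Q (fst p, fst q) (snd p, snd q) * e p x i * cnj (e q y j))"
  proof (rule sum.cong[OF refl])
    fix p
    have "Q (fst p, y) (snd p, j) = cnj (Q (y, fst p) (j, snd p))" by (rule Q_facts(2))
    also have "Q (y, fst p) (j, snd p) = (\<Sum>q\<in>P. Q (fst q, fst p) (snd q, snd p) * e q y j)"
      by (rule P[OF slice_section])
    also have "cnj \<dots> = (\<Sum>q\<in>P. Q (fst p, fst q) (snd p, snd q) * cnj (e q y j))"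
      by (simp add: Q_facts(2)[of "fst p" _ "snd p"])
    finally show "Q (fst p, y) (snd p, j) * e p x i = (\<Sum>q\<in>P. Q (fst p, fst q) (snd p, snd q) * e p x i * cnj (e q y j))"
      by (simp add: sum_distrib_left sum_distrib_right mult_ac)
  qed
  finally show ?thesis .
qed

end

section \<open>The kernel form and sums of squares\<close>

locale hermitian_bundle_measure = hermitian_bundle A F Q + \<Omega>: finite_measure \<Omega>
  for A :: "('x::{t2_space,second_countable_topology}, 'n::finite) chart set"
    and F :: "('x, 'i) line_bundle" and Q :: "('x, 'i) herm_fun" and \<Omega> :: "'x measure" +
  assumes sets_\<Omega>: "sets \<Omega> = sets borel"
    and open_pos: "\<And>W. open W \<Longrightarrow> W \<noteq> {} \<Longrightarrow> emeasure \<Omega> W \<noteq> 0"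
begin

lemma integrable_continuous:
  fixes f :: "'x \<Rightarrow> complex"
  assumes "continuous_on UNIV f"
  shows "integrable \<Omega> f"
proof -
  have "bounded (range f)" using compact_imp_bounded[OF compact_continuous_image[OF assms compact_X]] .
  then obtain C where "\<And>x. norm (f x) \<le> C" unfolding bounded_iff by blast
  moreover have "f \<in> borel_measurable \<Omega>"
    using borel_measurable_continuous_onI[OF assms] by (simp add: measurable_cong_sets[OF sets_\<Omega> refl])
  ultimately show ?thesis by (intro \<Omega>.integrable_const_bound[where B = C]) auto
qed

lemma integrable_ip: "s \<in> H0 A F \<Longrightarrow> t \<in> H0 A F \<Longrightarrow> integrable \<Omega> (ip s t)"
  by (intro integrable_continuous continuous_ip)

definition l2_prod :: "('x \<Rightarrow> 'i \<Rightarrow> complex) \<Rightarrow> ('x \<Rightarrow> 'i \<Rightarrow> complex) \<Rightarrow> complex" where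
  "l2_prod s t = (\<integral>x. ip s t x \<partial>\<Omega>)"

lemma cnj_l2_prod: "cnj (l2_prod s t) = l2_prod t s"
proof -
  have "(\<integral>x. ip t s x \<partial>\<Omega>) = (\<integral>x. cnj (ip s t x) \<partial>\<Omega>)" by (simp only: cnj_ip)
  then show ?thesis unfolding l2_prod_def by simp
qed

lemma l2_norm_sq_eq:
  assumes s: "s \<in> H0 A F"
  shows "l2_norm_sq \<Omega> F Q s = Re (l2_prod s s)"
proof -
  have "fquot (herm_lb F) (x, x) (vtensor (s x) (vconj (s x))) (Q (x, x)) = ip s s x" for x
  proof -
    obtain i j where ij: "idx (herm_lb F) (x, x) = (i, j)" "x \<in> lb_dom F i" "x \<in> lb_dom F j"
      by (rule idx_herm_lb[OF F])
    show ?thesis unfolding ip_eq2[OF s s ij(2,3)] by (simp add: fquot_def ij(1) vtensor_def vconj_def)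
  qed
  then show ?thesis unfolding l2_norm_sq_def l2_prod_def
    by (simp add: integral_Re[OF integrable_ip[OF s s]])
qed

lemma l2_prod_self_nonneg: "s \<in> H0 A F \<Longrightarrow> 0 \<le> Re (l2_prod s s)"
  unfolding l2_prod_def
  by (subst integral_Re[symmetric]) (auto intro!: integral_nonneg_AE integrable_ip simp: ip_self_nonneg)

text \<open>A continuous nonnegative function with vanishing integral is zero, since \<open>\<Omega>\<close> charges open sets.\<close>

lemma l2_prod_self_pos:
  assumes s: "s \<in> H0 A F" and "\<exists>x j. s x j \<noteq> 0"
  shows "0 < Re (l2_prod s s)"
proof (rule ccontr)
  assume "\<not> 0 < Re (l2_prod s s)"
  then have "Re (l2_prod s s) = 0" using l2_prod_self_nonneg[OF s] by simp
  then have "(\<integral>x. Re (ip s s x) \<partial>\<Omega>) = 0" unfolding l2_prod_def by (simp add: integral_Re[OF integrable_ip[OF s s]])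
  then have AE0: "AE x in \<Omega>. Re (ip s s x) = 0"
    by (subst (asm) integral_nonneg_eq_0_iff_AE) (auto intro!: integrable_Re integrable_ip s ip_self_nonneg)
  let ?W = "{x. Re (ip s s x) \<noteq> 0}"
  have "?W = (\<lambda>x. Re (ip s s x)) -` (- {0})" by auto
  then have o: "open ?W"
    using open_vimage[OF _ continuous_on_Re[OF continuous_ip[OF s s]], of "- {0}"] by auto
  have "?W \<in> null_sets \<Omega>"
    using AE0 o by (subst AE_iff_null_sets) (auto simp: sets_\<Omega>)
  then have "?W = {}" using open_pos[OF o] by auto
  then show False using assms(2) ip_self_zero_iff[OF s] by auto
qed

lemma ip_lincomb_left: "ip (\<lambda>x i. \<Sum>p\<in>P. c p * e p x i) t x = (\<Sum>p\<in>P. c p * ip (e p) t x)"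
  unfolding ip_def Let_def sum_distrib_right sum_divide_distrib by (intro sum.cong refl) (simp add: mult.assoc)

lemma l2_prod_lincomb_left:
  assumes "\<And>p. p \<in> P \<Longrightarrow> e p \<in> H0 A F" "t \<in> H0 A F"
  shows "l2_prod (\<lambda>x i. \<Sum>p\<in>P. c p * e p x i) t = (\<Sum>p\<in>P. c p * l2_prod (e p) t)"
proof -
  have "l2_prod (\<lambda>x i. \<Sum>p\<in>P. c p * e p x i) t = (\<Sum>p\<in>P. (\<integral>x. c p * ip (e p) t x \<partial>\<Omega>))"
    unfolding l2_prod_def ip_lincomb_left by (rule Bochner_Integration.integral_sum) (intro integrable_mult_right integrable_ip assms)
  then show ?thesis by (simp add: l2_prod_def)
qed

lemma l2_prod_lincomb_right:
  assumes "\<And>p. p \<in> P \<Longrightarrow> e p \<in> H0 A F" "t \<in> H0 A F"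
  shows "l2_prod t (\<lambda>x i. \<Sum>p\<in>P. c p * e p x i) = (\<Sum>p\<in>P. cnj (c p) * l2_prod t (e p))"
  using arg_cong[where f = cnj, OF l2_prod_lincomb_left[OF assms, where c = c]] by (simp add: cnj_l2_prod)

text \<open>Continuous functions are bounded, so the finiteness of \<open>\<Omega>\<close> makes Fubini's theorem applicable.\<close>

lemma product_integral:
  fixes f g :: "'x \<Rightarrow> complex"
  assumes f: "continuous_on UNIV f" and g: "continuous_on UNIV g"
  shows "integrable (\<Omega> \<Otimes>\<^sub>M \<Omega>) (\<lambda>p. f (fst p) * g (snd p))"
    "(\<integral>p. f (fst p) * g (snd p) \<partial>(\<Omega> \<Otimes>\<^sub>M \<Omega>)) = (\<integral>x. f x \<partial>\<Omega>) * (\<integral>y. g y \<partial>\<Omega>)"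
proof -
  interpret P: pair_sigma_finite \<Omega> \<Omega> ..
  note fi = integrable_continuous[OF f] and gi = integrable_continuous[OF g]
  have [measurable]: "f \<in> borel_measurable \<Omega>" "g \<in> borel_measurable \<Omega>"
    using fi gi by auto
  show int: "integrable (\<Omega> \<Otimes>\<^sub>M \<Omega>) (\<lambda>p. f (fst p) * g (snd p))"
  proof (rule P.Fubini_integrable)
    show "(\<lambda>p. f (fst p) * g (snd p)) \<in> borel_measurable (\<Omega> \<Otimes>\<^sub>M \<Omega>)" by measurable
    show "integrable \<Omega> (\<lambda>x. \<integral>y. norm (f (fst (x, y)) * g (snd (x, y))) \<partial>\<Omega>)"
      using fi gi by (simp add: norm_mult)
    show "AE x in \<Omega>. integrable \<Omega> (\<lambda>y. f (fst (x, y)) * g (snd (x, y)))"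
      using gi by simp
  qed
  have "(\<integral>p. f (fst p) * g (snd p) \<partial>(\<Omega> \<Otimes>\<^sub>M \<Omega>)) = (\<integral>x. (\<integral>y. f x * g y \<partial>\<Omega>) \<partial>\<Omega>)"
    using P.integral_fst[of "\<lambda>x y. f x * g y"] int by (simp add: case_prod_unfold)
  then show "(\<integral>p. f (fst p) * g (snd p) \<partial>(\<Omega> \<Otimes>\<^sub>M \<Omega>)) = (\<integral>x. f x \<partial>\<Omega>) * (\<integral>y. g y \<partial>\<Omega>)"
    by simp
qed

text \<open>After the expansion of \<open>Q\<close> the integrand is a finite sum of products of a function of \<open>x\<close> and a function of \<open>y\<close>.\<close>

lemma K_form_expansion:
  assumes e: "\<And>p. p \<in> P \<Longrightarrow> e p \<in> H0 A F"
    and P: "\<And>s x i. s \<in> H0 A F \<Longrightarrow> s x i = (\<Sum>p\<in>P. s (fst p) (snd p) * e p x i)"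
    and s: "s \<in> H0 A F"
  shows "K_form \<Omega> F Q s s = quad_form P (\<lambda>p q. Q (fst p, fst q) (snd p, snd q)) (\<lambda>p. l2_prod (e p) s)"
proof -
  let ?c = "\<lambda>p q. Q (fst p, fst q) (snd p, snd q)"
  have H: "(case z of (x, y) \<Rightarrow> let i = idx F x; j = idx F y in
        Q (x, y) (i, j) * s y j * cnj (s x i) / (Q (x, x) (i, i) * Q (y, y) (j, j)))
      = (\<Sum>p\<in>P. \<Sum>q\<in>P. ?c p q * (ip (e p) s (fst z) * ip s (e q) (snd z)))" for z
  proof -
    obtain x y where z: "z = (x, y)" by fastforce
    have "Q (x, y) (i, j) * s y j * cnj (s x i) / (Q (x, x) (i, i) * Q (y, y) (j, j))
      = (\<Sum>p\<in>P. \<Sum>q\<in>P. ?c p q * ((e p x i * cnj (s x i) / Q (x, x) (i, i)) * (s y j * cnj (e q y j) / Q (y, y) (j, j))))" for i j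
    proof -
      have E: "Q (x, y) (i, j) = (\<Sum>p\<in>P. \<Sum>q\<in>P. ?c p q * e p x i * cnj (e q y j))"
        by (rule kernel_expansion[OF P])
      have "Q (x, y) (i, j) * w = (\<Sum>p\<in>P. \<Sum>q\<in>P. ?c p q * e p x i * cnj (e q y j) * w)" for w
        unfolding E sum_distrib_right ..
      from this[of "s y j * cnj (s x i) / (Q (x, x) (i, i) * Q (y, y) (j, j))"]
      show ?thesis by (simp add: mult_ac)
    qed
    then show ?thesis by (simp add: z ip_def Let_def)
  qed
  have "K_form \<Omega> F Q s s = (\<integral>z. (\<Sum>p\<in>P. \<Sum>q\<in>P. ?c p q * (ip (e p) s (fst z) * ip s (e q) (snd z))) \<partial>(\<Omega> \<Otimes>\<^sub>M \<Omega>))"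
    unfolding K_form_def by (rule Bochner_Integration.integral_cong[OF refl]) (rule H)
  also have "\<dots> = (\<Sum>p\<in>P. \<Sum>q\<in>P. ?c p q * (l2_prod (e p) s * l2_prod s (e q)))"
  proof -
    have pi: "integrable (\<Omega> \<Otimes>\<^sub>M \<Omega>) (\<lambda>z. ip (e p) s (fst z) * ip s (e q) (snd z))"
      "(\<integral>z. ip (e p) s (fst z) * ip s (e q) (snd z) \<partial>(\<Omega> \<Otimes>\<^sub>M \<Omega>)) = l2_prod (e p) s * l2_prod s (e q)"
      if "p \<in> P" "q \<in> P" for p q
      unfolding l2_prod_def by (rule product_integral[OF continuous_ip[OF e[OF that(1)] s] continuous_ip[OF s e[OF that(2)]]])+
    show ?thesis
      by (subst Bochner_Integration.integral_sum, intro Bochner_Integration.integrable_sum integrable_mult_right pi, assumption+,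
          intro sum.cong refl, subst Bochner_Integration.integral_sum, intro integrable_mult_right pi, assumption+,
          intro sum.cong refl) (simp add: pi)
  qed
  also have "\<dots> = quad_form P ?c (\<lambda>p. l2_prod (e p) s)"
    unfolding quad_form_def by (intro sum.cong refl) (simp add: cnj_l2_prod)
  finally show ?thesis .
qed

text \<open>The estimate bounds the quadratic form of \<open>c\<close> from below by \<open>(\<kappa> - \<epsilon>) \<parallel>s\<parallel>\<^sup>2\<close> on the vectors of scalar products with
  the basis, and these are all vectors.  Independence of the rows in the Cholesky factorization of \<open>c\<close> ensures that the
  resulting sections are distinct, as is required of the members of a set that is summed over.\<close>

theorem sum_of_squares_of_kernel_estimate:
  assumes est: "\<And>s. s \<in> H0 A F \<Longrightarrow>
      cmod (K_form \<Omega> F Q s s - of_real \<kappa> * of_real (l2_norm_sq \<Omega> F Q s)) \<le> \<epsilon> * l2_norm_sq \<Omega> F Q s"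
  shows "\<epsilon> < \<kappa> \<Longrightarrow> maximal_sum_of_squares A F Q" and "\<epsilon> \<le> \<kappa> \<Longrightarrow> sum_of_squares A F Q"
proof -
  obtain P e where fin: "finite P" and e: "\<And>p. p \<in> P \<Longrightarrow> e p \<in> H0 A F"
    and dual: "\<And>p q. p \<in> P \<Longrightarrow> q \<in> P \<Longrightarrow> e p (fst q) (snd q) = (if p = q then 1 else 0)"
    and P: "\<And>s x i. s \<in> H0 A F \<Longrightarrow> s x i = (\<Sum>p\<in>P. s (fst p) (snd p) * e p x i)"
    using interpolation_basis by blast
  define c where "c = (\<lambda>p q. Q (fst p, fst q) (snd p, snd q))"
  have comb_at: "(\<Sum>p\<in>P. a p * e p (fst q) (snd q)) = a q" if "q \<in> P" for a q
  proof -
    have "(\<Sum>p\<in>P. a p * e p (fst q) (snd q)) = (\<Sum>p\<in>P. if p = q then a p else 0)"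
      using that by (intro sum.cong refl) (simp add: dual)
    then show ?thesis using that fin by simp
  qed
  have K_lower: "(\<kappa> - \<epsilon>) * Re (l2_prod s s) \<le> Re (K_form \<Omega> F Q s s)" if s: "s \<in> H0 A F" for s
  proof -
    have "\<bar>Re (K_form \<Omega> F Q s s - of_real \<kappa> * of_real (l2_norm_sq \<Omega> F Q s))\<bar> \<le> \<epsilon> * l2_norm_sq \<Omega> F Q s"
      using abs_Re_le_cmod est[OF s] by (rule order_trans)
    then show ?thesis unfolding l2_norm_sq_eq[OF s] by (simp add: algebra_simps)
  qed
  \<comment> \<open>Every coefficient vector arises as the vector of scalar products of some section with the basis.\<close>
  define G where "G = (\<lambda>p q. l2_prod (e p) (e q))"
  define lc where "lc = (\<lambda>a x i. \<Sum>p\<in>P. a p * e p x i)"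
  have lc: "lc a \<in> H0 A F" for a unfolding lc_def by (rule H0_lincomb[OF e])
  have lc_right: "l2_prod s (lc a) = (\<Sum>p\<in>P. cnj (a p) * l2_prod s (e p))" if "s \<in> H0 A F" for s a
    unfolding lc_def by (rule l2_prod_lincomb_right[OF e that])
  have lc_left: "l2_prod (lc a) s = (\<Sum>p\<in>P. a p * l2_prod (e p) s)" if "s \<in> H0 A F" for s a
    unfolding lc_def by (rule l2_prod_lincomb_left[OF e that])
  have G_quad: "quad_form P G a = l2_prod (lc a) (lc a)" for a
    unfolding lc_left[OF lc] quad_form_def G_def
    by (intro sum.cong refl) (simp add: lc_right[OF e] sum_distrib_left mult_ac)
  have G_pd: "0 < Re (quad_form P G a)" if nz: "\<exists>j\<in>P. a j \<noteq> 0" for a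
    unfolding G_quad
  proof (rule l2_prod_self_pos[OF lc])
    obtain q where q: "q \<in> P" "a q \<noteq> 0" using nz by blast
    have "lc a (fst q) (snd q) \<noteq> 0" unfolding lc_def comb_at[OF q(1)] by (rule q(2))
    then show "\<exists>x j. lc a x j \<noteq> 0" by blast
  qed
  have G_psd: "0 \<le> Re (quad_form P G a)" for a unfolding G_quad by (rule l2_prod_self_nonneg[OF lc])
  have G_herm: "G q p = cnj (G p q)" for p q unfolding G_def by (simp add: cnj_l2_prod)
  obtain uG where uG: "rank_factorization P G P uG" "invertible_on P uG"
    using cholesky_decomposition[OF fin G_herm G_psd] G_pd by blast
  have surj: "\<exists>s\<in>H0 A F. \<forall>p\<in>P. l2_prod (e p) s = b p" for b
  proof -
    obtain \<beta> where \<beta>: "\<forall>p\<in>P. (\<Sum>i\<in>P. \<beta> i * uG i p) = b p" using uG(2) unfolding invertible_on_def by blast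
    obtain a where a: "\<forall>i\<in>P. (\<Sum>r\<in>P. uG i r * a r) = cnj (\<beta> i)"
      using uG(2)[unfolded invertible_on_def, THEN conjunct2, THEN spec[where x = "\<lambda>i. cnj (\<beta> i)"]] by blast
    have "l2_prod (e p) (lc a) = b p" if p: "p \<in> P" for p
    proof -
      have "l2_prod (e p) (lc a) = (\<Sum>r\<in>P. cnj (a r) * G p r)"
        unfolding lc_right[OF e[OF p]] G_def ..
      also have "\<dots> = (\<Sum>r\<in>P. \<Sum>i\<in>P. uG i p * cnj (uG i r * a r))"
        using uG(1) p unfolding rank_factorization_def by (intro sum.cong refl) (simp add: sum_distrib_left mult_ac)
      also have "\<dots> = (\<Sum>i\<in>P. uG i p * cnj (\<Sum>r\<in>P. uG i r * a r))"
        by (subst sum.swap) (simp add: sum_distrib_left)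
      also have "\<dots> = (\<Sum>i\<in>P. \<beta> i * uG i p)" using a by (intro sum.cong refl) (simp add: mult.commute)
      finally show ?thesis using \<beta> p by simp
    qed
    then show ?thesis using lc by blast
  qed
  have quad_lower: "\<exists>s\<in>H0 A F. (\<forall>p\<in>P. l2_prod (e p) s = b p) \<and> (\<kappa> - \<epsilon>) * Re (l2_prod s s) \<le> Re (quad_form P c b)" for b
  proof -
    obtain s where s: "s \<in> H0 A F" "\<forall>p\<in>P. l2_prod (e p) s = b p" using surj by blast
    have "quad_form P c b = quad_form P c (\<lambda>p. l2_prod (e p) s)"
      unfolding quad_form_def using s(2) by (intro sum.cong refl) simp
    then show ?thesis using s K_lower[OF s(1)] K_form_expansion[OF e P s(1)] unfolding c_def by auto
  qed
  have c_herm: "c q p = cnj (c p q)" for p q unfolding c_def by (rule Q_facts(2))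
  have psd: "0 \<le> Re (quad_form P c b)" if "\<epsilon> \<le> \<kappa>" for b
    using quad_lower[of b] that l2_prod_self_nonneg by (meson diff_ge_0_iff_ge mult_nonneg_nonneg order_trans)
  have pd: "0 < Re (quad_form P c b)" if "\<epsilon> < \<kappa>" "\<exists>j\<in>P. b j \<noteq> 0" for b
  proof -
    obtain s where s: "s \<in> H0 A F" "\<forall>p\<in>P. l2_prod (e p) s = b p" "(\<kappa> - \<epsilon>) * Re (l2_prod s s) \<le> Re (quad_form P c b)"
      using quad_lower by blast
    have "\<exists>x j. s x j \<noteq> 0"
    proof (rule ccontr)
      assume "\<not> ?thesis"
      then have "l2_prod (e p) s = 0" for p by (simp add: l2_prod_def ip_def Let_def)
      then show False using s(2) that(2) by auto
    qed
    then have "0 < Re (l2_prod s s)" by (rule l2_prod_self_pos[OF s(1)])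
    then have "0 < (\<kappa> - \<epsilon>) * Re (l2_prod s s)" using that(1) by simp
    then show ?thesis using s(3) by linarith
  qed
  have squares: "\<exists>S. finite S \<and> S \<subseteq> H0 A F \<and> is_square_sum Q S \<and> (\<epsilon> < \<kappa> \<longrightarrow> is_finite_basis (H0 A F) S)" if le: "\<epsilon> \<le> \<kappa>"
  proof -
    obtain J u where fac: "rank_factorization P c J u" and inv: "\<epsilon> < \<kappa> \<Longrightarrow> J = P \<and> invertible_on P u"
      using cholesky_decomposition[OF fin c_herm psd[OF le]] pd by blast
    have JP: "J \<subseteq> P" and c_eq: "\<And>p q. p \<in> P \<Longrightarrow> q \<in> P \<Longrightarrow> c p q = (\<Sum>i\<in>J. u i p * cnj (u i q))"
      and ind: "\<And>b. (\<forall>q\<in>P. (\<Sum>i\<in>J. b i * u i q) = 0) \<Longrightarrow> \<forall>i\<in>J. b i = 0"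
      using fac unfolding rank_factorization_def by blast+
    have finJ: "finite J" using JP fin finite_subset by blast
    define t where "t = (\<lambda>k x i. \<Sum>p\<in>P. u k p * e p x i)"
    have t: "t k \<in> H0 A F" for k unfolding t_def by (rule H0_lincomb[OF e])
    have t_at: "t k (fst q) (snd q) = u k q" if "q \<in> P" for k q unfolding t_def by (rule comb_at[OF that])
    have t_ind: "\<forall>i\<in>J. b i = 0" if "\<forall>x j. (\<Sum>k\<in>J. b k * t k x j) = 0" for b
    proof (rule ind, intro ballI)
      fix q assume q: "q \<in> P"
      have "(\<Sum>k\<in>J. b k * t k (fst q) (snd q)) = 0" using that by blast
      then show "(\<Sum>i\<in>J. b i * u i q) = 0" by (simp add: t_at[OF q])
    qed
    have inj: "inj_on t J"
    proof (rule inj_onI, rule ccontr)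
      fix k l assume kl: "k \<in> J" "l \<in> J" "t k = t l" "k \<noteq> l"
      have "(\<Sum>i\<in>J. (if i = k then 1 else if i = l then - 1 else 0) * t i x j) = 0" for x j
      proof -
        have "(\<Sum>i\<in>J. (if i = k then 1 else if i = l then - 1 else 0) * t i x j)
          = (\<Sum>i\<in>J. (if i = k then t k x j else 0) + (if i = l then - t l x j else 0))"
          using kl(4) by (intro sum.cong refl) auto
        also have "\<dots> = 0" using kl finJ by (simp add: sum.distrib)
        finally show ?thesis .
      qed
      then have "\<forall>i\<in>J. (if i = k then 1 else if i = l then - 1 else (0::complex)) = 0"
        by (intro t_ind) blast
      then show False using kl(1) by auto
    qed
    have sq: "is_square_sum Q (t ` J)"
      unfolding is_square_sum_def
    proof (intro allI ext)
      fix x and ij :: "'i \<times> 'i"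
      obtain i j where ij: "ij = (i, j)" by fastforce
      have "Q (x, x) (i, j) = (\<Sum>p\<in>P. \<Sum>q\<in>P. c p q * e p x i * cnj (e q x j))"
        unfolding c_def by (rule kernel_expansion[OF P])
      also have "\<dots> = (\<Sum>p\<in>P. \<Sum>q\<in>P. \<Sum>k\<in>J. (u k p * e p x i) * cnj (u k q * e q x j))"
        by (intro sum.cong refl) (simp add: c_eq sum_distrib_left sum_distrib_right mult_ac)
      also have "\<dots> = (\<Sum>k\<in>J. \<Sum>p\<in>P. \<Sum>q\<in>P. (u k p * e p x i) * cnj (u k q * e q x j))"
        by (subst (2) sum.swap, subst sum.swap) (rule refl)
      also have "\<dots> = (\<Sum>k\<in>J. t k x i * cnj (t k x j))"
        by (simp add: t_def sum_product)
      also have "\<dots> = (\<Sum>s\<in>t ` J. vtensor (s x) (vconj (s x)) ij)"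
        by (simp add: sum.reindex[OF inj] o_def ij vtensor_def vconj_def)
      finally show "Q (x, x) ij = (\<Sum>s\<in>t ` J. vtensor (s x) (vconj (s x)) ij)" by (simp add: ij)
    qed
    have basis: "is_finite_basis (H0 A F) (t ` J)" if lt: "\<epsilon> < \<kappa>"
      unfolding is_finite_basis_def
    proof (intro conjI allI impI ballI)
      show "finite (t ` J)" using finJ by simp
      show "t ` J \<subseteq> H0 A F" using t by auto
      fix d s assume "\<forall>x i. (\<Sum>s\<in>t ` J. d s * s x i) = 0" "s \<in> t ` J"
      then show "d s = 0" using t_ind[of "\<lambda>k. d (t k)"] by (auto simp: sum.reindex[OF inj] o_def)
    next
      fix s assume s: "s \<in> H0 A F"
      have "J = P" using inv[OF lt] by simp
      with inv[OF lt, THEN conjunct2, unfolded invertible_on_def, THEN conjunct1, THEN spec[where x = "\<lambda>p. s (fst p) (snd p)"]]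
      obtain a where a: "\<forall>p\<in>P. (\<Sum>k\<in>J. a k * u k p) = s (fst p) (snd p)" by auto
      have "s x i = (\<Sum>k\<in>J. a k * t k x i)" for x i
      proof -
        have "s x i = (\<Sum>p\<in>P. s (fst p) (snd p) * e p x i)" by (rule P[OF s])
        also have "\<dots> = (\<Sum>p\<in>P. (\<Sum>k\<in>J. a k * u k p) * e p x i)" using a by simp
        also have "\<dots> = (\<Sum>k\<in>J. \<Sum>p\<in>P. a k * u k p * e p x i)"
          unfolding sum_distrib_right by (rule sum.swap)
        finally show ?thesis by (simp add: t_def sum_distrib_left mult.assoc)
      qed
      then have "\<forall>x i. s x i = (\<Sum>r\<in>t ` J. a (inv_into J t r) * r x i)"
        by (simp add: sum.reindex[OF inj] o_def inv_into_f_f[OF inj])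
      then show "\<exists>d. \<forall>x i. s x i = (\<Sum>r\<in>t ` J. d r * r x i)" by (intro exI[of _ "\<lambda>r. a (inv_into J t r)"])
    qed
    show ?thesis using finJ t sq basis by (intro exI[of _ "t ` J"]) auto
  qed
  show "\<epsilon> < \<kappa> \<Longrightarrow> maximal_sum_of_squares A F Q"
    using squares unfolding maximal_sum_of_squares_def by (meson less_imp_le)
  show "\<epsilon> \<le> \<kappa> \<Longrightarrow> sum_of_squares A F Q"
    using squares unfolding sum_of_squares_def by meson
qed

end

section \<open>Maps to projective space\<close>

definition line_of :: "(nat \<Rightarrow> complex) \<Rightarrow> (nat \<Rightarrow> complex) set" where
  "line_of z = range (\<lambda>c i. c * z i)"

lemma line_of_scale:
  assumes "c \<noteq> 0"
  shows "line_of (\<lambda>i. c * z i) = line_of z"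
proof (intro set_eqI iffI)
  fix v assume "v \<in> line_of z"
  then obtain b where "v = (\<lambda>i. b * z i)" by (auto simp: line_of_def)
  then show "v \<in> line_of (\<lambda>i. c * z i)"
    unfolding line_of_def by (intro range_eqI[where x = "b / c"]) (use assms in simp)
next
  fix v assume "v \<in> line_of (\<lambda>i. c * z i)"
  then obtain b where "v = (\<lambda>i. b * (c * z i))" by (auto simp: line_of_def)
  then have "v = (\<lambda>i. (b * c) * z i)" by (simp add: mult.assoc)
  then show "v \<in> line_of z" unfolding line_of_def by blast
qed

lemma self_in_line_of: "z \<in> line_of z"
  unfolding line_of_def by (rule range_eqI[of _ _ 1]) simp

lemma line_of_in_proj_space: "\<exists>i. z i \<noteq> 0 \<Longrightarrow> \<forall>i>N. z i = 0 \<Longrightarrow> line_of z \<in> proj_space N"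
  unfolding proj_space_def line_of_def by blast

lemma line_of_affine_dom:
  assumes "line_of z \<in> proj_space N"
  shows "line_of z \<in> affine_dom N j \<longleftrightarrow> z j \<noteq> 0"
proof -
  have "(\<exists>v\<in>line_of z. v j \<noteq> 0) \<longleftrightarrow> z j \<noteq> 0"
  proof
    show "z j \<noteq> 0 \<Longrightarrow> \<exists>v\<in>line_of z. v j \<noteq> 0" using self_in_line_of by blast
  qed (auto simp: line_of_def)
  then show ?thesis using assms by (simp add: affine_dom_def)
qed

lemma affine_coord_line_of:
  assumes "z j \<noteq> 0"
  shows "affine_coord i j (line_of z) = z i / z j"
  unfolding affine_coord_def
proof (rule the_equality)
  show "\<forall>v\<in>line_of z. v i = z i / z j * v j" using assms by (auto simp: line_of_def)
  fix c assume "\<forall>v\<in>line_of z. v i = c * v j"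
  then have "z i = c * z j" using self_in_line_of by blast
  then show "c = z i / z j" using assms by simp
qed

lemma fibre_tautological:
  assumes l: "line_of z \<in> proj_space N" and z: "\<exists>i. z i \<noteq> 0" and f: "f x = line_of z"
  shows "fibre (pullback_lb f (tautological_lb N)) x = line_of z"
proof -
  have fib: "v \<in> fibre (pullback_lb f (tautological_lb N)) x \<longleftrightarrow>
      (\<forall>k. z k = 0 \<longrightarrow> v k = 0) \<and> (\<forall>k m. z k \<noteq> 0 \<and> z m \<noteq> 0 \<longrightarrow> v k = affine_coord k m (line_of z) * v m)" for v
    by (simp add: fibre_def pullback_lb_def tautological_lb_def f line_of_affine_dom[OF l])
  obtain m where m: "z m \<noteq> 0" using z by blast
  show ?thesis
  proof (intro set_eqI iffI)
    fix v assume v: "v \<in> fibre (pullback_lb f (tautological_lb N)) x"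
    have "v k = (v m / z m) * z k" for k
    proof (cases "z k = 0")
      case False
      then have "v k = affine_coord k m (line_of z) * v m" using v m unfolding fib by blast
      then show ?thesis by (simp add: affine_coord_line_of[where z = z and j = m, OF m])
    qed (use v in \<open>simp add: fib\<close>)
    then show "v \<in> line_of z" unfolding line_of_def by blast
  next
    fix v assume "v \<in> line_of z"
    then obtain c where "v = (\<lambda>k. c * z k)" by (auto simp: line_of_def)
    then show "v \<in> fibre (pullback_lb f (tautological_lb N)) x"
      unfolding fib by (simp add: affine_coord_line_of)
  qed
qed

context hermitian_bundle
begin

lemma dual_fibre_scale:
  "v \<in> fibre (dual_lb F) x \<Longrightarrow> (\<lambda>i. c * v i) \<in> fibre (dual_lb F) x"
  unfolding fibre_def by (simp add: mult.left_commute)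

text \<open>The squares \<open>t\<^sub>0, \<dots>, t\<^sub>N\<close> have no common zero because their sum is positive.  In any trivialization the point
  \<open>[t\<^sub>0(x) : \<dots> : t\<^sub>N(x)]\<close> is the same, and \<open>v \<mapsto> (t\<^sub>k(x) v)\<^sub>k\<close> maps the dual fibre onto the line it represents; the
  squared length of the image is \<open>\<Sum>\<^sub>k |t\<^sub>k(x) v|\<^sup>2 = Q(v, cnj v)\<close>.\<close>

theorem projective_map_of_sum_of_squares:
  assumes "sum_of_squares A F Q"
  shows "\<exists>N f. holomorphic_to_proj A N f \<and>
    hermitian_isomorphic A (dual_lb F) (metric_of F Q) (pullback_lb f (tautological_lb N)) (\<lambda>x. fubini_study N (f x))"
proof -
  obtain S where S: "finite S" "S \<subseteq> H0 A F" "is_square_sum Q S"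
    using assms unfolding sum_of_squares_def by blast
  have Q_S: "Q (x, x) (i, j) = (\<Sum>s\<in>S. s x i * cnj (s x j))" for x i j
    using S(3) unfolding is_square_sum_def by (simp add: vtensor_def vconj_def)
  have "S \<noteq> {}"
  proof
    assume "S = {}"
    then have "Q (x, x) (idx F x, idx F x) = 0" for x using Q_S by simp
    then show False using Q_pos(2)[OF lb(6)] by simp
  qed
  define N where "N = card S - 1"
  obtain t' where "bij_betw t' {..<card S} S" using ex_bij_betw_nat_finite[OF S(1)] atLeast0LessThan by metis
  moreover have "{..<card S} = {..N}" using \<open>S \<noteq> {}\<close> S(1) card_gt_0_iff[of S] by (auto simp: N_def)
  ultimately have bij: "bij_betw t' {..N} S" by simp
  define t where "t = (\<lambda>k x i. if k \<le> N then t' k x i else 0)"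
  have t: "t k \<in> H0 A F" if "k \<le> N" for k
    using that bij S(2) by (auto simp: t_def bij_betw_def)
  have t_zero: "k > N \<Longrightarrow> t k x i = 0" for k x i by (simp add: t_def)
  have Q_t: "Q (x, x) (i, j) = (\<Sum>k\<le>N. t k x i * cnj (t k x j))" for x i j
    unfolding Q_S sum.reindex_bij_betw[OF bij, symmetric] by (intro sum.cong) (auto simp: t_def)
  have t_trans: "t k x i = lb_trans F i j x * t k x j" if "x \<in> lb_dom F i" "x \<in> lb_dom F j" for k x i j
    using H0_D(3)[OF t that] by (cases "k \<le> N") (auto simp: t_zero)
  have ex_nz: "\<exists>k. t k x i \<noteq> 0" if "x \<in> lb_dom F i" for x i
  proof (rule ccontr)
    assume "\<nexists>k. t k x i \<noteq> 0"
    then have "Q (x, x) (i, i) = 0" by (simp add: Q_t)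
    then show False using Q_pos(2)[OF that] by simp
  qed
  define f where "f = (\<lambda>x. line_of (\<lambda>k. t k x (idx F x)))"
  have f_eq: "f x = line_of (\<lambda>k. t k x i)" if i: "x \<in> lb_dom F i" for x i
  proof -
    have "(\<lambda>k. t k x (idx F x)) = (\<lambda>k. lb_trans F (idx F x) i x * t k x i)"
      using t_trans[OF lb(6) i] by blast
    then show ?thesis unfolding f_def using line_of_scale[OF lb(7)[OF lb(6) i]] by simp
  qed
  have f_proj: "line_of (\<lambda>k. t k x i) \<in> proj_space N" if "x \<in> lb_dom F i" for x i
    by (rule line_of_in_proj_space[OF ex_nz[OF that]]) (simp add: t_zero)
  have f_dom: "f x \<in> affine_dom N j \<longleftrightarrow> t j x i \<noteq> 0" if "x \<in> lb_dom F i" for x i j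
    unfolding f_eq[OF that] by (rule line_of_affine_dom[OF f_proj[OF that]])
  have W_holo: "holo_on A (\<lambda>x. t j x i) (lb_dom F i)" if "j \<le> N" for i j
    by (rule H0_D(1)[OF t[OF that]])
  define W where "W = (\<lambda>i j. {x \<in> lb_dom F i. t j x i \<noteq> 0})"
  have oW: "open (W i j)" for i j
  proof (cases "j \<le> N")
    case True
    have "open (lb_dom F i \<inter> (\<lambda>x. t j x i) -` (- {0}))"
      by (rule continuous_open_preimage[OF holo_on_continuous[OF A W_holo[OF True]] lb(1)]) auto
    moreover have "W i j = lb_dom F i \<inter> (\<lambda>x. t j x i) -` (- {0})" by (auto simp: W_def)
    ultimately show ?thesis by simp
  qed (simp add: W_def t_zero)
  have pre: "f -` affine_dom N j = (\<Union>i. W i j)" for j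
    using f_dom lb(2) by (auto simp: W_def) blast
  have o_pre: "open (f -` affine_dom N j)" for j unfolding pre using oW by blast
  have holo: "holomorphic_to_proj A N f"
    unfolding holomorphic_to_proj_def
  proof (intro conjI allI impI)
    show "range f \<subseteq> proj_space N" using f_proj[OF lb(6)] by (auto simp: f_def)
    fix j i assume ji: "j \<le> N" "i \<le> N"
    show "holo_on A (\<lambda>x. affine_coord i j (f x)) (f -` affine_dom N j)"
    proof (rule holo_on_locally[OF A o_pre])
      fix x assume "x \<in> f -` affine_dom N j"
      then obtain k where k: "x \<in> W k j" unfolding pre by blast
      have sub: "W k j \<subseteq> lb_dom F k" by (auto simp: W_def)
      have "holo_on A (\<lambda>x. t i x k / t j x k) (W k j)"
        by (rule holo_on_divide[OF A holo_on_subset[OF A W_holo[OF ji(2)] oW sub] holo_on_subset[OF A W_holo[OF ji(1)] oW sub]])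
          (simp add: W_def)
      then have "holo_on A (\<lambda>x. affine_coord i j (f x)) (W k j)"
        by (rule holo_on_cong[OF A]) (auto simp: W_def f_eq affine_coord_line_of)
      then show "\<exists>W'. x \<in> W' \<and> holo_on A (\<lambda>x. affine_coord i j (f x)) W'" using k by blast
    qed
  qed
  define \<Psi> where "\<Psi> = (\<lambda>x v k. t k x (idx F x) * v (idx F x) :: complex)"
  have dual: "v i = inverse (lb_trans F i j x) * v j" if "v \<in> fibre (dual_lb F) x" "x \<in> lb_dom F i" "x \<in> lb_dom F j" for v x i j
    using fibreD(2)[OF that(1), of i j] that(2,3) by simp
  have \<Psi>_eq: "\<Psi> x v k = t k x i * v i" if v: "v \<in> fibre (dual_lb F) x" and i: "x \<in> lb_dom F i" for x v k i
    using t_trans[OF lb(6) i, of k] dual[OF v lb(6) i] lb(7)[OF lb(6) i] by (simp add: \<Psi>_def)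
  have "isometric_iso A (dual_lb F) (metric_of F Q) (pullback_lb f (tautological_lb N)) (\<lambda>x. fubini_study N (f x)) \<Psi>"
    unfolding isometric_iso_def
  proof (intro conjI allI ballI)
    fix x
    define i where "i = idx F x"
    have i: "x \<in> lb_dom F i" unfolding i_def by (rule lb(6))
    have fib: "fibre (pullback_lb f (tautological_lb N)) x = line_of (\<lambda>k. t k x i)"
      by (rule fibre_tautological[where z = "\<lambda>k. t k x i" and f = f and x = x and N = N, OF f_proj[OF i] ex_nz[OF i] f_eq[OF i]])
    show "bij_betw (\<Psi> x) (fibre (dual_lb F) x) (fibre (pullback_lb f (tautological_lb N)) x)"
      unfolding fib
    proof (rule bij_betw_imageI)
      show "inj_on (\<Psi> x) (fibre (dual_lb F) x)"
      proof (rule inj_onI)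
        fix v w assume v: "v \<in> fibre (dual_lb F) x" and w: "w \<in> fibre (dual_lb F) x" and eq: "\<Psi> x v = \<Psi> x w"
        obtain k where k: "t k x i \<noteq> 0" using ex_nz[OF i] by blast
        have "t k x i * v i = t k x i * w i" using fun_cong[OF eq, of k] \<Psi>_eq[OF v i] \<Psi>_eq[OF w i] by simp
        then have vi: "v i = w i" using k by simp
        show "v = w"
        proof
          fix j show "v j = w j"
            using dual[OF v _ i, of j] dual[OF w _ i, of j] fibreD(1)[OF v, of j] fibreD(1)[OF w, of j] vi
            by (cases "x \<in> lb_dom F j") auto
        qed
      qed
      show "\<Psi> x ` fibre (dual_lb F) x = line_of (\<lambda>k. t k x i)"
      proof (intro set_eqI iffI)
        fix u assume "u \<in> \<Psi> x ` fibre (dual_lb F) x"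
        then obtain v where v: "v \<in> fibre (dual_lb F) x" "u = \<Psi> x v" by blast
        have "u = (\<lambda>k. v i * t k x i)" unfolding v(2) using \<Psi>_eq[OF v(1) i] by (simp add: fun_eq_iff mult.commute)
        then show "u \<in> line_of (\<lambda>k. t k x i)" unfolding line_of_def by blast
      next
        fix u assume "u \<in> line_of (\<lambda>k. t k x i)"
        then obtain c where u: "u = (\<lambda>k. c * t k x i)" by (auto simp: line_of_def)
        let ?v = "\<lambda>j. c * frame (dual_lb F) i x j"
        have v: "?v \<in> fibre (dual_lb F) x" by (rule dual_fibre_scale[OF frame_in_dual_fibre(1)[OF F i]])
        have "u = \<Psi> x ?v" unfolding u using \<Psi>_eq[OF v i] frame_in_dual_fibre(2)[OF F i] by (simp add: fun_eq_iff mult.commute)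
        then show "u \<in> \<Psi> x ` fibre (dual_lb F) x" using v by blast
      qed
    qed
    fix v w assume v: "v \<in> fibre (dual_lb F) x" and w: "w \<in> fibre (dual_lb F) x"
    show "\<Psi> x (\<lambda>i. a * v i + b * w i) = (\<lambda>j. a * \<Psi> x v j + b * \<Psi> x w j)" for a b
      by (simp add: \<Psi>_def fun_eq_iff algebra_simps)
    have "fubini_study N (f x) (\<Psi> x v) (\<Psi> x w) = (\<Sum>k\<le>N. t k x i * cnj (t k x i)) * v i * cnj (w i)"
      unfolding fubini_study_def sum_distrib_right
      by (intro sum.cong refl) (simp add: \<Psi>_eq[OF v i] \<Psi>_eq[OF w i] mult_ac)
    then show "fubini_study N (f x) (\<Psi> x v) (\<Psi> x w) = metric_of F Q x v w"
      unfolding metric_of_def heval_eq[OF F Q_herm v w i i] Q_t .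
  next
    fix i j
    have W': "lb_dom (dual_lb F) i \<inter> lb_dom (pullback_lb f (tautological_lb N)) j = W i j"
      by (auto simp: pullback_lb_def tautological_lb_def W_def f_dom)
    have fr: "\<Psi> x (frame (dual_lb F) i x) j = t j x i" if "x \<in> W i j" for x
    proof -
      have xi: "x \<in> lb_dom F i" using that by (simp add: W_def)
      show ?thesis using \<Psi>_eq[OF frame_in_dual_fibre(1)[OF F xi] xi] frame_in_dual_fibre(2)[OF F xi] by simp
    qed
    show "holo_on A (\<lambda>x. \<Psi> x (frame (dual_lb F) i x) j) (lb_dom (dual_lb F) i \<inter> lb_dom (pullback_lb f (tautological_lb N)) j)"
      unfolding W'
    proof (cases "j \<le> N")
      case True
      show "holo_on A (\<lambda>x. \<Psi> x (frame (dual_lb F) i x) j) (W i j)"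
        by (rule holo_on_cong[OF A holo_on_subset[OF A W_holo[OF True] oW]]) (auto simp: W_def fr)
    next
      case False
      then have "W i j = {}" by (simp add: W_def t_zero)
      then show "holo_on A (\<lambda>x. \<Psi> x (frame (dual_lb F) i x) j) (W i j)" 
        using holo_on_cong[OF A holo_on_const[OF A open_empty, of 0]] by simp
    qed
  qed
  then show ?thesis using holo unfolding hermitian_isomorphic_def by blast
qed

end

section \<open>Tensor powers\<close>

lemma power_tensor_simps [simp]:
  "lb_dom (tensor_lb (power_lb L m) E) (i, k) = lb_dom L i \<inter> lb_dom E k"
  "lb_trans (tensor_lb (power_lb L m) E) (i, k) (j, l) x = lb_trans L i j x ^ m * lb_trans E k l x"
  by (simp_all add: tensor_lb_def power_lb_def)

lemma holomorphic_power_tensor: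
  assumes A: "complex_manifold A" and L: "holomorphic_line_bundle A L" and E: "holomorphic_line_bundle A E"
  shows "holomorphic_line_bundle A (tensor_lb (power_lb L m) E)"
proof -
  note l = line_bundle_facts[OF L] and e = line_bundle_facts[OF E]
  have 1: "open (lb_dom (tensor_lb (power_lb L m) E) i)" for i
    using l(1) e(1) by (cases i) auto
  have 2: "(\<Union>i. lb_dom (tensor_lb (power_lb L m) E) i) = UNIV"
  proof -
    have "x \<in> (\<Union>i. lb_dom (tensor_lb (power_lb L m) E) i)" for x
      using l(6)[of x] e(6)[of x] by (intro UN_I[of "(idx L x, idx E x)"]) auto
    then show ?thesis by blast
  qed
  have 3: "holo_on A (lb_trans (tensor_lb (power_lb L m) E) i j)
      (lb_dom (tensor_lb (power_lb L m) E) i \<inter> lb_dom (tensor_lb (power_lb L m) E) j)" for i j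
  proof -
    obtain a b c d where ij: "i = (a, b)" "j = (c, d)" by (cases i, cases j) auto
    let ?W = "lb_dom L a \<inter> lb_dom E b \<inter> (lb_dom L c \<inter> lb_dom E d)"
    have o: "open ?W" using l(1) e(1) by auto
    have "holo_on A (\<lambda>x. lb_trans L a c x ^ m * lb_trans E b d x) ?W"
      by (intro holo_on_mult holo_on_power holo_on_subset[OF A l(3) o] holo_on_subset[OF A e(3) o]) auto
    then show ?thesis unfolding ij power_tensor_simps(1) by (rule holo_on_cong[OF A]) simp
  qed
  show ?thesis
    unfolding holomorphic_line_bundle_def
  proof (intro conjI allI ballI 1 2 3)
    fix i x assume "x \<in> lb_dom (tensor_lb (power_lb L m) E) i"
    then show "lb_trans (tensor_lb (power_lb L m) E) i i x = 1" using l(4) e(4) by (cases i) auto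
  next
    fix i j k x assume x: "x \<in> lb_dom (tensor_lb (power_lb L m) E) i \<inter> lb_dom (tensor_lb (power_lb L m) E) j \<inter> lb_dom (tensor_lb (power_lb L m) E) k"
    obtain a b c d a' b' where ijk: "i = (a, b)" "j = (c, d)" "k = (a', b')" by (cases i, cases j, cases k) auto
    have "lb_trans L a c x * lb_trans L c a' x = lb_trans L a a' x"
      by (rule l(5)) (use x ijk in auto)
    moreover have "lb_trans E b d x * lb_trans E d b' x = lb_trans E b b' x"
      by (rule e(5)) (use x ijk in auto)
    moreover have "(p ^ m * q) * (p' ^ m * q') = (p * p') ^ m * (q * q')" for p q p' q' :: complex
      by (simp add: power_mult_distrib)
    ultimately show "lb_trans (tensor_lb (power_lb L m) E) i j x * lb_trans (tensor_lb (power_lb L m) E) j k x = lb_trans (tensor_lb (power_lb L m) E) i k x"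
      unfolding ijk power_tensor_simps(2) by (simp only:)
  qed
qed

lemma herm_power_mult_simp [simp]: "herm_power_mult R m P p ((i, k), (j, l)) = R p (i, j) ^ m * P p (k, l)"
  by (simp add: herm_power_mult_def)

text \<open>The exponent must be positive: the constant \<open>R\<^sup>0 = 1\<close> does not vanish at indices whose trivialization misses the point.\<close>

lemma positive_power_tensor:
  fixes A :: "('x::{t2_space,second_countable_topology}, 'n::finite) chart set"
    and L :: "('x, 'i) line_bundle" and E :: "('x, 'j) line_bundle"
    and R :: "('x, 'i) herm_fun" and P :: "('x, 'j) herm_fun"
  assumes A: "complex_manifold A" and L: "holomorphic_line_bundle A L" and E: "holomorphic_line_bundle A E"
    and R: "positive_hermitian_algebraic A L R" and P: "positive_hermitian_algebraic A E P" and m: "m \<ge> 1"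
  shows "positive_hermitian_algebraic A (tensor_lb (power_lb L m) E) (herm_power_mult R m P)"
proof -
  let ?F = "tensor_lb (power_lb L m) E" and ?Q = "herm_power_mult R m P"
  note l = line_bundle_facts[OF L] and e = line_bundle_facts[OF E]
  note F = holomorphic_power_tensor[OF A L E, of m]
  have Rh: "hermitian_algebraic A L R" and Ph: "hermitian_algebraic A E P"
    using R P by (auto simp: positive_hermitian_algebraic_def)
  note r = hermitian_facts[OF Rh] and p = hermitian_facts[OF Ph]
  have herm: "hermitian_algebraic A ?F ?Q"
    unfolding hermitian_algebraic_def hol_section_def
  proof (intro conjI allI)
    fix z :: "'x \<times> 'x"
    obtain x y where z: "z = (x, y)" by fastforce
    show "?Q z \<in> fibre (herm_lb ?F) z"
    proof (rule fibreI)
      fix ij assume n: "z \<notin> lb_dom (herm_lb ?F) ij"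
      obtain i k j q where ij: "ij = ((i, k), (j, q))" by (metis surj_pair)
      show "?Q z ij = 0" using n r(3)[of x i y j] p(3)[of x k y q] m unfolding ij z by auto
    next
      fix ij ij' assume n: "z \<in> lb_dom (herm_lb ?F) ij" "z \<in> lb_dom (herm_lb ?F) ij'"
      obtain i k j q where ij: "ij = ((i, k), (j, q))" by (metis surj_pair)
      obtain i' k' j' q' where ij': "ij' = ((i', k'), (j', q'))" by (metis surj_pair)
      have "x \<in> lb_dom L i" "x \<in> lb_dom E k" "y \<in> lb_dom L j" "y \<in> lb_dom E q"
        "x \<in> lb_dom L i'" "x \<in> lb_dom E k'" "y \<in> lb_dom L j'" "y \<in> lb_dom E q'"
        using n unfolding ij ij' z by auto
      then show "?Q z ij = lb_trans (herm_lb ?F) ij ij' z * ?Q z ij'"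
        unfolding ij ij' z by (simp add: r(4)[of x i i' y j j'] p(4)[of x k k' y q q'] power_mult_distrib mult_ac)
    qed
  next
    fix ij :: "('i \<times> 'j) \<times> ('i \<times> 'j)"
    obtain i k j q where ij: "ij = ((i, k), (j, q))" by (metis surj_pair)
    have "holo_on (prod_atlas A (conj_atlas A)) (\<lambda>z. R z (i, j) ^ m * P z (k, q)) ((lb_dom L i \<inter> lb_dom E k) \<times> (lb_dom L j \<inter> lb_dom E q))"
      by (intro holo_on_mult holo_on_power holo_on_prod_subset[OF A r(1)] holo_on_prod_subset[OF A p(1)]) (use l(1) e(1) in auto)
    then show "holo_on (prod_atlas A (conj_atlas A)) (\<lambda>z. ?Q z ij) (lb_dom (herm_lb ?F) ij)"
      unfolding ij by simp
  next
    fix x y and i j :: "'i \<times> 'j"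
    show "?Q (x, y) (i, j) = cnj (?Q (y, x) (j, i))"
      by (cases i; cases j) (simp add: r(2)[of x y] p(2)[of x y])
  qed
  have "0 < Re (heval ?F ?Q x v x v)" if v: "v \<in> fibre (dual_lb ?F) x" "v \<noteq> (\<lambda>_. 0)" for x v
  proof -
    let ?i = "(idx L x, idx E x)"
    have i: "x \<in> lb_dom ?F ?i" using l(6) e(6) by simp
    have "v ?i \<noteq> 0"
    proof
      assume 0: "v ?i = 0"
      have "v j = 0" for j
        using fibreD(1)[OF v(1), of j] fibreD(2)[OF v(1), of j ?i] i 0 by (cases "x \<in> lb_dom ?F j") (auto simp del: power_tensor_simps)
      then show False using v(2) by blast
    qed
    moreover have "?Q (x, x) (?i, ?i) = of_real (Re (R (x, x) (idx L x, idx L x)) ^ m * Re (P (x, x) (idx E x, idx E x)))"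
      using positive_diagonal(1)[OF L R l(6)] positive_diagonal(1)[OF E P e(6)] by (metis herm_power_mult_simp of_real_mult of_real_power)
    ultimately show ?thesis
      unfolding heval_eq[OF F herm v(1) v(1) i i]
      using positive_diagonal(2)[OF L R l(6), of x] positive_diagonal(2)[OF E P e(6), of x]
      by (simp add: mult.assoc complex_norm_square[symmetric] del: herm_power_mult_simp)
  qed
  then show ?thesis using herm by (simp add: positive_hermitian_algebraic_def)
qed

theorem corollary1:
  fixes A :: "('x::{t2_space,second_countable_topology}, 'n::finite) chart set"
    and L :: "('x, 'i) line_bundle" and E :: "('x, 'j) line_bundle"
    and R :: "('x, 'i) herm_fun" and P :: "('x, 'j) herm_fun"
    and C :: real
  defines "\<Omega> \<equiv> volume_measure A L R"
    and "F \<equiv> \<lambda>m::nat. tensor_lb (power_lb L m) E"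
    and "Q \<equiv> \<lambda>m::nat. herm_power_mult R m P"
  assumes "complex_manifold A" and "compact (UNIV :: 'x set)"
    and "holomorphic_line_bundle A L" and "holomorphic_line_bundle A E"
    and "positive_hermitian_algebraic A L R" and "positive_hermitian_algebraic A E P"
    and "SGCS A L R"
    and "C > 0"
    and "\<And>m s. m \<ge> 1 \<Longrightarrow> s \<in> H0 A (F m) \<Longrightarrow>
           cmod (K_form \<Omega> (F m) (Q m) s s
                 - of_real (pi ^ CARD('n) / real m ^ CARD('n)) * of_real (l2_norm_sq \<Omega> (F m) (Q m) s))
           \<le> C / real m ^ (CARD('n) + 1) * l2_norm_sq \<Omega> (F m) (Q m) s"
  shows "\<forall>m\<ge>1.
     (real m > C / pi ^ CARD('n) \<longrightarrow> maximal_sum_of_squares A (F m) (Q m)) \<and>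
     (real m \<ge> C / pi ^ CARD('n) \<longrightarrow> sum_of_squares A (F m) (Q m)) \<and>
     (real m \<ge> C / pi ^ CARD('n) \<longrightarrow>
        (\<exists>N f. holomorphic_to_proj A N f \<and>
           hermitian_isomorphic A (dual_lb (F m)) (metric_of (F m) (Q m))
             (pullback_lb f (tautological_lb N)) (\<lambda>x. fubini_study N (f x))))"
proof (intro allI impI)
  fix m :: nat assume m: "m \<ge> 1"
  interpret X: polarized_manifold A L R
    using assms(4,5,6,8,10) by (rule polarized_manifold.intro)
  interpret H: hermitian_bundle_measure A "F m" "Q m" \<Omega>
  proof (intro hermitian_bundle_measure.intro hermitian_bundle.intro hermitian_bundle_measure_axioms.intro)
    show "holomorphic_line_bundle A (F m)" unfolding F_def by (rule holomorphic_power_tensor[OF assms(4,6,7)])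
    show "positive_hermitian_algebraic A (F m) (Q m)"
      unfolding F_def Q_def by (rule positive_power_tensor[OF assms(4,6,7,8,9) m])
    show "finite_measure \<Omega>" unfolding \<Omega>_def by (rule X.\<Omega>.finite_measure_axioms)
    show "sets \<Omega> = sets borel" unfolding \<Omega>_def by (rule X.space_sets_volume_measure)
    show "emeasure \<Omega> W \<noteq> 0" if "open W" "W \<noteq> {}" for W unfolding \<Omega>_def using that by (rule X.volume_open_pos)
  qed fact+
  let ?\<kappa> = "pi ^ CARD('n) / real m ^ CARD('n)" and ?\<epsilon> = "C / real m ^ (CARD('n) + 1)"
  have m0: "0 < real m" using m by simp
  have le: "?\<epsilon> \<le> ?\<kappa> \<longleftrightarrow> real m \<ge> C / pi ^ CARD('n)" and lt: "?\<epsilon> < ?\<kappa> \<longleftrightarrow> real m > C / pi ^ CARD('n)"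
    using m0 by (simp_all add: field_simps)
  note squares = H.sum_of_squares_of_kernel_estimate[of ?\<kappa> ?\<epsilon>, OF assms(12)[OF m]]
  show "(real m > C / pi ^ CARD('n) \<longrightarrow> maximal_sum_of_squares A (F m) (Q m)) \<and>
     (real m \<ge> C / pi ^ CARD('n) \<longrightarrow> sum_of_squares A (F m) (Q m)) \<and>
     (real m \<ge> C / pi ^ CARD('n) \<longrightarrow>
        (\<exists>N f. holomorphic_to_proj A N f \<and>
           hermitian_isomorphic A (dual_lb (F m)) (metric_of (F m) (Q m))
             (pullback_lb f (tautological_lb N)) (\<lambda>x. fubini_study N (f x))))"
    using squares H.projective_map_of_sum_of_squares unfolding le lt by blast
qed

end
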